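(* Let $d,n\ge 1$ and let $X_1,\dots,X_n\in\mathbb{R}^d$ be a martingale difference sequence adapted to a filtration $\mathcal F_0,\mathcal F_1,\dots,\mathcal F_n$, with conditional covariances $V_k=\mathbb{E}[X_kX_k^\top\mid\mathcal F_{k-1}]$ almost surely. Let $S_n=\sum_{i=1}^n X_i$ and let $\Sigma_n=\mathrm{Var}(S_n)$ be its covariance matrix. Assume that $\sum_{i=1}^n V_i=\Sigma_n$ almost surely. Assume further that there are constants $\alpha,\beta,\gamma>0$ such that for all $k\in\{1,\dots,n\}$ $$\alpha I\preceq V_k\preceq\beta I\ \text{ almost surely},\qquad \mathbb{E}\big[\|X_k\|_2^3\big]\le\gamma d^{3/2}.$$ Let $Z\sim\mathcal N_d(0,I)$ and let $h:\mathbb{R}^d\to\mathbb{R}$ be a twice differentiable function with $M_2(h)<\infty$. Then $$\left|\mathbb{E}\big[h(\Sigma_n^{-1/2}S_n)\big]-\mathbb{E}[h(Z)]\right|\le\frac{3\pi\gamma\sqrt\beta}{4\alpha^2}\,M_2(h)\,\frac{d^2}{\sqrt n}.$$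
   Context: Martingale difference sequence: each $X_k$ is $\mathcal F_k$-measurable, square integrable, and $\mathbb{E}[X_k\mid\mathcal F_{k-1}]=0$ almost surely. $A\preceq B$ means that $B-A$ is positive semidefinite. $\|\cdot\|_2$ is the Euclidean norm on vectors. $\Sigma_n^{-1/2}$ is the inverse of the symmetric positive definite square root of $\Sigma_n$. For a twice differentiable $h:\mathbb{R}^d\to\mathbb{R}$, $$M_2(h)=\sup_{x,y\in\mathbb{R}^d,\,x\ne y}\frac{\|\nabla h(x)-\nabla h(y)\|_2}{\|x-y\|_2}.$$ $\mathcal N_d(0,I)$ is the standard Gaussian distribution on $\mathbb{R}^d$. *)

theory Defs
  imports "HOL-Probability.Probability"
begin

definition posdef :: "real^'d^'d \<Rightarrow> bool" where
  "posdef A \<longleftrightarrow> transpose A = A \<and> (\<forall>x. x \<noteq> 0 \<longrightarrow> 0 < x \<bullet> (A *v x))"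

definition possemidef :: "real^'d^'d \<Rightarrow> bool" where
  "possemidef A \<longleftrightarrow> transpose A = A \<and> (\<forall>x. 0 \<le> x \<bullet> (A *v x))"

definition loewner_le :: "real^'d^'d \<Rightarrow> real^'d^'d \<Rightarrow> bool"  (infix \<open>\<preceq>\<close> 50) where
  "A \<preceq> B \<longleftrightarrow> possemidef (B - A)"

definition posdef_sqrt :: "real^'d^'d \<Rightarrow> real^'d^'d" where
  "posdef_sqrt A = (THE R. posdef R \<and> R ** R = A)"

definition outer :: "real^'d \<Rightarrow> real^'d \<Rightarrow> real^'d^'d" where
  "outer x y = (\<chi> i j. x $ i * y $ j)"

definition covariance_matrix :: "'a measure \<Rightarrow> ('a \<Rightarrow> real^'d) \<Rightarrow> real^'d^'d" where
  "covariance_matrix M Y =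
     (let m = integral\<^sup>L M Y in integral\<^sup>L M (\<lambda>\<omega>. outer (Y \<omega> - m) (Y \<omega> - m)))"

definition vec_cond_exp ::
  "'a measure \<Rightarrow> 'a measure \<Rightarrow> ('a \<Rightarrow> real^'d) \<Rightarrow> 'a \<Rightarrow> real^'d" where
  "vec_cond_exp M G Y \<omega> = (\<chi> i. real_cond_exp M G (\<lambda>\<omega>. Y \<omega> $ i) \<omega>)"

definition mat_cond_exp ::
  "'a measure \<Rightarrow> 'a measure \<Rightarrow> ('a \<Rightarrow> real^'d^'d) \<Rightarrow> 'a \<Rightarrow> real^'d^'d" where
  "mat_cond_exp M G Y \<omega> = (\<chi> i j. real_cond_exp M G (\<lambda>\<omega>. Y \<omega> $ i $ j) \<omega>)"

text \<open>Only \<open>F 0, \<dots>, F n\<close> and \<open>X 1, \<dots>, X n\<close> are constrained below.\<close>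

definition finite_filtration :: "'a measure \<Rightarrow> nat \<Rightarrow> (nat \<Rightarrow> 'a measure) \<Rightarrow> bool" where
  "finite_filtration M n F \<longleftrightarrow>
     (\<forall>k\<le>n. subalgebra M (F k)) \<and> (\<forall>k\<le>n. \<forall>j\<le>k. subalgebra (F k) (F j))"

definition martingale_difference ::
  "'a measure \<Rightarrow> nat \<Rightarrow> (nat \<Rightarrow> 'a measure) \<Rightarrow> (nat \<Rightarrow> 'a \<Rightarrow> real^'d) \<Rightarrow> bool" where
  "martingale_difference M n F X \<longleftrightarrow>
     (\<forall>k\<in>{1..n}. X k \<in> borel_measurable (F k)
        \<and> integrable M (\<lambda>\<omega>. (norm (X k \<omega>))\<^sup>2)
        \<and> (AE \<omega> in M. vec_cond_exp M (F (k - 1)) (X k) \<omega> = 0))"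

text \<open>Density of \<open>N\<^sub>d(0, I)\<close> with respect to Lebesgue measure.\<close>

definition std_gaussian_density :: "real^'d \<Rightarrow> real" where
  "std_gaussian_density x = (\<Prod>i\<in>UNIV. std_normal_density (x $ i))"

definition gradient :: "(real^'d \<Rightarrow> real) \<Rightarrow> real^'d \<Rightarrow> real^'d" where
  "gradient h x = (THE g. GDERIV h x :> g)"

definition twice_differentiable :: "(real^'d \<Rightarrow> real) \<Rightarrow> bool" where
  "twice_differentiable h \<longleftrightarrow>
     (\<forall>x. h differentiable (at x)) \<and> (\<forall>x. gradient h differentiable (at x))"

definition M2 :: "(real^'d \<Rightarrow> real) \<Rightarrow> ennreal" where
  "M2 h = (SUP (x, y) \<in> {(x, y). x \<noteq> y}.
             ennreal (norm (gradient h x - gradient h y) / norm (x - y)))"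

end

theory Submission
  imports Defs
begin

text \<open>Lindeberg's method with a Gaussian smoothing that follows the conditional covariances. After
  replacing \<open>h\<close> by \<open>f(x) = h(\<Sigma>\<^sup>-\<^sup>1\<^sup>/\<^sup>2 x)\<close>, whose gradient is Lipschitz with constant
  \<open>L = M\<^sub>2(h)/(n \<alpha>)\<close>, put \<open>P\<^sub>k = \<Sigma> - V\<^sub>1 - \<dots> - V\<^sub>k\<close>, which is \<open>F\<^sub>k\<^sub>-\<^sub>1\<close>-measurable and at least
  \<open>(n - k) \<alpha> I\<close>, and telescope \<open>E f(S\<^sub>k + P\<^sub>k\<^sup>1\<^sup>/\<^sup>2 Z)\<close> from \<open>k = 0\<close> to \<open>k = n\<close>. Conditionally on
  \<open>F\<^sub>k\<^sub>-\<^sub>1\<close>, the \<open>k\<close>-th step replaces \<open>X\<^sub>k\<close> by a Gaussian vector with the same first two moments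
  inside a function smoothed by \<open>N(0, P\<^sub>k)\<close>, so only a third-order Taylor remainder of size
  \<open>L E|X\<^sub>k|\<^sup>3 / (2 ((n - k) \<alpha>)\<^sup>1\<^sup>/\<^sup>2)\<close> survives; the unsmoothed last step costs
  \<open>L E|X\<^sub>n|\<^sup>3 / \<alpha>\<^sup>1\<^sup>/\<^sup>2\<close>. Summing gives \<open>2 L \<gamma> d\<^sup>3\<^sup>/\<^sup>2 (n / \<alpha>)\<^sup>1\<^sup>/\<^sup>2\<close>, and \<open>2 \<le> 3 \<pi> / 4\<close>.\<close>

section \<open>Square roots of positive definite matrices\<close>

text \<open>Third-order accuracy is wanted from a function whose gradient is merely Lipschitz.
  Smoothing supplies the missing derivative: in the expansion of E f(x + R Z + u) with R = P^(1/2),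
  one differentiation falls on the Gaussian density and costs a factor |R^-1 u| <= |u| / sqrt l when
  P >= l I. This is where the lower bound \<alpha> on the V_k enters, and the sum of 1 / sqrt(n - k)
  is of order sqrt n. Almost surely P_k is V_(k+1) + ... + V_n, a sum over the future; it is known
  at time k - 1 because the total is the constant matrix \<Sigma>. Hence the coefficients of the
  expansion can be pulled out of the conditional expectation. The factor 1/2 per step is 1/6 + 2/6:
  the Taylor remainder 1/6 for X_k, and the same for the Gaussian vector V_k^(1/2) Z, whose third
  absolute moment is at most 2 (tr V_k)^(3/2), with E (tr V_k)^(3/2) <= E |X_k|^3 by Jensen. At k =
  n nothing is left to smooth with, so only a second-order estimate L E tr V_n is available; tr V_n
  >= \<alpha> turns it into a cubic one.\<close>

lemma symmetric_inner_matrix_vector: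
  fixes A :: "real^'d^'d"
  assumes "transpose A = A"
  shows "x \<bullet> (A *v y) = (A *v x) \<bullet> y"
  by (metis assms dot_lmul_matrix transpose_matrix_vector)

lemma nonneg_quadratic_linear_zero:
  fixes a b :: real
  assumes "\<And>t. 0 \<le> 2 * t * a + t\<^sup>2 * b"
  shows "a = 0"
proof (rule ccontr)
  assume a: "a \<noteq> 0"
  \<comment> \<open>The minimiser -a/b of the quadratic with b replaced by |b| + 1, which is
    positive whatever the sign of b; the upper bound becomes -a^2 / (|b| + 1).\<close>
  define t where "t = - a / (\<bar>b\<bar> + 1)"
  have "0 \<le> 2 * t * a + t\<^sup>2 * b" by (rule assms)
  also have "\<dots> \<le> 2 * t * a + t\<^sup>2 * (\<bar>b\<bar> + 1)" by (intro add_left_mono mult_left_mono) auto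
  also have "\<dots> = 2 * t * a + t * (t * (\<bar>b\<bar> + 1))" by (simp add: power2_eq_square)
  also have "\<dots> = - (a\<^sup>2 / (\<bar>b\<bar> + 1))" by (simp add: t_def power2_eq_square)
  also have "\<dots> < 0" using a by (simp add: add_nonneg_pos)
  finally show False by simp
qed

text \<open>A maximiser v of the Rayleigh quotient on the unit sphere of S works: the residual \<mu>
  v - A v lies in S by invariance and is orthogonal to S by the first-order condition, so it is
  orthogonal to itself.\<close>

lemma symmetric_matrix_eigenvector_in_subspace:
  fixes A :: "real^'d^'d"
  assumes sym: "transpose A = A" and S: "subspace S" "\<And>x. x \<in> S \<Longrightarrow> A *v x \<in> S" "S \<noteq> {0}"
  obtains v \<mu> where "v \<in> S" "norm v = 1" "A *v v = \<mu> *\<^sub>R v"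
proof -
  have cont: "continuous_on UNIV (\<lambda>x. x \<bullet> (A *v x))"
    by (intro continuous_intros matrix_vector_mult_linear_continuous_on)
  have comp: "compact (S \<inter> sphere 0 1)"
    using S(1) by (intro closed_Int_compact closed_subspace) auto
  obtain w where w: "w \<in> S" "w \<noteq> 0"
    using S(1,3) subspace_0 by blast
  have "w /\<^sub>R norm w \<in> S \<inter> sphere 0 1"
    using w S(1) by (simp add: subspace_scale)
  then have ne: "S \<inter> sphere 0 1 \<noteq> {}" by blast
  obtain v where v: "v \<in> S" "norm v = 1"
    and max: "\<And>x. x \<in> S \<Longrightarrow> norm x = 1 \<Longrightarrow> x \<bullet> (A *v x) \<le> v \<bullet> (A *v v)"
    using continuous_attains_sup[OF comp ne continuous_on_subset[OF cont]] by auto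
  define \<mu> where "\<mu> = v \<bullet> (A *v v)"
  have nonneg: "0 \<le> \<mu> * (x \<bullet> x) - x \<bullet> (A *v x)" if "x \<in> S" for x
  proof (cases "x = 0")
    case False
    have "(x /\<^sub>R norm x) \<bullet> (A *v (x /\<^sub>R norm x)) \<le> \<mu>"
      unfolding \<mu>_def using that False S(1) by (intro max) (auto simp: subspace_scale)
    then have "(x \<bullet> (A *v x)) / (norm x)\<^sup>2 \<le> \<mu>"
      by (simp add: matrix_vector_mult_scaleR power2_eq_square divide_inverse mult_ac)
    then show ?thesis
      using False by (simp add: field_simps power2_norm_eq_inner)
  qed simp
  \<comment> \<open>The form \<mu> |x|^2 - x . A x is nonnegative on S and vanishes at v, so its
    expansion at v + t y has no term linear in t.\<close>
  have orth: "y \<bullet> (\<mu> *\<^sub>R v - A *v v) = 0" if "y \<in> S" for y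
  proof (rule nonneg_quadratic_linear_zero)
    fix t :: real
    have "v + t *\<^sub>R y \<in> S" using v that S(1) by (simp add: subspace_add subspace_scale)
    then have "0 \<le> \<mu> * ((v + t *\<^sub>R y) \<bullet> (v + t *\<^sub>R y)) - (v + t *\<^sub>R y) \<bullet> (A *v (v + t *\<^sub>R y))"
      by (rule nonneg)
    also have "\<dots> = 2 * t * (y \<bullet> (\<mu> *\<^sub>R v - A *v v)) + t\<^sup>2 * (\<mu> * (y \<bullet> y) - y \<bullet> (A *v y))"
      using symmetric_inner_matrix_vector[OF sym, of v y] v(2)
      by (simp add: matrix_vector_right_distrib matrix_vector_mult_scaleR inner_simps algebra_simps
          power2_eq_square inner_commute \<mu>_def norm_eq_1)
    finally show "0 \<le> 2 * t * (y \<bullet> (\<mu> *\<^sub>R v - A *v v)) + t\<^sup>2 * (\<mu> * (y \<bullet> y) - y \<bullet> (A *v y))" .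
  qed
  have "\<mu> *\<^sub>R v - A *v v \<in> S"
    using v S by (simp add: subspace_diff subspace_scale)
  then have "\<mu> *\<^sub>R v - A *v v = 0"
    using orth by (metis inner_eq_zero_iff)
  then have "A *v v = \<mu> *\<^sub>R v" by simp
  then show thesis using that v by blast
qed

text \<open>The spectral theorem, stated for invariant subspaces so that induction on the dimension
  can pass to the orthogonal complement of one eigenvector; symmetry of A keeps that complement
  invariant.\<close>

lemma symmetric_matrix_orthonormal_eigenbasis_subspace:
  fixes A :: "real^'d^'d"
  assumes sym: "transpose A = A" and S: "subspace S" "\<And>x. x \<in> S \<Longrightarrow> A *v x \<in> S"
  shows "\<exists>B. finite B \<and> pairwise orthogonal B \<and> B \<subseteq> S \<and> S \<subseteq> span B \<and>
           (\<forall>b\<in>B. norm b = 1 \<and> (\<exists>c. A *v b = c *\<^sub>R b))"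
  using S
proof (induction "dim S" arbitrary: S rule: less_induct)
  case less
  show ?case
  proof (cases "S = {0}")
    case True
    then show ?thesis by (intro exI[of _ "{}"]) auto
  next
    case False
    obtain v \<mu> where v: "v \<in> S" "norm v = 1" "A *v v = \<mu> *\<^sub>R v"
      using symmetric_matrix_eigenvector_in_subspace[OF sym less.prems False] by metis
    define T where "T = {x \<in> S. x \<bullet> v = 0}"
    have T: "subspace T"
      using less.prems(1) unfolding T_def subspace_def by (auto simp: inner_simps)
    have TA: "A *v x \<in> T" if "x \<in> T" for x
      using that less.prems(2) symmetric_inner_matrix_vector[OF sym, of v x] v
      by (auto simp: T_def inner_commute)
    have "v \<notin> T" using v by (auto simp: T_def norm_eq_1)
    moreover have "T \<subseteq> S" by (auto simp: T_def)
    ultimately have "T \<subset> S" using v by blast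
    then have "dim T < dim S"
      using T less.prems(1) by (intro dim_psubset) (simp add: span_eq_iff[THEN iffD2])
    from less.hyps[OF this T TA] obtain B where B: "finite B" "pairwise orthogonal B" "B \<subseteq> T"
      "T \<subseteq> span B" "\<forall>b\<in>B. norm b = 1 \<and> (\<exists>c. A *v b = c *\<^sub>R b)" by blast
    have "x \<in> span (insert v B)" if "x \<in> S" for x
    proof -
      have "x - (x \<bullet> v) *\<^sub>R v \<in> T"
        using that v less.prems(1)
        by (auto simp: T_def subspace_diff subspace_scale inner_simps norm_eq_1)
      then have "x - (x \<bullet> v) *\<^sub>R v \<in> span B" using B by blast
      then show ?thesis by (auto simp: span_insert)
    qed
    then show ?thesis
      using B v \<open>T \<subset> S\<close>
      by (intro exI[of _ "insert v B"])
        (auto simp: pairwise_insert orthogonal_def T_def inner_commute)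
  qed
qed

text \<open>The functional calculus \<open>\<Phi>\<close> of a symmetric matrix with spectrum \<open>\<Lambda>\<close>.\<close>

lemma symmetric_matrix_functional_calculus:
  fixes A :: "real^'d^'d"
  assumes sym: "transpose A = A"
  obtains \<Phi> :: "(real \<Rightarrow> real) \<Rightarrow> real^'d^'d" and \<Lambda>
  where "\<And>f. transpose (\<Phi> f) = \<Phi> f"
    and "\<And>f g. \<Phi> f ** \<Phi> g = \<Phi> (\<lambda>c. f c * g c)"
    and "\<And>f g. \<Phi> f + \<Phi> g = \<Phi> (\<lambda>c. f c + g c)"
    and "\<And>f g. \<forall>c\<in>\<Lambda>. f c = g c \<Longrightarrow> \<Phi> f = \<Phi> g"
    and "\<Phi> (\<lambda>c. c) = A" and "\<And>r. \<Phi> (\<lambda>_. r) = r *\<^sub>R mat 1"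
    and "\<And>f x. \<forall>c\<in>\<Lambda>. 0 \<le> f c \<Longrightarrow> 0 \<le> x \<bullet> (\<Phi> f *v x)"
    and "\<And>c. c \<in> \<Lambda> \<Longrightarrow> \<exists>x. norm x = 1 \<and> A *v x = c *\<^sub>R x"
proof -
  obtain B where B: "finite B" "pairwise orthogonal B" "UNIV \<subseteq> span B"
    "\<forall>b\<in>B. norm b = 1 \<and> (\<exists>c. A *v b = c *\<^sub>R b)"
    using symmetric_matrix_orthonormal_eigenbasis_subspace[OF sym, of UNIV] by auto
  from B(4) obtain c where c: "\<And>b. b \<in> B \<Longrightarrow> A *v b = c b *\<^sub>R b" by metis
  define \<Phi> :: "(real \<Rightarrow> real) \<Rightarrow> real^'d^'d" where
    "\<Phi> f = (\<Sum>b\<in>B. f (c b) *\<^sub>R outer b b)" for f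
  have outer_mult: "outer a b *v x = (b \<bullet> x) *\<^sub>R a" for a b x :: "real^'d"
    by (simp add: vec_eq_iff outer_def matrix_vector_mult_def inner_vec_def sum_distrib_left mult_ac)
  have \<Phi>_mult: "\<Phi> f *v x = (\<Sum>b\<in>B. (f (c b) * (b \<bullet> x)) *\<^sub>R b)" for f x
  proof -
    have "\<Phi> f *v x = (\<Sum>b\<in>B. (f (c b) *\<^sub>R outer b b) *v x)"
      unfolding \<Phi>_def by (induction B rule: infinite_finite_induct)
        (auto simp: matrix_vector_mult_add_rdistrib)
    also have "\<dots> = (\<Sum>b\<in>B. (f (c b) * (b \<bullet> x)) *\<^sub>R b)"
      by (intro sum.cong refl) (simp add: scaleR_matrix_vector_assoc[symmetric] outer_mult)
    finally show ?thesis .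
  qed
  have \<Phi>_basis: "\<Phi> f *v b = f (c b) *\<^sub>R b" if "b \<in> B" for f b
  proof -
    have "\<Phi> f *v b = (\<Sum>b'\<in>B. if b' = b then f (c b) *\<^sub>R b else 0)"
      unfolding \<Phi>_mult using B(2,4) that
      by (intro sum.cong refl) (auto simp: pairwise_def orthogonal_def norm_eq_1)
    then show ?thesis using that B(1) by simp
  qed
  have ext: "P = Q" if "\<And>b. b \<in> B \<Longrightarrow> P *v b = Q *v b" for P Q :: "real^'d^'d"
  proof -
    have "P *v x = Q *v x" for x
      by (rule linear_eq_on_span[of "(*v) P" "(*v) Q" B]) (use that B(3) in auto)
    then show ?thesis by (simp add: matrix_eq)
  qed
  show thesis
  proof (rule that[of \<Phi> "c ` B"])
    show "transpose (\<Phi> f) = \<Phi> f" for f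
      by (simp add: \<Phi>_def vec_eq_iff transpose_def outer_def mult_ac)
    show "\<Phi> f ** \<Phi> g = \<Phi> (\<lambda>c. f c * g c)" for f g
      by (rule ext) (simp add: matrix_vector_mul_assoc[symmetric] \<Phi>_basis matrix_vector_mult_scaleR mult.commute)
    show "\<Phi> f + \<Phi> g = \<Phi> (\<lambda>c. f c + g c)" for f g
      by (simp add: \<Phi>_def sum.distrib algebra_simps)
    show "\<Phi> f = \<Phi> g" if "\<forall>x\<in>c ` B. f x = g x" for f g
      using that by (simp add: \<Phi>_def)
    show "\<Phi> (\<lambda>c. c) = A" by (rule ext) (simp add: \<Phi>_basis c)
    show "\<Phi> (\<lambda>_. r) = r *\<^sub>R mat 1" for r
      by (rule ext) (simp add: \<Phi>_basis scaleR_matrix_vector_assoc[symmetric])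
    show "0 \<le> x \<bullet> (\<Phi> f *v x)" if "\<forall>x\<in>c ` B. 0 \<le> f x" for f x
      unfolding \<Phi>_mult inner_sum_right using that
      by (intro sum_nonneg) (auto simp: inner_commute[of x] mult.assoc)
    show "\<exists>x. norm x = 1 \<and> A *v x = k *\<^sub>R x" if "k \<in> c ` B" for k
      using that B(4) c by blast
  qed
qed

section \<open>Matrix algebra, the Loewner order and the Frobenius inner product\<close>

lemma transpose_add_matrix: "transpose (A + B) = transpose A + transpose (B :: 'a::plus^'m^'n)"
  by (simp add: transpose_def vec_eq_iff)

lemma transpose_diff_matrix: "transpose (A - B) = transpose A - transpose (B :: 'a::minus^'m^'n)"
  by (simp add: transpose_def vec_eq_iff)

lemma transpose_scaleR_matrix: "transpose (c *\<^sub>R A) = c *\<^sub>R transpose (A :: real^'m^'n)"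
  by (simp add: transpose_def vec_eq_iff)

lemmas transpose_linear_simps = transpose_add_matrix transpose_diff_matrix transpose_scaleR_matrix

lemma matrix_add_rdistrib': "(A + B) ** C = A ** C + B ** (C :: 'a::semiring_1^'k^'m)"
  by (simp add: vec_eq_iff matrix_matrix_mult_def sum.distrib distrib_right)

lemma matrix_diff_ldistrib: "A ** (B - C) = A ** B - A ** (C :: 'a::ring_1^'k^'m)"
  by (simp add: vec_eq_iff matrix_matrix_mult_def sum_subtractf right_diff_distrib)

lemma matrix_diff_rdistrib: "(A - B) ** C = A ** C - B ** (C :: 'a::ring_1^'k^'m)"
  by (simp add: vec_eq_iff matrix_matrix_mult_def sum_subtractf left_diff_distrib)

lemma scaleR_mat_1_mult_vec: "(c *\<^sub>R mat 1) *v x = c *\<^sub>R (x :: real^'d)"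
  by (simp add: scaleR_matrix_vector_assoc[symmetric])

lemma scaleR_mat_1_loewner_le_iff:
  fixes A :: "real^'d^'d"
  shows "l *\<^sub>R mat 1 \<preceq> A \<longleftrightarrow> transpose A = A \<and> (\<forall>x. l * (norm x)\<^sup>2 \<le> x \<bullet> (A *v x))"
  by (auto simp: loewner_le_def possemidef_def transpose_linear_simps
      matrix_vector_mult_diff_rdistrib scaleR_mat_1_mult_vec inner_diff_right power2_norm_eq_inner)

lemma loewner_le_scaleR_mat_1_iff:
  fixes A :: "real^'d^'d"
  shows "A \<preceq> u *\<^sub>R mat 1 \<longleftrightarrow> transpose A = A \<and> (\<forall>x. x \<bullet> (A *v x) \<le> u * (norm x)\<^sup>2)"
  by (auto simp: loewner_le_def possemidef_def transpose_linear_simps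
      matrix_vector_mult_diff_rdistrib scaleR_mat_1_mult_vec inner_diff_right power2_norm_eq_inner)

lemma loewner_ge_add:
  fixes A B :: "real^'d^'d"
  assumes "l *\<^sub>R mat 1 \<preceq> A" "l' *\<^sub>R mat 1 \<preceq> B"
  shows "(l + l') *\<^sub>R mat 1 \<preceq> A + B"
  using assms by (auto simp: scaleR_mat_1_loewner_le_iff transpose_linear_simps
      matrix_vector_mult_add_rdistrib inner_add_right distrib_right intro!: add_mono)

lemma loewner_le_add:
  fixes A B :: "real^'d^'d"
  assumes "A \<preceq> u *\<^sub>R mat 1" "B \<preceq> u' *\<^sub>R mat 1"
  shows "A + B \<preceq> (u + u') *\<^sub>R mat 1"
  using assms by (auto simp: loewner_le_scaleR_mat_1_iff transpose_linear_simps
      matrix_vector_mult_add_rdistrib inner_add_right distrib_right intro!: add_mono)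

lemma loewner_le_imp_posdef:
  assumes "l *\<^sub>R mat 1 \<preceq> A" "0 < l"
  shows "posdef A"
  using assms unfolding scaleR_mat_1_loewner_le_iff posdef_def
  by (metis mult_pos_pos order_less_le_trans zero_less_norm_iff zero_less_power)

lemma posdef_imp_invertible:
  fixes A :: "real^'d^'d"
  assumes "posdef A"
  shows "invertible A"
  using assms unfolding posdef_def invertible_left_inverse matrix_left_invertible_ker
  by (metis inner_zero_right order_less_irrefl)

lemma matrix_inv_mult:
  fixes A :: "real^'d^'d"
  assumes "invertible A"
  shows "A ** matrix_inv A = mat 1" "matrix_inv A ** A = mat 1"
  using someI_ex[of "\<lambda>B. A ** B = mat 1 \<and> B ** A = mat 1"] assms
  unfolding invertible_def matrix_inv_def by auto

lemma matrix_inv_symmetric: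
  fixes A :: "real^'d^'d"
  assumes "invertible A" "transpose A = A"
  shows "transpose (matrix_inv A) = matrix_inv A"
proof -
  have "transpose (matrix_inv A) ** A = mat 1"
    by (metis assms matrix_inv_mult(1) matrix_transpose_mul transpose_mat)
  then show ?thesis
    by (metis assms(1) matrix_inv_mult(1) matrix_mul_assoc matrix_mul_lid matrix_mul_rid)
qed

text \<open>\<open>norm\<close> on matrices is the Frobenius norm, so this is Cauchy-Schwarz row by
  row. The same norm carries the inner product by which square roots are compared.\<close>

lemma norm_matrix_vector_mult_le:
  fixes A :: "real^'n^'m"
  shows "norm (A *v x) \<le> norm A * norm x"
proof -
  have "(A *v x) $ i = (A $ i) \<bullet> x" for i
    by (simp add: matrix_vector_mult_def inner_vec_def)
  then have "norm (A *v x) \<le> L2_set (\<lambda>i. norm (A $ i) * norm x) UNIV"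
    unfolding norm_vec_def[of "A *v x"] by (intro L2_set_mono) (auto simp: Cauchy_Schwarz_ineq2)
  also have "\<dots> = norm A * norm x"
    by (simp add: norm_vec_def[of A] L2_set_left_distrib)
  finally show ?thesis .
qed

text \<open>Both inner products are tr(D R D); writing it as a sum over the rows of D lets bounds on
  the quadratic form of R act on each row.\<close>

lemma inner_matrix_mult_left_right:
  fixes D R :: "real^'d^'d"
  assumes "transpose D = D" "transpose R = R"
  shows "D \<bullet> (D ** R) = (\<Sum>i\<in>UNIV. D $ i \<bullet> (R *v D $ i))"
    and "D \<bullet> (R ** D) = (\<Sum>i\<in>UNIV. D $ i \<bullet> (R *v D $ i))"
proof -
  have "(D ** R) $ i = R *v D $ i" for i
  proof -
    have "(D ** R) $ i = transpose R *v D $ i"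
      by (simp add: vec_eq_iff matrix_matrix_mult_def matrix_vector_mult_def transpose_def mult.commute)
    then show ?thesis using assms by simp
  qed
  then show 1: "D \<bullet> (D ** R) = (\<Sum>i\<in>UNIV. D $ i \<bullet> (R *v D $ i))"
    by (simp add: inner_vec_def[of D])
  have "D \<bullet> (R ** D) = transpose D \<bullet> transpose (R ** D)"
    unfolding inner_vec_def transpose_def by simp (rule sum.swap)
  also have "\<dots> = D \<bullet> (D ** R)" by (simp add: matrix_transpose_mul assms)
  finally show "D \<bullet> (R ** D) = (\<Sum>i\<in>UNIV. D $ i \<bullet> (R *v D $ i))" using 1 by simp
qed

text \<open>With \<open>D = R - T\<close>, the identity \<open>R\<^sup>2 - T\<^sup>2 = R D + D T\<close> gives
  \<open>\<langle>D, R\<^sup>2 - T\<^sup>2\<rangle> \<ge> (r + t) |D|\<^sup>2\<close> for lower bounds \<open>r\<close>, \<open>t\<close> of the quadratic forms.\<close>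

lemma inner_square_diff_ge:
  fixes R T :: "real^'d^'d"
  assumes sym: "transpose R = R" "transpose T = T"
  shows "(R - T) \<bullet> (R ** R - T ** T) = (\<Sum>i\<in>UNIV. (R - T) $ i \<bullet> (R *v (R - T) $ i)) +
     (\<Sum>i\<in>UNIV. (R - T) $ i \<bullet> (T *v (R - T) $ i))"
proof -
  have D: "transpose (R - T) = R - T" using sym by (simp add: transpose_linear_simps)
  have "R ** R - T ** T = R ** (R - T) + (R - T) ** T"
    by (simp add: matrix_diff_ldistrib matrix_diff_rdistrib)
  then show ?thesis
    using inner_matrix_mult_left_right[OF D] sym by (simp add: inner_add_right)
qed

text \<open>Makes the description in \<open>posdef_sqrt\<close> meaningful. Equal squares write 0 as
  a sum of two nonnegative row sums, and the first is positive if R and T differ in some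
  row.\<close>

lemma posdef_square_unique:
  fixes R T :: "real^'d^'d"
  assumes "posdef R" "posdef T" "R ** R = T ** T"
  shows "R = T"
proof (rule ccontr)
  assume "R \<noteq> T"
  then obtain i where i: "(R - T) $ i \<noteq> 0" by (auto simp: vec_eq_iff)
  have ge: "0 \<le> x \<bullet> (R *v x)" "0 \<le> x \<bullet> (T *v x)" for x
    using assms(1,2) by (cases "x = 0"; auto simp: posdef_def less_imp_le)+
  have "0 < (\<Sum>i\<in>UNIV. (R - T) $ i \<bullet> (R *v (R - T) $ i))"
    using i assms(1) by (intro sum_pos2[of _ i] ge) (auto simp: posdef_def simp del: vector_minus_component)
  moreover have "0 \<le> (\<Sum>i\<in>UNIV. (R - T) $ i \<bullet> (T *v (R - T) $ i))"
    by (intro sum_nonneg ge)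
  ultimately show False
    using inner_square_diff_ge[of R T] assms by (simp add: posdef_def)
qed

section \<open>Existence, bounds and continuity of the positive definite square root\<close>

lemma loewner_le_sqrt_exists:
  fixes A :: "real^'d^'d"
  assumes A: "l *\<^sub>R mat 1 \<preceq> A" and l: "0 < l"
  obtains R where "sqrt l *\<^sub>R mat 1 \<preceq> R" "R ** R = A"
proof -
  have sym: "transpose A = A" and ge: "l * (norm x)\<^sup>2 \<le> x \<bullet> (A *v x)" for x
    using A by (auto simp: scaleR_mat_1_loewner_le_iff)
  obtain \<Phi> :: "(real \<Rightarrow> real) \<Rightarrow> real^'d^'d" and \<Lambda> where
    \<Phi>: "\<And>f. transpose (\<Phi> f) = \<Phi> f" "\<And>f g. \<Phi> f ** \<Phi> g = \<Phi> (\<lambda>c. f c * g c)"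
      "\<And>f g. \<Phi> f + \<Phi> g = \<Phi> (\<lambda>c. f c + g c)"
      "\<And>f g. \<forall>c\<in>\<Lambda>. f c = g c \<Longrightarrow> \<Phi> f = \<Phi> g" "\<Phi> (\<lambda>c. c) = A" "\<And>r. \<Phi> (\<lambda>_. r) = r *\<^sub>R mat 1"
      "\<And>f x. \<forall>c\<in>\<Lambda>. 0 \<le> f c \<Longrightarrow> 0 \<le> x \<bullet> (\<Phi> f *v x)"
      "\<And>c. c \<in> \<Lambda> \<Longrightarrow> \<exists>x. norm x = 1 \<and> A *v x = c *\<^sub>R x"
    by (rule symmetric_matrix_functional_calculus[OF sym]) (rule that)
  have c: "l \<le> c" if c: "c \<in> \<Lambda>" for c
  proof -
    obtain x where x: "norm x = 1" "A *v x = c *\<^sub>R x" using \<Phi>(8) c by blast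
    then show ?thesis using ge[of x] by (simp add: dot_square_norm)
  qed
  \<comment> \<open>The summand sqrt l is split off on purpose: additivity of \<open>\<Phi>\<close>
    then exhibits R as sqrt l I plus a positive semidefinite matrix.\<close>
  define R where "R = \<Phi> (\<lambda>c. sqrt l + (sqrt c - sqrt l))"
  show thesis
  proof
    show "R ** R = A" unfolding R_def \<Phi>(2)
      using c l by (subst \<Phi>(5)[symmetric], intro \<Phi>(4)) force
    have "sqrt l * (norm x)\<^sup>2 \<le> x \<bullet> (R *v x)" for x
    proof -
      have "0 \<le> x \<bullet> (\<Phi> (\<lambda>c. sqrt c - sqrt l) *v x)"
        using c by (intro \<Phi>(7)) simp
      moreover have "R = sqrt l *\<^sub>R mat 1 + \<Phi> (\<lambda>c. sqrt c - sqrt l)"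
        unfolding R_def \<Phi>(3)[symmetric] \<Phi>(6) by (rule refl)
      ultimately show ?thesis
        by (simp add: matrix_vector_mult_add_rdistrib scaleR_mat_1_mult_vec inner_add_right power2_norm_eq_inner)
    qed
    then show "sqrt l *\<^sub>R mat 1 \<preceq> R"
      by (simp add: scaleR_mat_1_loewner_le_iff R_def \<Phi>(1))
  qed
qed

lemma posdef_sqrt_eqI:
  fixes A :: "real^'d^'d"
  assumes "posdef R" "R ** R = A"
  shows "posdef_sqrt A = R"
  unfolding posdef_sqrt_def using assms posdef_square_unique by (intro the_equality) auto

lemma posdef_sqrt_props:
  fixes A :: "real^'d^'d"
  assumes A: "l *\<^sub>R mat 1 \<preceq> A" and l: "0 < l"
  shows "sqrt l *\<^sub>R mat 1 \<preceq> posdef_sqrt A" (is ?A) "posdef_sqrt A ** posdef_sqrt A = A" (is ?B)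
    "transpose (posdef_sqrt A) = posdef_sqrt A" (is ?C) "invertible (posdef_sqrt A)" (is ?D)
proof -
  obtain R where R: "sqrt l *\<^sub>R mat 1 \<preceq> R" "R ** R = A"
    using loewner_le_sqrt_exists[OF A l] by blast
  have pd: "posdef R" using loewner_le_imp_posdef[OF R(1)] l by simp
  have "posdef_sqrt A = R" using posdef_sqrt_eqI[OF pd R(2)] .
  then show ?A ?B ?C ?D
    using R pd posdef_imp_invertible[OF pd] by (auto simp: posdef_def)
qed

lemma norm_posdef_sqrt_mult_vec:
  fixes A :: "real^'d^'d"
  assumes "l *\<^sub>R mat 1 \<preceq> A" "0 < l"
  shows "(norm (posdef_sqrt A *v x))\<^sup>2 = x \<bullet> (A *v x)"
proof -
  let ?R = "posdef_sqrt A"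
  have "(norm (?R *v x))\<^sup>2 = x \<bullet> (?R *v (?R *v x))"
    using symmetric_inner_matrix_vector[OF posdef_sqrt_props(3)[OF assms], of x "?R *v x"]
    by (simp add: power2_norm_eq_inner)
  then show ?thesis
    using posdef_sqrt_props(2)[OF assms] by (simp add: matrix_vector_mul_assoc)
qed

lemma norm_matrix_inv_posdef_sqrt_mult_vec_le:
  fixes A :: "real^'d^'d"
  assumes "l *\<^sub>R mat 1 \<preceq> A" "0 < l"
  shows "norm (matrix_inv (posdef_sqrt A) *v x) \<le> norm x / sqrt l"
proof -
  let ?R = "posdef_sqrt A" and ?y = "matrix_inv (posdef_sqrt A) *v x"
  have "?R *v ?y = x"
    using matrix_inv_mult(1)[OF posdef_sqrt_props(4)[OF assms]] by (simp add: matrix_vector_mul_assoc)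
  then have "l * (norm ?y)\<^sup>2 \<le> (norm x)\<^sup>2"
    using norm_posdef_sqrt_mult_vec[OF assms, of ?y] assms(1) by (simp add: scaleR_mat_1_loewner_le_iff)
  then have "(sqrt l * norm ?y)\<^sup>2 \<le> (norm x)\<^sup>2" using assms(2) by (simp add: power_mult_distrib)
  then have "sqrt l * norm ?y \<le> norm x" by (rule power2_le_imp_le) simp
  then show ?thesis using assms(2) by (simp add: field_simps)
qed

text \<open>With D the difference of the roots, 2 sqrt l |D|^2 <= <D, A - B> <= |D| |A - B|. The
  resulting continuity is what makes roots of random covariance matrices measurable.\<close>

lemma norm_posdef_sqrt_diff_le:
  fixes A B :: "real^'d^'d"
  assumes A: "l *\<^sub>R mat 1 \<preceq> A" and B: "l *\<^sub>R mat 1 \<preceq> B" and l: "0 < l"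
  shows "norm (posdef_sqrt A - posdef_sqrt B) \<le> norm (A - B) / (2 * sqrt l)"
proof -
  let ?R = "posdef_sqrt A" and ?T = "posdef_sqrt B"
  let ?D = "?R - ?T"
  have norm_D: "(norm ?D)\<^sup>2 = (\<Sum>i\<in>UNIV. (norm (?D $ i))\<^sup>2)"
    unfolding power2_norm_eq_inner by (simp add: inner_vec_def)
  have ge: "sqrt l * (norm ?D)\<^sup>2 \<le> (\<Sum>i\<in>UNIV. ?D $ i \<bullet> (W *v ?D $ i))"
    if "sqrt l *\<^sub>R mat 1 \<preceq> W" for W
    unfolding norm_D sum_distrib_left using that
    by (intro sum_mono) (simp add: scaleR_mat_1_loewner_le_iff)
  have "2 * sqrt l * (norm ?D)\<^sup>2 \<le> ?D \<bullet> (A - B)"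
    using inner_square_diff_ge[OF posdef_sqrt_props(3)[OF A l] posdef_sqrt_props(3)[OF B l]]
      ge[OF posdef_sqrt_props(1)[OF A l]] ge[OF posdef_sqrt_props(1)[OF B l]]
    by (simp add: posdef_sqrt_props(2)[OF A l] posdef_sqrt_props(2)[OF B l])
  also have "\<dots> \<le> norm ?D * norm (A - B)" by (rule norm_cauchy_schwarz)
  finally have "norm ?D * (2 * sqrt l * norm ?D) \<le> norm ?D * norm (A - B)"
    by (simp add: power2_eq_square mult_ac)
  then have "2 * sqrt l * norm ?D \<le> norm (A - B)"
    by (cases "norm ?D = 0") (auto simp: mult_le_cancel_left)
  then show ?thesis using l by (simp add: field_simps)
qed

lemma continuous_on_posdef_sqrt:
  assumes "0 < l"
  shows "continuous_on {A :: real^'d^'d. l *\<^sub>R mat 1 \<preceq> A} posdef_sqrt"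
proof (rule continuous_on_subset[OF lipschitz_on_continuous_on])
  show "(1 / (2 * sqrt l))-lipschitz_on {A :: real^'d^'d. l *\<^sub>R mat 1 \<preceq> A} posdef_sqrt"
    using assms norm_posdef_sqrt_diff_le[of l] by (intro lipschitz_onI) (auto simp: dist_norm)
qed simp

lemma matrix_component_eq_inner: "(A :: real^'m^'n) $ i $ j = axis i 1 \<bullet> (A *v axis j 1)"
  by (simp add: inner_axis' matrix_vector_mult_basis column_def)

text \<open>Resolvent identity R^-1 - T^-1 = R^-1 (T - R) T^-1: each inverse contributes 1 / sqrt l
  and the difference of roots 1 / (2 sqrt l). Entries are what the measurability of the Hessian asks
  for later.\<close>

lemma continuous_on_matrix_inv_posdef_sqrt:
  assumes l: "0 < l"
  shows "continuous_on {A :: real^'d^'d. l *\<^sub>R mat 1 \<preceq> A} (\<lambda>A. matrix_inv (posdef_sqrt A) $ i $ j)"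
proof (rule continuous_on_subset[OF lipschitz_on_continuous_on])
  show "(1 / (2 * sqrt l * l))-lipschitz_on {A :: real^'d^'d. l *\<^sub>R mat 1 \<preceq> A}
          (\<lambda>A. matrix_inv (posdef_sqrt A) $ i $ j)"
  proof (rule lipschitz_onI)
    fix A B :: "real^'d^'d"
    assume "A \<in> {A. l *\<^sub>R mat 1 \<preceq> A}" "B \<in> {A. l *\<^sub>R mat 1 \<preceq> A}"
    then have A: "l *\<^sub>R mat 1 \<preceq> A" and B: "l *\<^sub>R mat 1 \<preceq> B" by auto
    let ?R = "posdef_sqrt A" and ?T = "posdef_sqrt B"
    let ?R' = "matrix_inv ?R" and ?T' = "matrix_inv ?T"
    note R = matrix_inv_mult[OF posdef_sqrt_props(4)[OF A l]]
    note T = matrix_inv_mult[OF posdef_sqrt_props(4)[OF B l]]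
    have "?R' - ?T' = ?R' ** (?T ** ?T') - (?R' ** ?R) ** ?T'"
      by (simp add: R T)
    also have "\<dots> = ?R' ** ((?T - ?R) ** ?T')"
      by (simp add: matrix_diff_ldistrib matrix_diff_rdistrib matrix_mul_assoc)
    finally have eq: "?R' - ?T' = ?R' ** ((?T - ?R) ** ?T')" .
    have "norm (?R' $ i $ j - ?T' $ i $ j) = \<bar>(?R' - ?T') $ i $ j\<bar>" by simp
    also have "\<dots> \<le> norm (axis i 1 :: real^'d) * norm ((?R' - ?T') *v axis j 1)"
      unfolding matrix_component_eq_inner by (rule Cauchy_Schwarz_ineq2)
    also have "\<dots> = norm (?R' *v ((?T - ?R) *v (?T' *v axis j 1)))"
      unfolding eq by (simp add: matrix_vector_mul_assoc)
    also have "\<dots> \<le> norm ((?T - ?R) *v (?T' *v axis j 1)) / sqrt l"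
      by (rule norm_matrix_inv_posdef_sqrt_mult_vec_le[OF A l])
    also have "\<dots> \<le> norm (?T - ?R) * norm (?T' *v axis j 1) / sqrt l"
      using l by (intro divide_right_mono norm_matrix_vector_mult_le) simp
    also have "\<dots> \<le> (norm (B - A) / (2 * sqrt l)) * (norm (axis j 1 :: real^'d) / sqrt l) / sqrt l"
      using l by (intro divide_right_mono mult_mono norm_posdef_sqrt_diff_le[OF B A l]
          norm_matrix_inv_posdef_sqrt_mult_vec_le[OF B l]) auto
    also have "\<dots> = 1 / (2 * sqrt l * l) * dist A B"
      using l by (simp add: dist_norm norm_minus_commute)
    finally show "dist (?R' $ i $ j) (?T' $ i $ j) \<le> 1 / (2 * sqrt l * l) * dist A B"
      by (simp add: dist_norm)
  qed (use l in auto)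
qed simp

lemma closed_loewner_ge: "closed {A :: real^'d^'d. l *\<^sub>R mat 1 \<preceq> A}"
proof -
  have 1: "{A :: real^'d^'d. l *\<^sub>R mat 1 \<preceq> A} =
      {A. transpose A = A} \<inter> (\<Inter>x. {A. l * (norm x)\<^sup>2 \<le> x \<bullet> (A *v x)})"
    by (auto simp: scaleR_mat_1_loewner_le_iff)
  have 2: "{A :: real^'d^'d. transpose A = A} = (\<Inter>i j. {A. A $ i $ j = A $ j $ i})"
    by (auto simp: transpose_def vec_eq_iff)
  show ?thesis
    unfolding 1 2 by (intro closed_Int closed_INT ballI closed_Collect_eq closed_Collect_le)
      (auto simp: matrix_vector_mult_def inner_vec_def intro!: continuous_intros)
qed

lemma closed_loewner_le: "closed {A :: real^'d^'d. A \<preceq> u *\<^sub>R mat 1}"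
proof -
  have "{A :: real^'d^'d. A \<preceq> u *\<^sub>R mat 1} = uminus -` {A. (- u) *\<^sub>R mat 1 \<preceq> A}"
    by (auto simp: loewner_le_def)
  moreover have "closed (uminus -` {A :: real^'d^'d. (- u) *\<^sub>R mat 1 \<preceq> A})"
    by (intro closed_vimage closed_loewner_ge continuous_intros)
  ultimately show ?thesis by simp
qed

section \<open>The standard Gaussian measure\<close>

lemma orthogonal_transformation_borel_measurable:
  fixes T :: "'a::euclidean_space \<Rightarrow> 'a"
  assumes "orthogonal_transformation T"
  shows "T \<in> borel_measurable borel"
  using orthogonal_transformation_linear[OF assms]
  by (intro borel_measurable_continuous_onI linear_continuous_on linear_conv_bounded_linear[THEN iffD1])

lemma nn_integral_lborel_plus:
  fixes c :: "'a::euclidean_space"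
  assumes [measurable]: "f \<in> borel_measurable borel"
  shows "(\<integral>\<^sup>+x. f (x + c) \<partial>lborel) = (\<integral>\<^sup>+x. f x \<partial>lborel)"
  by (subst (2) lborel_distr_plus[of c, symmetric], subst nn_integral_distr) (auto simp: add.commute)

text \<open>The image measure is translation invariant, hence a multiple of Lebesgue measure; integrating
  \<open>indicator A (T x) * indicator (cball 0 1) (y - T x)\<close> in both orders identifies the factor,
  since \<open>T\<close> preserves the unit ball.\<close>

lemma distr_lborel_orthogonal_transformation:
  fixes T :: "'a::euclidean_space \<Rightarrow> 'a"
  assumes T: "orthogonal_transformation T"
  shows "distr lborel borel T = lborel"
proof (rule measure_eqI)
  have [measurable]: "T \<in> borel_measurable borel"
    by (rule orthogonal_transformation_borel_measurable[OF T])
  have lin: "linear T" by (rule orthogonal_transformation_linear[OF T])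
  fix A assume "A \<in> sets (distr lborel borel T)"
  then have A[measurable]: "A \<in> sets borel" by simp
  define f where "f x = (indicator A x :: ennreal)" for x
  define g where "g x = (indicator (cball 0 1) x :: ennreal)" for x :: 'a
  have [measurable]: "f \<in> borel_measurable borel" "g \<in> borel_measurable borel"
    unfolding f_def g_def by (intro borel_measurable_indicator A borel_closed closed_cball)+
  define c where "c = (\<integral>\<^sup>+y. g y \<partial>lborel)"
  have c: "c = emeasure lborel (cball 0 1 :: 'a set)"
    unfolding c_def g_def by (simp add: nn_integral_indicator)
  have shift: "(\<integral>\<^sup>+x. h (T x + y) \<partial>lborel) = (\<integral>\<^sup>+x. h (T x) \<partial>lborel)"
    if [measurable]: "h \<in> borel_measurable borel" for h :: "'a \<Rightarrow> ennreal" and y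
  proof -
    obtain z where z: "T z = y" using orthogonal_transformation_surj[OF T] by (metis surjD)
    have "(\<integral>\<^sup>+x. h (T x + y) \<partial>lborel) = (\<integral>\<^sup>+x. h (T (x + z)) \<partial>lborel)"
      using z linear_add[OF lin] by simp
    also have "\<dots> = (\<integral>\<^sup>+x. h (T x) \<partial>lborel)" by (rule nn_integral_lborel_plus) measurable
    finally show ?thesis .
  qed
  have "emeasure (distr lborel borel T) A * c = (\<integral>\<^sup>+x. f (T x) \<partial>lborel) * c"
    unfolding f_def by (subst nn_integral_distr[symmetric, where f="indicator A" and M'=borel])
      (auto simp: nn_integral_indicator)
  also have "\<dots> = (\<integral>\<^sup>+x. \<integral>\<^sup>+y. f (T x) * g (y - T x) \<partial>lborel \<partial>lborel)"
  proof -
    have "(\<integral>\<^sup>+y. g (y - T x) \<partial>lborel) = c" for x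
      unfolding c_def using nn_integral_lborel_plus[of g "- T x"] by simp
    then show ?thesis by (simp add: nn_integral_cmult nn_integral_multc)
  qed
  also have "\<dots> = (\<integral>\<^sup>+y. \<integral>\<^sup>+x. f (T x) * g (y - T x) \<partial>lborel \<partial>lborel)"
    by (rule lborel_pair.Fubini') measurable
  \<comment> \<open>For fixed y, translating x by a preimage of y under T turns y - T x into - T x,
    so that y survives in the factor f alone.\<close>
  also have "\<dots> = (\<integral>\<^sup>+y. \<integral>\<^sup>+x. f (T x + y) * g (- T x) \<partial>lborel \<partial>lborel)"
  proof (rule nn_integral_cong)
    fix y
    show "(\<integral>\<^sup>+x. f (T x) * g (y - T x) \<partial>lborel) = (\<integral>\<^sup>+x. f (T x + y) * g (- T x) \<partial>lborel)"
      using shift[of "\<lambda>x. f x * g (y - x)" y] by simp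
  qed
  also have "\<dots> = (\<integral>\<^sup>+x. \<integral>\<^sup>+y. f (T x + y) * g (- T x) \<partial>lborel \<partial>lborel)"
    by (rule lborel_pair.Fubini') measurable
  also have "\<dots> = (\<integral>\<^sup>+x. (\<integral>\<^sup>+y. f y \<partial>lborel) * g (- T x) \<partial>lborel)"
  proof (rule nn_integral_cong)
    fix x
    show "(\<integral>\<^sup>+y. f (T x + y) * g (- T x) \<partial>lborel) = (\<integral>\<^sup>+y. f y \<partial>lborel) * g (- T x)"
      using nn_integral_lborel_plus[of f "T x"] by (simp add: nn_integral_multc add.commute)
  qed
  also have "\<dots> = (\<integral>\<^sup>+y. f y \<partial>lborel) * (\<integral>\<^sup>+x. g (- T x) \<partial>lborel)"
    by (rule nn_integral_cmult) measurable
  also have "(\<integral>\<^sup>+x. g (- T x) \<partial>lborel) = c"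
    unfolding c_def using orthogonal_transformation_norm[OF T]
    by (intro nn_integral_cong) (auto simp: g_def indicator_def)
  also have "(\<integral>\<^sup>+y. f y \<partial>lborel) = emeasure lborel A"
    unfolding f_def by (simp add: nn_integral_indicator)
  finally have eq: "emeasure (distr lborel borel T) A * c = emeasure lborel A * c" .
  have "c \<noteq> \<top>" unfolding c using emeasure_lborel_cball_finite[of "0::'a" 1] by auto
  \<comment> \<open>The cube with sides 1 / DIM lies in the unit ball, its points having l1 norm at
    most 1, and has positive volume; so the factor c can be cancelled.\<close>
  moreover have "c \<noteq> 0"
  proof -
    have "emeasure lborel (box (0::'a) ((1 / real DIM('a)) *\<^sub>R One)) \<le> c"
      unfolding c
    proof (rule emeasure_mono)
      show "box (0::'a) ((1 / real DIM('a)) *\<^sub>R One) \<subseteq> cball 0 1"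
      proof
        fix x :: 'a assume x: "x \<in> box 0 ((1 / real DIM('a)) *\<^sub>R One)"
        have "norm x \<le> (\<Sum>b\<in>Basis. \<bar>x \<bullet> b\<bar>)" by (rule norm_le_l1)
        also have "\<dots> \<le> (\<Sum>b\<in>(Basis::'a set). 1 / real DIM('a))"
          using x by (intro sum_mono) (auto simp: box_def less_imp_le)
        finally show "x \<in> cball 0 1" by simp
      qed
    qed simp
    moreover have "0 < emeasure lborel (box (0::'a) ((1 / real DIM('a)) *\<^sub>R One))"
      by (subst emeasure_lborel_box_eq) (auto intro!: prod_pos)
    ultimately show ?thesis by auto
  qed
  ultimately show "emeasure (distr lborel borel T) A = emeasure lborel A"
    using eq by (metis ennreal_mult_divide_eq infinity_ennreal_def)
qed simp

text \<open>Stated for any Euclidean space, because rotation invariance is used both for one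
  standard Gaussian vector and for an independent pair of them.\<close>

lemma distr_density_norm_orthogonal_transformation:
  fixes T :: "'a::euclidean_space \<Rightarrow> 'a"
  assumes T: "orthogonal_transformation T" and [measurable]: "\<psi> \<in> borel_measurable borel"
  shows "distr (density lborel (\<lambda>x. \<psi> (norm x))) borel T = density lborel (\<lambda>x. \<psi> (norm x))"
proof (rule measure_eqI)
  have [measurable]: "T \<in> borel_measurable borel"
    by (rule orthogonal_transformation_borel_measurable[OF T])
  fix A assume "A \<in> sets (distr (density lborel (\<lambda>x. \<psi> (norm x))) borel T)"
  then have [measurable]: "A \<in> sets borel" by simp
  then have [measurable]: "T -` A \<in> sets borel"
    by (rule measurable_sets_borel[rotated]) measurable
  have "emeasure (distr (density lborel (\<lambda>x. \<psi> (norm x))) borel T) A =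
      (\<integral>\<^sup>+x. \<psi> (norm x) * indicator (T -` A) x \<partial>lborel)"
    by (simp add: emeasure_distr emeasure_density measurable_sets_borel)
  also have "\<dots> = (\<integral>\<^sup>+x. \<psi> (norm (T x)) * indicator A (T x) \<partial>lborel)"
    using orthogonal_transformation_norm[OF T] by (intro nn_integral_cong) (auto simp: indicator_def)
  also have "\<dots> = (\<integral>\<^sup>+x. \<psi> (norm x) * indicator A x \<partial>distr lborel borel T)"
    by (subst nn_integral_distr) auto
  also have "\<dots> = emeasure (density lborel (\<lambda>x. \<psi> (norm x))) A"
    by (simp add: distr_lborel_orthogonal_transformation[OF T] emeasure_density)
  finally show "emeasure (distr (density lborel (\<lambda>x. \<psi> (norm x))) borel T) A =
      emeasure (density lborel (\<lambda>x. \<psi> (norm x))) A" .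
qed simp

section \<open>Rotation invariance and moments of the standard Gaussian\<close>

definition gauss :: "(real^'d) measure" where
  "gauss = density lborel (\<lambda>x. ennreal (std_gaussian_density x))"

lemma sets_gauss [simp, measurable_cong]: "sets gauss = sets borel"
  by (simp add: gauss_def)

lemma space_gauss [simp]: "space gauss = UNIV"
  by (simp add: gauss_def)

lemma std_gaussian_density_eq_exp:
  "std_gaussian_density (x :: real^'d) = (1 / sqrt (2 * pi)) ^ CARD('d) * exp (- (norm x)\<^sup>2 / 2)"
proof -
  have "(\<Sum>i\<in>UNIV. - (x $ i)\<^sup>2 / 2) = - (norm x)\<^sup>2 / 2"
    unfolding power2_norm_eq_inner
    by (simp add: inner_vec_def sum_divide_distrib sum_negf power2_eq_square)
  moreover have "std_gaussian_density x =
      (1 / sqrt (2 * pi)) ^ CARD('d) * exp (\<Sum>i\<in>UNIV. - (x $ i)\<^sup>2 / 2)"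
    unfolding std_gaussian_density_def std_normal_density_def prod.distrib
    by (simp add: exp_sum)
  ultimately show ?thesis by simp
qed

lemma std_gaussian_density_nonneg [simp]: "0 \<le> std_gaussian_density x"
  by (simp add: std_gaussian_density_def prod_nonneg)

lemma std_gaussian_density_measurable [measurable]: "std_gaussian_density \<in> borel_measurable borel"
  unfolding std_gaussian_density_eq_exp[abs_def] by measurable

lemma distr_gauss_orthogonal_transformation:
  fixes T :: "real^'d \<Rightarrow> real^'d"
  assumes "orthogonal_transformation T"
  shows "distr gauss borel T = gauss"
  using distr_density_norm_orthogonal_transformation[OF assms,
      of "\<lambda>r. ennreal ((1 / sqrt (2 * pi)) ^ CARD('d) * exp (- r\<^sup>2 / 2))"]
  by (simp add: gauss_def std_gaussian_density_eq_exp[abs_def])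

lemma nn_integral_gauss_component:
  fixes i :: "'d::finite"
  assumes [measurable]: "f \<in> borel_measurable borel" and f: "\<And>x. 0 \<le> f x"
  shows "(\<integral>\<^sup>+z. ennreal (f (z $ i)) \<partial>gauss) = (\<integral>\<^sup>+x. ennreal (std_normal_density x * f x) \<partial>lborel)"
proof -
  \<comment> \<open>Lebesgue measure is a product over \<open>Basis\<close>; f is attached to the
    factor belonging to axis i, and each of the others integrates to 1.\<close>
  define F where "F b x = ennreal (std_normal_density x * (if b = axis i 1 then f x else 1))"
    for b :: "real^'d" and x
  have F: "F b \<in> borel_measurable borel" for b unfolding F_def by measurable
  have Basis_prod: "(\<Prod>b\<in>(Basis :: (real^'d) set). G b) = (\<Prod>j\<in>UNIV. G (axis j 1))" for G :: "_ \<Rightarrow> ennreal"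
    unfolding axis_index_def[symmetric] Basis_vec_def
    by (subst prod.reindex_bij_betw[symmetric, where h="\<lambda>j. axis j 1" and S=UNIV])
      (auto simp: bij_betw_def inj_on_def axis_eq_axis)
  have eq: "ennreal (std_gaussian_density z) * ennreal (f (z $ i)) = (\<Prod>b\<in>Basis. F b (z \<bullet> b))" for z :: "real^'d"
  proof -
    have "(\<Prod>b\<in>Basis. F b (z \<bullet> b)) =
        ennreal (\<Prod>j\<in>UNIV. std_normal_density (z $ j) * (if j = i then f (z $ j) else 1))"
      unfolding Basis_prod F_def using f
      by (subst prod_ennreal) (auto simp: inner_axis axis_eq_axis cong: if_cong)
    also have "\<dots> = ennreal (std_gaussian_density z * f (z $ i))"
      by (simp add: prod.distrib std_gaussian_density_def)
    finally show ?thesis using f by (simp add: ennreal_mult)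
  qed
  have "(\<integral>\<^sup>+z. ennreal (f (z $ i)) \<partial>gauss) = (\<integral>\<^sup>+z. (\<Prod>b\<in>Basis. F b (z \<bullet> b)) \<partial>lborel)"
    unfolding gauss_def by (subst nn_integral_density) (auto simp: eq)
  also have "\<dots> = (\<Prod>b\<in>Basis. \<integral>\<^sup>+x. F b x \<partial>lborel)"
    using F by (intro nn_integral_lborel_prod) auto
  also have "\<dots> = (\<Prod>j\<in>UNIV. if j = i then (\<integral>\<^sup>+x. ennreal (std_normal_density x * f x) \<partial>lborel) else 1)"
  proof -
    have "(\<integral>\<^sup>+x. ennreal (std_normal_density x) \<partial>lborel) = 1"
      by (subst nn_integral_eq_integral) auto
    then show ?thesis
      unfolding Basis_prod F_def by (intro prod.cong refl) (auto simp: axis_eq_axis)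
  qed
  finally show ?thesis by simp
qed

lemma prob_space_gauss: "prob_space (gauss :: (real^'d) measure)"
proof
  have "(\<integral>\<^sup>+z. ennreal 1 \<partial>(gauss :: (real^'d) measure)) = 1"
    by (subst nn_integral_gauss_component[of "\<lambda>_. 1" undefined])
      (auto simp: nn_integral_eq_integral)
  then show "emeasure gauss (space (gauss :: (real^'d) measure)) = 1"
    by simp
qed

interpretation gauss: prob_space "gauss :: (real^'d) measure"
  by (rule prob_space_gauss)

interpretation gauss_pair: pair_prob_space "gauss :: (real^'d) measure" "gauss :: (real^'d) measure" ..

text \<open>A rotation carrying u to |u| times a coordinate axis reduces every direction to one
  coordinate, whose even moments (2k)! / (2^k k!) are those of the one-dimensional normal
  law.\<close>

lemma has_bochner_integral_gauss_inner_even_power: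
  fixes u :: "real^'d"
  shows "has_bochner_integral gauss (\<lambda>z. (z \<bullet> u) ^ (2 * k)) (norm u ^ (2 * k) * (fact (2 * k) / (2 ^ k * fact k)))"
proof -
  fix i :: 'd
  let ?m = "fact (2 * k) / (2 ^ k * fact k) :: real"
  have "(\<integral>\<^sup>+z. ennreal ((z $ i) ^ (2 * k)) \<partial>gauss) = ennreal ?m"
    unfolding nn_integral_gauss_component[of "\<lambda>x. x ^ (2 * k)" i, simplified]
    using std_normal_moment_even[of k]
    by (subst nn_integral_eq_integral) (auto simp: has_bochner_integral_iff zero_le_even_power)
  then have 1: "has_bochner_integral gauss (\<lambda>z. (z $ i) ^ (2 * k)) ?m"
    by (intro has_bochner_integral_nn_integral) auto
  obtain T where T: "orthogonal_transformation T" "T u = norm u *\<^sub>R (axis i 1 :: real^'d)"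
    using orthogonal_transformation_exists[of u "norm u *\<^sub>R axis i 1"] by auto
  have [measurable]: "T \<in> borel_measurable borel"
    by (rule orthogonal_transformation_borel_measurable[OF T(1)])
  have "has_bochner_integral gauss (\<lambda>z. (norm u * z $ i) ^ (2 * k)) (norm u ^ (2 * k) * ?m)"
    unfolding power_mult_distrib by (rule has_bochner_integral_mult_right[OF 1])
  then have "has_bochner_integral (distr gauss borel T) (\<lambda>z. (norm u * z $ i) ^ (2 * k)) (norm u ^ (2 * k) * ?m)"
    using distr_gauss_orthogonal_transformation[OF T(1)] by simp
  then have "has_bochner_integral gauss (\<lambda>z. (norm u * T z $ i) ^ (2 * k)) (norm u ^ (2 * k) * ?m)"
    by (simp add: has_bochner_integral_iff integrable_distr_eq integral_distr)
  moreover have "norm u * T z $ i = z \<bullet> u" for z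
  proof -
    have "norm u * T z $ i = T z \<bullet> T u" by (simp add: T inner_axis)
    then show ?thesis using T(1) by (simp add: orthogonal_transformation_def)
  qed
  ultimately show ?thesis by simp
qed

lemma
  fixes u :: "real^'d"
  shows integrable_gauss_inner_power2: "integrable gauss (\<lambda>z. (z \<bullet> u)\<^sup>2)"
    and integral_gauss_inner_power2: "(\<integral>z. (z \<bullet> u)\<^sup>2 \<partial>gauss) = (norm u)\<^sup>2"
    and integrable_gauss_inner_power4: "integrable gauss (\<lambda>z. (z \<bullet> u) ^ 4)"
    and integral_gauss_inner_power4: "(\<integral>z. (z \<bullet> u) ^ 4 \<partial>gauss) = 3 * norm u ^ 4"
  using has_bochner_integral_gauss_inner_even_power[of u 1] has_bochner_integral_gauss_inner_even_power[of u 2]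
  by (simp_all add: has_bochner_integral_iff fact_numeral)

lemma integrable_gauss_norm_power2: "integrable (gauss :: (real^'d) measure) (\<lambda>z. (norm z)\<^sup>2)"
proof -
  have "(norm z)\<^sup>2 = (\<Sum>i\<in>UNIV. (z \<bullet> axis i 1)\<^sup>2)" for z :: "real^'d"
    unfolding power2_norm_eq_inner by (simp add: inner_vec_def[of z z] inner_axis power2_eq_square)
  then show ?thesis by (simp add: integrable_gauss_inner_power2)
qed

lemma integrable_gauss_norm: "integrable (gauss :: (real^'d) measure) norm"
proof (rule Bochner_Integration.integrable_bound)
  show "integrable (gauss :: (real^'d) measure) (\<lambda>z. 1 + (norm z)\<^sup>2)"
    by (intro Bochner_Integration.integrable_add integrable_gauss_norm_power2) simp
  show "AE z in gauss. norm (norm (z :: real^'d)) \<le> norm (1 + (norm z)\<^sup>2)"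
  proof (intro AE_I2)
    fix z :: "real^'d"
    have "0 \<le> (norm z - 1)\<^sup>2" by simp
    then have "2 * norm z \<le> 1 + (norm z)\<^sup>2" by (simp add: power2_eq_square algebra_simps)
    then show "norm (norm z) \<le> norm (1 + (norm z)\<^sup>2)"
      using norm_ge_zero[of z] unfolding real_norm_def by linarith
  qed
qed measurable

lemma integrable_gauss_inner: "integrable gauss (\<lambda>z :: real^'d. z \<bullet> u)"
  by (rule Bochner_Integration.integrable_bound[OF integrable_mult_right[OF integrable_gauss_norm, of "norm u"]])
    (auto simp: Cauchy_Schwarz_ineq2 mult.commute)

lemma integral_gauss_inner: "(\<integral>z. z \<bullet> u \<partial>gauss) = (0 :: real)" for u :: "real^'d"
proof -
  have "(\<integral>z. z \<bullet> u \<partial>gauss) = (\<integral>z. z \<bullet> u \<partial>distr gauss borel uminus)"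
    by (simp add: distr_gauss_orthogonal_transformation orthogonal_transformation_neg[of "\<lambda>x. x", simplified])
  also have "\<dots> = - (\<integral>z. z \<bullet> u \<partial>gauss)"
    by (subst integral_distr) auto
  finally show ?thesis by simp
qed

lemma integral_gauss_abs_inner_le: "(\<integral>z. \<bar>z \<bullet> u\<bar> \<partial>gauss) \<le> norm (u :: real^'d)"
proof (rule power2_le_imp_le)
  have "(\<integral>z. \<bar>z \<bullet> u\<bar> \<partial>gauss)\<^sup>2 \<le> (\<integral>z. \<bar>z \<bullet> u\<bar>\<^sup>2 \<partial>gauss)"
    using gauss.variance_positive[of "\<lambda>z. \<bar>z \<bullet> u\<bar>"] gauss.variance_eq[of "\<lambda>z. \<bar>z \<bullet> u\<bar>"]
      integrable_gauss_inner[of u] integrable_gauss_inner_power2[of u] by simp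
  then show "(\<integral>z. \<bar>z \<bullet> u\<bar> \<partial>gauss)\<^sup>2 \<le> (norm u)\<^sup>2"
    by (simp add: integral_gauss_inner_power2)
qed simp

lemma
  fixes u w :: "real^'d"
  shows integrable_gauss_inner_mult: "integrable gauss (\<lambda>z. (z \<bullet> u) * (z \<bullet> w))"
    and integral_gauss_inner_mult: "(\<integral>z. (z \<bullet> u) * (z \<bullet> w) \<partial>gauss) = u \<bullet> w"
proof -
  have eq: "(z \<bullet> u) * (z \<bullet> w) = ((z \<bullet> (u + w))\<^sup>2 - (z \<bullet> u)\<^sup>2 - (z \<bullet> w)\<^sup>2) / 2" for z
    by (simp add: inner_add_right power2_eq_square algebra_simps)
  show "integrable gauss (\<lambda>z. (z \<bullet> u) * (z \<bullet> w))"
    unfolding eq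
    by (intro integrable_divide_zero Bochner_Integration.integrable_diff integrable_gauss_inner_power2)
  have "(\<integral>z. (z \<bullet> u) * (z \<bullet> w) \<partial>gauss) = ((norm (u + w))\<^sup>2 - (norm u)\<^sup>2 - (norm w)\<^sup>2) / 2"
    unfolding eq by (simp add: integrable_gauss_inner_power2 integral_gauss_inner_power2)
  then show "(\<integral>z. (z \<bullet> u) * (z \<bullet> w) \<partial>gauss) = u \<bullet> w"
    by (simp add: power2_norm_eq_inner inner_simps inner_commute)
qed

section \<open>Sums of independent Gaussian vectors\<close>

lemma norm_add_power2_le:
  fixes a b :: "'a::real_normed_vector"
  shows "(norm (a + b))\<^sup>2 \<le> 2 * (norm a)\<^sup>2 + 2 * (norm b)\<^sup>2"
proof -
  have "(norm (a + b))\<^sup>2 \<le> (norm a + norm b)\<^sup>2"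
    by (intro power_mono norm_triangle_ineq) simp
  also have "\<dots> \<le> 2 * (norm a)\<^sup>2 + 2 * (norm b)\<^sup>2"
    using zero_le_power2[of "norm a - norm b"] by (simp add: power2_sum power2_diff)
  finally show ?thesis .
qed

lemma abs_integral_le_integral:
  fixes f g :: "'a \<Rightarrow> real"
  assumes "integrable M f" "integrable M g" "\<And>x. \<bar>f x\<bar> \<le> g x"
  shows "\<bar>\<integral>x. f x \<partial>M\<bar> \<le> (\<integral>x. g x \<partial>M)"
  by (rule order_trans[OF integral_abs_bound integral_mono]) (use assms in auto)

lemma borel_measurable_matrix_vector_mult [measurable]:
  "(\<lambda>x. (A :: real^'n^'m) *v x) \<in> borel_measurable borel"
  by (intro borel_measurable_continuous_onI matrix_vector_mult_linear_continuous_on)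

text \<open>Equality of the two products makes W2^-1 W1 orthogonal, and \<open>gauss\<close> is
  rotation invariant. W1 may be non-symmetric: this is how other factors of a covariance are
  exchanged for its positive definite root.\<close>

lemma distr_gauss_matrix_eq:
  fixes W1 W2 :: "real^'d^'d"
  assumes eq: "W1 ** transpose W1 = W2 ** transpose W2" and inv: "invertible W2"
  shows "distr gauss borel ((*v) W1) = distr gauss borel ((*v) W2)"
proof -
  define P where "P = matrix_inv W2 ** W1"
  have "P ** transpose P = matrix_inv W2 ** (W1 ** transpose W1) ** transpose (matrix_inv W2)"
    by (simp add: P_def matrix_transpose_mul matrix_mul_assoc)
  also have "\<dots> = (matrix_inv W2 ** W2) ** transpose (matrix_inv W2 ** W2)"
    by (simp only: eq matrix_transpose_mul matrix_mul_assoc)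
  also have "\<dots> = mat 1"
    by (simp add: matrix_inv_mult(2)[OF inv])
  finally have "orthogonal_matrix P"
    by (simp add: orthogonal_matrix_def matrix_left_right_inverse)
  then have orth: "orthogonal_transformation ((*v) P)"
    by (simp add: orthogonal_transformation_matrix)
  have "W1 = W2 ** P"
    by (simp add: P_def matrix_mul_assoc matrix_inv_mult(1)[OF inv])
  then have "distr gauss borel ((*v) W1) = distr (distr gauss borel ((*v) P)) borel ((*v) W2)"
    by (subst distr_distr) (auto simp: comp_def matrix_vector_mul_assoc)
  then show ?thesis
    by (simp add: distr_gauss_orthogonal_transformation[OF orth])
qed

lemma distr_gauss_pair_orthogonal_transformation:
  fixes T :: "(real^'d) \<times> (real^'d) \<Rightarrow> (real^'d) \<times> (real^'d)"
  assumes "orthogonal_transformation T"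
  shows "distr (gauss \<Otimes>\<^sub>M gauss) borel T = gauss \<Otimes>\<^sub>M gauss"
proof -
  let ?\<psi> = "\<lambda>r. ennreal ((1 / sqrt (2 * pi)) ^ (2 * CARD('d)) * exp (- r\<^sup>2 / 2))"
  have "(gauss \<Otimes>\<^sub>M gauss :: ((real^'d) \<times> (real^'d)) measure) =
      density (lborel \<Otimes>\<^sub>M lborel) (\<lambda>(x, y). ennreal (std_gaussian_density x) * ennreal (std_gaussian_density y))"
    unfolding gauss_def
  proof (rule pair_measure_density)
    show "sigma_finite_measure (density lborel (\<lambda>x :: real^'d. ennreal (std_gaussian_density x)))"
      using gauss.sigma_finite_measure_axioms unfolding gauss_def .
  qed (auto intro: sigma_finite_lborel)
  also have "\<dots> = density lborel (\<lambda>p. ?\<psi> (norm p))"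
  proof -
    have "ennreal (std_gaussian_density x) * ennreal (std_gaussian_density y) = ?\<psi> (norm (x, y))"
      for x y :: "real^'d"
    proof -
      have "(norm (x, y))\<^sup>2 = (norm x)\<^sup>2 + (norm y)\<^sup>2" by (simp add: norm_prod_def)
      then have "exp (- (norm (x, y))\<^sup>2 / 2) = exp (- (norm x)\<^sup>2 / 2) * exp (- (norm y)\<^sup>2 / 2)"
        by (simp add: mult_exp_exp diff_divide_distrib)
      moreover have "(1 / sqrt (2 * pi)) ^ (2 * CARD('d)) = (1 / sqrt (2 * pi)) ^ CARD('d) * (1 / sqrt (2 * pi)) ^ CARD('d)"
        by (simp only: mult_2 power_add)
      ultimately show ?thesis
        by (simp add: ennreal_mult[symmetric] std_gaussian_density_eq_exp mult_ac)
    qed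
    then show ?thesis unfolding lborel_prod by (simp add: case_prod_beta')
  qed
  finally show ?thesis
    using distr_density_norm_orthogonal_transformation[OF assms, of ?\<psi>] by simp
qed

text \<open>Conjugating by \<open>U = (Q + V)\<^sup>1\<^sup>/\<^sup>2\<close> turns \<open>Q\<close> and \<open>V\<close> into \<open>C\<close> and \<open>I - C\<close>; their square roots
  \<open>A\<close> and \<open>B\<close> commute, so \<open>(z, w) \<mapsto> (A z + B w, A w - B z)\<close> is orthogonal.\<close>

lemma distr_gauss_pair_posdef_sqrt:
  fixes Q V :: "real^'d^'d"
  assumes Q: "l *\<^sub>R mat 1 \<preceq> Q" and V: "a *\<^sub>R mat 1 \<preceq> V" and pos: "0 < l" "0 < a"
  shows "distr (gauss \<Otimes>\<^sub>M gauss) borel (\<lambda>(z, w). posdef_sqrt Q *v z + posdef_sqrt V *v w) =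
    distr gauss borel ((*v) (posdef_sqrt (Q + V)))"
proof -
  have QV: "(l + a) *\<^sub>R mat 1 \<preceq> Q + V"
    by (rule loewner_ge_add[OF Q V])
  define U where "U = posdef_sqrt (Q + V)"
  define U' where "U' = matrix_inv U"
  note U = posdef_sqrt_props[OF QV add_pos_pos[OF pos], folded U_def]
  note U_inv = matrix_inv_mult[OF U(4), folded U'_def]
  have U'_sym: "transpose U' = U'" unfolding U'_def by (rule matrix_inv_symmetric[OF U(4,3)])
  have Q_sym: "transpose Q = Q" and Q_ge: "0 \<le> x \<bullet> (Q *v x)" for x
    using Q pos by (auto simp: scaleR_mat_1_loewner_le_iff intro: order_trans[rotated])
  have V_sym: "transpose V = V" and V_ge: "0 \<le> x \<bullet> (V *v x)" for x
    using V pos by (auto simp: scaleR_mat_1_loewner_le_iff intro: order_trans[rotated])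
  define C where "C = U' ** Q ** U'"
  define D where "D = U' ** V ** U'"
  have conj_U: "U ** (U' ** P ** U') ** U = P" for P
  proof -
    have "U ** (U' ** P ** U') ** U = (U ** U') ** P ** (U' ** U)"
      by (simp only: matrix_mul_assoc)
    then show ?thesis by (simp add: U_inv)
  qed
  have conj_ge: "x \<bullet> ((U' ** P ** U') *v x) = (U' *v x) \<bullet> (P *v (U' *v x))" for P x
    using symmetric_inner_matrix_vector[OF U'_sym, of x] by (simp add: matrix_vector_mul_assoc[symmetric])
  have "C + D = U' ** (U ** U) ** U'"
    by (simp add: C_def D_def U(2) matrix_add_ldistrib matrix_add_rdistrib')
  also have "\<dots> = (U' ** U) ** (U ** U')" by (simp only: matrix_mul_assoc)
  finally have CD: "C + D = mat 1" by (simp add: U_inv)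
  have C_sym: "transpose C = C"
    by (simp add: C_def matrix_transpose_mul Q_sym U'_sym matrix_mul_assoc)
  obtain \<Phi> :: "(real \<Rightarrow> real) \<Rightarrow> real^'d^'d" and \<Lambda> where
    \<Phi>: "\<And>f. transpose (\<Phi> f) = \<Phi> f" "\<And>f g. \<Phi> f ** \<Phi> g = \<Phi> (\<lambda>c. f c * g c)"
      "\<And>f g. \<Phi> f + \<Phi> g = \<Phi> (\<lambda>c. f c + g c)"
      "\<And>f g. \<forall>c\<in>\<Lambda>. f c = g c \<Longrightarrow> \<Phi> f = \<Phi> g" "\<Phi> (\<lambda>c. c) = C" "\<And>r. \<Phi> (\<lambda>_. r) = r *\<^sub>R mat 1"
      "\<And>f x. \<forall>c\<in>\<Lambda>. 0 \<le> f c \<Longrightarrow> 0 \<le> x \<bullet> (\<Phi> f *v x)"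
      "\<And>c. c \<in> \<Lambda> \<Longrightarrow> \<exists>x. norm x = 1 \<and> C *v x = c *\<^sub>R x"
    by (rule symmetric_matrix_functional_calculus[OF C_sym]) (rule that)
  \<comment> \<open>C and D are positive semidefinite with sum I, so the eigenvalues of C lie in
    [0, 1] and both square roots below are taken of nonnegative numbers.\<close>
  have c: "0 \<le> c \<and> c \<le> 1" if c: "c \<in> \<Lambda>" for c
  proof -
    obtain x where x: "norm x = 1" "C *v x = c *\<^sub>R x" using \<Phi>(8)[OF c] by blast
    have "x \<bullet> (C *v x) + x \<bullet> (D *v x) = 1"
      using CD x(1) by (simp add: inner_add_right[symmetric] matrix_vector_mult_add_rdistrib[symmetric] dot_square_norm)
    moreover have "0 \<le> x \<bullet> (C *v x)" "0 \<le> x \<bullet> (D *v x)"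
      unfolding C_def D_def conj_ge by (rule Q_ge V_ge)+
    moreover have "x \<bullet> (C *v x) = c" using x by (simp add: dot_square_norm)
    ultimately show ?thesis by linarith
  qed
  define A where "A = \<Phi> sqrt"
  define B where "B = \<Phi> (\<lambda>c. sqrt (1 - c))"
  have AA: "A ** A = C"
    unfolding A_def \<Phi>(2) \<Phi>(5)[symmetric] using c by (intro \<Phi>(4)) auto
  have "B ** B = \<Phi> (\<lambda>c. 1 - c)"
    unfolding B_def \<Phi>(2) using c by (intro \<Phi>(4)) auto
  then have "C + B ** B = \<Phi> (\<lambda>c. c + (1 - c))"
    by (simp only: \<Phi>(5)[symmetric] \<Phi>(3))
  then have "C + B ** B = mat 1" using \<Phi>(6)[of 1] by simp
  with CD have BB: "B ** B = D" by (metis add_left_cancel)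
  have AB: "A ** B = B ** A"
    by (simp add: A_def B_def \<Phi>(2) mult.commute)
  have A_sym: "transpose A = A" and B_sym: "transpose B = B"
    by (simp_all add: A_def B_def \<Phi>(1))
  define \<Theta> where "\<Theta> = (\<lambda>(z, w). (A *v z + B *v w, A *v w - B *v z))"
  have \<Theta>: "orthogonal_transformation \<Theta>"
    unfolding orthogonal_transformation
  proof (intro conjI allI)
    show "linear \<Theta>"
      unfolding \<Theta>_def by (intro linearI)
        (auto simp: matrix_vector_right_distrib matrix_vector_mult_scaleR algebra_simps)
    fix p :: "(real^'d) \<times> (real^'d)"
    obtain z w where p: "p = (z, w)" by force
    have inner: "(P *v x) \<bullet> (P' *v y) = x \<bullet> ((P ** P') *v y)" if "transpose P = P" for P P' :: "real^'d^'d" and x y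
      using symmetric_inner_matrix_vector[OF that, of x] by (simp add: matrix_vector_mul_assoc[symmetric])
    have one: "x \<bullet> (C *v y) + x \<bullet> (D *v y) = x \<bullet> y" for x y
      using CD by (simp add: inner_add_right[symmetric] matrix_vector_mult_add_rdistrib[symmetric])
    have "(norm (\<Theta> p))\<^sup>2 = (norm p)\<^sup>2"
      using one[of z z] one[of w w] inner[OF A_sym, of w B z] inner[OF A_sym, of z B w]
        inner[OF B_sym, of z A w] inner[OF B_sym, of w A z]
      unfolding p \<Theta>_def power2_norm_eq_inner
      by (simp add: inner_simps inner[OF A_sym, of _ A] inner[OF B_sym, of _ B] AA BB AB inner_commute)
    then show "norm (\<Theta> p) = norm p" by simp
  qed
  have [measurable]: "\<Theta> \<in> borel_measurable borel"
    by (rule orthogonal_transformation_borel_measurable[OF \<Theta>])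
  have [measurable]: "(\<lambda>(z, w). P *v z + P' *v w) \<in> borel_measurable (borel \<Otimes>\<^sub>M borel)" for P P' :: "real^'d^'d"
    by measurable
  let ?G = "gauss \<Otimes>\<^sub>M gauss :: ((real^'d) \<times> (real^'d)) measure"
  have "distr ?G gauss fst = (gauss :: (real^'d) measure)"
    by (rule gauss.distr_pair_fst)
  then have fst: "distr ?G borel fst = (gauss :: (real^'d) measure)"
    by (simp cong: distr_cong)
  have [measurable]: "(\<lambda>p :: (real^'d) \<times> (real^'d). U *v fst p) \<in> borel_measurable borel"
    unfolding borel_prod[symmetric] by measurable
  have [measurable]: "\<Theta> \<in> measurable ?G borel"
    using \<open>\<Theta> \<in> borel_measurable borel\<close> unfolding borel_prod[symmetric]
    by (simp cong: measurable_cong_sets)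
  \<comment> \<open>Rotating (z, w) by \<open>\<Theta>\<close> leaves its law unchanged, so U z has
    the law of U A z + U B w. The factors U A and U B need not be symmetric, but U A (U A)^T = U C U
    = Q and U B (U B)^T = V, so each may be replaced by the positive definite root; the detour
    through the product of the two image laws allows this one factor at a time.\<close>
  have "distr gauss borel ((*v) U) =
      distr (distr ?G borel fst) borel ((*v) U)"
    by (simp only: fst)
  also have "\<dots> = distr ?G borel (\<lambda>p. U *v fst p)"
    by (subst distr_distr) (auto simp: comp_def)
  also have "\<dots> = distr (distr ?G borel \<Theta>) borel (\<lambda>p. U *v fst p)"
    by (simp only: distr_gauss_pair_orthogonal_transformation[OF \<Theta>])
  also have "\<dots> = distr ?G borel (\<lambda>(z, w). (U ** A) *v z + (U ** B) *v w)"
    by (subst distr_distr)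
      (auto intro!: distr_cong simp: \<Theta>_def case_prod_beta matrix_vector_right_distrib matrix_vector_mul_assoc)
  also have "\<dots> = distr (distr gauss borel ((*v) (U ** A)) \<Otimes>\<^sub>M distr gauss borel ((*v) (U ** B))) borel
      (\<lambda>(x, y). x + y)"
  proof -
    interpret D: prob_space "distr gauss borel ((*v) (U ** B))"
      by (rule gauss.prob_space_distr) measurable
    show ?thesis
      by (subst pair_measure_distr, measurable, rule D.sigma_finite_measure_axioms, subst distr_distr)
       (auto simp: comp_def case_prod_beta')
  qed
  also have "distr gauss borel ((*v) (U ** A)) = distr gauss borel ((*v) (posdef_sqrt Q))"
  proof (rule distr_gauss_matrix_eq[OF _ posdef_sqrt_props(4)[OF Q pos(1)]])
    have "(U ** A) ** transpose (U ** A) = U ** (A ** A) ** U"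
      by (simp add: matrix_transpose_mul A_sym U(3) matrix_mul_assoc)
    then show "(U ** A) ** transpose (U ** A) = posdef_sqrt Q ** transpose (posdef_sqrt Q)"
      by (simp add: AA C_def conj_U posdef_sqrt_props[OF Q pos(1)])
  qed
  also have "distr gauss borel ((*v) (U ** B)) = distr gauss borel ((*v) (posdef_sqrt V))"
  proof (rule distr_gauss_matrix_eq[OF _ posdef_sqrt_props(4)[OF V pos(2)]])
    have "(U ** B) ** transpose (U ** B) = U ** (B ** B) ** U"
      by (simp add: matrix_transpose_mul B_sym U(3) matrix_mul_assoc)
    then show "(U ** B) ** transpose (U ** B) = posdef_sqrt V ** transpose (posdef_sqrt V)"
      by (simp add: BB D_def conj_U posdef_sqrt_props[OF V pos(2)])
  qed
  also have "distr (distr gauss borel ((*v) (posdef_sqrt Q)) \<Otimes>\<^sub>M distr gauss borel ((*v) (posdef_sqrt V))) borel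
      (\<lambda>(x, y). x + y) = distr (gauss \<Otimes>\<^sub>M gauss) borel (\<lambda>(z, w). posdef_sqrt Q *v z + posdef_sqrt V *v w)"
  proof -
    interpret D: prob_space "distr gauss borel ((*v) (posdef_sqrt V))"
      by (rule gauss.prob_space_distr) measurable
    show ?thesis
      by (subst pair_measure_distr, measurable, rule D.sigma_finite_measure_axioms, subst distr_distr)
       (auto simp: comp_def case_prod_beta')
  qed
  finally show ?thesis unfolding U_def by simp
qed

section \<open>Second and third moments of a centred Gaussian vector\<close>

lemma trace_square_eq_sum_norm_rows:
  fixes T :: "real^'d^'d"
  assumes "transpose T = T"
  shows "trace (T ** T) = (\<Sum>i\<in>UNIV. (norm (T $ i))\<^sup>2)"
proof -
  have "T $ i $ j = T $ j $ i" for i j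
    by (metis assms transpose_def vec_lambda_beta)
  then show ?thesis
    unfolding trace_def power2_norm_eq_inner by (simp add: matrix_matrix_mult_def inner_vec_def)
qed

lemma trace_ge_loewner:
  fixes V :: "real^'d^'d"
  assumes "a *\<^sub>R mat 1 \<preceq> V"
  shows "a * real CARD('d) \<le> trace V"
proof -
  have "a \<le> V $ i $ i" for i
    using assms by (simp add: scaleR_mat_1_loewner_le_iff matrix_component_eq_inner)
      (metis mult.right_neutral norm_axis_1 power_one)
  then have "(\<Sum>i\<in>(UNIV::'d set). a) \<le> trace V" unfolding trace_def by (intro sum_mono)
  then show ?thesis by (simp add: mult.commute)
qed

lemma
  fixes V :: "real^'d^'d"
  assumes V: "a *\<^sub>R mat 1 \<preceq> V" and a: "0 < a"
  shows integrable_gauss_posdef_sqrt_norm_power2: "integrable gauss (\<lambda>w. (norm (posdef_sqrt V *v w))\<^sup>2)"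
    and integral_gauss_posdef_sqrt_norm_power2: "(\<integral>w. (norm (posdef_sqrt V *v w))\<^sup>2 \<partial>gauss) = trace V"
    and integrable_gauss_posdef_sqrt_norm_power3: "integrable gauss (\<lambda>w. norm (posdef_sqrt V *v w) ^ 3)"
    and integral_gauss_posdef_sqrt_norm_power3_le:
      "(\<integral>w. norm (posdef_sqrt V *v w) ^ 3 \<partial>gauss) \<le> 2 * (trace V * sqrt (trace V))"
proof -
  let ?T = "posdef_sqrt V"
  note T = posdef_sqrt_props[OF V a]
  define s where "s i = (norm (?T $ i))\<^sup>2" for i
  define m where "m = trace V"
  have m_sum: "m = (\<Sum>i\<in>UNIV. s i)"
    using trace_square_eq_sum_norm_rows[OF T(3)] by (simp add: m_def T(2) s_def)
  have "0 < a * real CARD('d)" using a by simp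
  then have m: "0 < m" using trace_ge_loewner[OF V] by (simp add: m_def)
  have norm2: "(norm (?T *v w))\<^sup>2 = (\<Sum>i\<in>UNIV. (w \<bullet> ?T $ i)\<^sup>2)" for w
  proof -
    have "(?T *v w) $ i = w \<bullet> ?T $ i" for i
      by (simp add: matrix_vector_mult_def inner_vec_def mult.commute)
    then show ?thesis
      unfolding power2_norm_eq_inner by (simp add: inner_vec_def[of "?T *v w"] power2_eq_square)
  qed
  show int2: "integrable gauss (\<lambda>w. (norm (?T *v w))\<^sup>2)"
    unfolding norm2 by (simp add: integrable_gauss_inner_power2)
  show E2: "(\<integral>w. (norm (?T *v w))\<^sup>2 \<partial>gauss) = trace V"
    unfolding norm2 using m_sum
    by (simp add: integrable_gauss_inner_power2 integral_gauss_inner_power2 m_def s_def)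
  \<comment> \<open>Cauchy-Schwarz with weights s i gives |T w|^4 <= Y w, where only fourth powers
    of single projections occur; no mixed moments are involved, and E Y = 3 m^2.\<close>
  define Y where "Y w = m * (\<Sum>i\<in>UNIV. (w \<bullet> ?T $ i) ^ 4 / s i)" for w
  have intY: "integrable gauss Y"
    unfolding Y_def by (intro integrable_mult_right Bochner_Integration.integrable_sum
        integrable_divide_zero integrable_gauss_inner_power4)
  have "(\<integral>w. Y w \<partial>gauss) = m * (\<Sum>i\<in>UNIV. 3 * (s i)\<^sup>2 / s i)"
    unfolding Y_def by (simp add: integrable_gauss_inner_power4 integral_gauss_inner_power4 s_def power_mult[symmetric])
  also have "(\<Sum>i\<in>UNIV. 3 * (s i)\<^sup>2 / s i) = (\<Sum>i\<in>UNIV. 3 * s i)"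
    by (intro sum.cong) (auto simp: power2_eq_square)
  also have "m * (\<Sum>i\<in>UNIV. 3 * s i) = 3 * m\<^sup>2"
    by (simp add: m_sum sum_distrib_left[symmetric] power2_eq_square)
  finally have EY: "(\<integral>w. Y w \<partial>gauss) = 3 * m\<^sup>2" .
  have Y: "norm (?T *v w) ^ 4 \<le> Y w" for w
  proof -
    have "norm (?T *v w) ^ 4 = ((norm (?T *v w))\<^sup>2)\<^sup>2" by (simp add: power_mult[symmetric])
    also have "\<dots> = (\<Sum>i\<in>UNIV. sqrt (s i) * ((w \<bullet> ?T $ i)\<^sup>2 / sqrt (s i)))\<^sup>2"
      unfolding norm2 by (intro arg_cong[where f="\<lambda>x. x\<^sup>2"] sum.cong) (auto simp: s_def)
    also have "\<dots> \<le> (\<Sum>i\<in>UNIV. (sqrt (s i))\<^sup>2) * (\<Sum>i\<in>UNIV. ((w \<bullet> ?T $ i)\<^sup>2 / sqrt (s i))\<^sup>2)"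
      by (rule Cauchy_Schwarz_ineq_sum)
    also have "\<dots> = Y w"
      by (simp add: Y_def m_sum s_def power_divide power_mult[symmetric])
    finally show ?thesis .
  qed
  \<comment> \<open>From x^2 (x - sqrt m)^2 >= 0. The weight sqrt m balances E Y = 3 m^2 against E
    x^2 = m, and (3 + 1) / 2 is the constant 2 of the conclusion.\<close>
  have le: "norm (?T *v w) ^ 3 \<le> (Y w / sqrt m + sqrt m * (norm (?T *v w))\<^sup>2) / 2" for w
  proof -
    let ?x = "norm (?T *v w)"
    have "0 \<le> ?x\<^sup>2 * (?x - sqrt m)\<^sup>2" by simp
    also have "\<dots> = ?x ^ 4 - 2 * sqrt m * ?x ^ 3 + m * ?x\<^sup>2"
      using m by (simp add: power2_eq_square power4_eq_xxxx power3_eq_cube algebra_simps)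
    also have "\<dots> \<le> Y w - 2 * sqrt m * ?x ^ 3 + m * ?x\<^sup>2" using Y[of w] by simp
    finally have "sqrt m * (2 * ?x ^ 3) \<le> sqrt m * (Y w / sqrt m + sqrt m * ?x\<^sup>2)"
      using m by (simp add: distrib_left mult.assoc[symmetric])
    then show ?thesis using m by (simp add: mult_le_cancel_left)
  qed
  have intB: "integrable gauss (\<lambda>w. (Y w / sqrt m + sqrt m * (norm (?T *v w))\<^sup>2) / 2)"
    using intY int2 by simp
  show int3: "integrable gauss (\<lambda>w. norm (?T *v w) ^ 3)"
    by (rule Bochner_Integration.integrable_bound[OF intB]) (use le in \<open>auto intro: order_trans[OF _ abs_ge_self]\<close>)
  have "(\<integral>w. norm (?T *v w) ^ 3 \<partial>gauss) \<le> (\<integral>w. (Y w / sqrt m + sqrt m * (norm (?T *v w))\<^sup>2) / 2 \<partial>gauss)"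
    by (intro integral_mono int3 intB le)
  also have "\<dots> = (3 * m\<^sup>2 / sqrt m + sqrt m * m) / 2"
    using intY int2 by (simp add: EY E2 m_def)
  also have "\<dots> = 2 * (m * sqrt m)"
    using m by (simp add: field_simps power2_eq_square)
  finally show "(\<integral>w. norm (?T *v w) ^ 3 \<partial>gauss) \<le> 2 * (trace V * sqrt (trace V))"
    by (simp add: m_def)
qed

section \<open>Gaussian smoothing of functions with Lipschitz gradient\<close>

text \<open>Monotonicity of c t^(k+1) / (k+1) plus or minus F takes the place of integrating F'. It
  serves with k = 1 for f and with k = 2 for the smoothed function.\<close>

lemma abs_diff_le_of_DERIV_bound:
  fixes F F' :: "real \<Rightarrow> real"
  assumes deriv: "\<And>t. 0 \<le> t \<Longrightarrow> t \<le> 1 \<Longrightarrow> (F has_real_derivative F' t) (at t)"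
    and bound: "\<And>t. 0 \<le> t \<Longrightarrow> t \<le> 1 \<Longrightarrow> \<bar>F' t\<bar> \<le> c * t ^ k"
  shows "\<bar>F 1 - F 0\<bar> \<le> c / real (Suc k)"
proof -
  have P: "((\<lambda>t. c * t ^ Suc k / real (Suc k)) has_real_derivative c * t ^ k) (at t)" for t
    by (rule derivative_eq_intros refl | simp)+
  have "c * 0 ^ Suc k / real (Suc k) - F 0 \<le> c * 1 ^ Suc k / real (Suc k) - F 1"
  proof (rule DERIV_nonneg_imp_nondecreasing[where f="\<lambda>t. c * t ^ Suc k / real (Suc k) - F t"])
    fix t :: real assume t: "0 \<le> t" "t \<le> 1"
    show "\<exists>y. ((\<lambda>t. c * t ^ Suc k / real (Suc k) - F t) has_real_derivative y) (at t) \<and> 0 \<le> y"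
      using DERIV_diff[OF P deriv[OF t]] bound[OF t] by (auto intro!: exI)
  qed simp
  moreover have "c * 0 ^ Suc k / real (Suc k) + F 0 \<le> c * 1 ^ Suc k / real (Suc k) + F 1"
  proof (rule DERIV_nonneg_imp_nondecreasing[where f="\<lambda>t. c * t ^ Suc k / real (Suc k) + F t"])
    fix t :: real assume t: "0 \<le> t" "t \<le> 1"
    show "\<exists>y. ((\<lambda>t. c * t ^ Suc k / real (Suc k) + F t) has_real_derivative y) (at t) \<and> 0 \<le> y"
      using DERIV_add[OF P deriv[OF t]] bound[OF t] by (auto intro!: exI)
  qed simp
  ultimately show ?thesis by simp
qed

lemma DERIV_of_quadratic_bound:
  fixes F :: "real \<Rightarrow> real"
  assumes "\<And>e. \<bar>F (t + e) - F t - e * D\<bar> \<le> C * e\<^sup>2"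
  shows "(F has_real_derivative D) (at t)"
proof -
  have "((\<lambda>e. (F (t + e) - F t) / e - D) \<longlongrightarrow> 0) (at 0)"
  proof (rule Lim_null_comparison)
    show "\<forall>\<^sub>F e in at 0. norm ((F (t + e) - F t) / e - D) \<le> C * \<bar>e\<bar>"
    proof (rule eventually_at[THEN iffD2], intro exI[of _ 1] conjI ballI impI)
      fix e :: real assume "e \<noteq> 0 \<and> dist e 0 < 1"
      then have e: "e \<noteq> 0" by simp
      then have "norm ((F (t + e) - F t) / e - D) = \<bar>F (t + e) - F t - e * D\<bar> / \<bar>e\<bar>"
        by (simp add: abs_divide[symmetric] diff_divide_distrib)
      also have "\<dots> \<le> C * e\<^sup>2 / \<bar>e\<bar>" by (intro divide_right_mono assms) simp
      also have "\<dots> = C * \<bar>e\<bar>"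
        using e by (simp add: power2_eq_square abs_if)
      finally show "norm ((F (t + e) - F t) / e - D) \<le> C * \<bar>e\<bar>" .
    qed simp
    have "((\<lambda>e. C * \<bar>e\<bar>) \<longlongrightarrow> C * \<bar>0\<bar>) (at (0::real))" by (intro tendsto_intros)
    then show "((\<lambda>e. C * \<bar>e\<bar>) \<longlongrightarrow> 0) (at (0::real))" by simp
  qed
  then show ?thesis unfolding DERIV_def by (simp add: LIM_zero_iff)
qed

lemma borel_measurable_affine_matrix [measurable]:
  "(\<lambda>z. x + (R :: real^'n^'m) *v z) \<in> borel_measurable borel"
  by (intro borel_measurable_add borel_measurable_const borel_measurable_matrix_vector_mult)

text \<open>Moves the translation from h to the density, where it can be differentiated even when h
  cannot.\<close>

lemma
  fixes c :: "real^'d" and h :: "real^'d \<Rightarrow> real"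
  assumes [measurable]: "h \<in> borel_measurable borel"
  shows integral_gauss_shift: "(\<integral>z. h (z + c) \<partial>gauss) = (\<integral>y. std_gaussian_density (y - c) * h y \<partial>lborel)"
    and integrable_gauss_shift:
      "integrable gauss (\<lambda>z. h (z + c)) \<longleftrightarrow> integrable lborel (\<lambda>y. std_gaussian_density (y - c) * h y)"
proof -
  have 1: "(\<integral>z. h (z + c) \<partial>gauss) = (\<integral>y. std_gaussian_density y * h (y + c) \<partial>lborel)"
    unfolding gauss_def by (subst integral_density) auto
  also have "\<dots> = (\<integral>y. std_gaussian_density (y - c) * h y \<partial>distr lborel borel ((+) c))"
    by (subst integral_distr) (auto simp: add.commute)
  finally show "(\<integral>z. h (z + c) \<partial>gauss) = (\<integral>y. std_gaussian_density (y - c) * h y \<partial>lborel)"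
    by (simp add: lborel_distr_plus)
  have "integrable gauss (\<lambda>z. h (z + c)) \<longleftrightarrow> integrable lborel (\<lambda>y. std_gaussian_density y * h (y + c))"
    unfolding gauss_def by (subst integrable_density) auto
  also have "\<dots> \<longleftrightarrow> integrable (distr lborel borel ((+) c)) (\<lambda>y. std_gaussian_density (y - c) * h y)"
    by (subst integrable_distr_eq) (auto simp: add.commute)
  finally show "integrable gauss (\<lambda>z. h (z + c)) \<longleftrightarrow> integrable lborel (\<lambda>y. std_gaussian_density (y - c) * h y)"
    by (simp add: lborel_distr_plus)
qed

lemma std_gaussian_density_line_deriv:
  fixes v y :: "real^'d"
  shows "((\<lambda>s. std_gaussian_density (y - s *\<^sub>R v)) has_real_derivative
    ((y - s *\<^sub>R v) \<bullet> v) * std_gaussian_density (y - s *\<^sub>R v)) (at s)"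
proof -
  have eq: "std_gaussian_density (y - s *\<^sub>R v) =
     (1 / sqrt (2 * pi)) ^ CARD('d) * exp (- ((norm y)\<^sup>2 - 2 * s * (y \<bullet> v) + s\<^sup>2 * (norm v)\<^sup>2) / 2)" for s
    unfolding std_gaussian_density_eq_exp power2_norm_eq_inner
    by (simp add: inner_simps inner_commute power2_eq_square algebra_simps)
  show ?thesis
    unfolding eq
    by (rule derivative_eq_intros refl | simp)+
      (simp add: inner_diff_left power2_norm_eq_inner algebra_simps)
qed

locale lipschitz_gradient =
  fixes f :: "real^'d \<Rightarrow> real" and g :: "real^'d \<Rightarrow> real^'d" and L :: real
  assumes gderiv: "GDERIV f x :> g x"
    and lipschitz: "norm (g x - g y) \<le> L * norm (x - y)"
    and L_nonneg: "0 \<le> L"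
begin

lemma continuous_f: "continuous_on UNIV f"
  using gderiv by (auto simp: gderiv_def intro!: continuous_at_imp_continuous_on has_derivative_continuous)

lemma continuous_g: "continuous_on UNIV g"
proof (rule lipschitz_on_continuous_on)
  show "L-lipschitz_on UNIV g"
    using lipschitz L_nonneg by (auto intro!: lipschitz_onI simp: dist_norm)
qed

lemma measurable_f [measurable]: "f \<in> borel_measurable borel"
  and measurable_g [measurable]: "g \<in> borel_measurable borel"
  using continuous_f continuous_g by (auto intro: borel_measurable_continuous_onI)

lemma line_deriv: "((\<lambda>t. f (x + t *\<^sub>R u)) has_real_derivative g (x + t *\<^sub>R u) \<bullet> u) (at t)"
proof -
  have "((\<lambda>t. x + t *\<^sub>R u) has_derivative (\<lambda>h. h *\<^sub>R u)) (at t)"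
    by (auto intro!: derivative_eq_intros)
  moreover have "(f has_derivative (\<lambda>h. h \<bullet> g (x + t *\<^sub>R u))) (at (x + t *\<^sub>R u))"
    using gderiv by (simp add: gderiv_def)
  ultimately have "((\<lambda>t. f (x + t *\<^sub>R u)) has_derivative (\<lambda>h. (h *\<^sub>R u) \<bullet> g (x + t *\<^sub>R u))) (at t)"
    by (rule has_derivative_compose)
  moreover have "(\<lambda>h. (h *\<^sub>R u) \<bullet> g (x + t *\<^sub>R u)) = (*) (g (x + t *\<^sub>R u) \<bullet> u)"
    by (simp add: fun_eq_iff inner_commute)
  ultimately show ?thesis by (simp only: has_field_derivative_def)
qed

lemma first_order: "\<bar>f (x + u) - f x - g x \<bullet> u\<bar> \<le> L / 2 * (norm u)\<^sup>2"
proof -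
  have "\<bar>(f (x + 1 *\<^sub>R u) - 1 * (g x \<bullet> u)) - (f (x + 0 *\<^sub>R u) - 0 * (g x \<bullet> u))\<bar> \<le>
      (L * (norm u)\<^sup>2) / real (Suc 1)"
  proof (rule abs_diff_le_of_DERIV_bound[where F'="\<lambda>t. g (x + t *\<^sub>R u) \<bullet> u - g x \<bullet> u"])
    fix t :: real assume t: "0 \<le> t"
    show "((\<lambda>t. f (x + t *\<^sub>R u) - t * (g x \<bullet> u)) has_real_derivative g (x + t *\<^sub>R u) \<bullet> u - g x \<bullet> u) (at t)"
      by (auto intro!: derivative_eq_intros line_deriv)
    have "\<bar>(g (x + t *\<^sub>R u) - g x) \<bullet> u\<bar> \<le> norm (g (x + t *\<^sub>R u) - g x) * norm u"
      by (rule Cauchy_Schwarz_ineq2)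
    also have "\<dots> \<le> (L * norm (x + t *\<^sub>R u - x)) * norm u"
      by (intro mult_right_mono lipschitz) simp
    finally show "\<bar>g (x + t *\<^sub>R u) \<bullet> u - g x \<bullet> u\<bar> \<le> L * (norm u)\<^sup>2 * t ^ 1"
      using t by (simp add: inner_diff_left power2_eq_square mult_ac)
  qed
  moreover have "(f (x + 1 *\<^sub>R u) - 1 * (g x \<bullet> u)) - (f (x + 0 *\<^sub>R u) - 0 * (g x \<bullet> u)) = f (x + u) - f x - g x \<bullet> u"
    by simp
  ultimately have "\<bar>f (x + u) - f x - g x \<bullet> u\<bar> \<le> (L * (norm u)\<^sup>2) / real (Suc 1)"
    by (simp only:)
  then show ?thesis by simp
qed

lemma norm_g_le: "norm (g x) \<le> norm (g 0) + L * norm x"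
  using lipschitz[of x 0] norm_triangle_ineq2[of "g x" "g 0"] by simp

text \<open>Quadratic growth reduces integrability of f along Gaussian and martingale sums to second
  moments.\<close>

lemma abs_f_le: "\<bar>f x\<bar> \<le> (\<bar>f 0\<bar> + norm (g 0) + L) * (1 + (norm x)\<^sup>2)"
proof -
  have "0 \<le> (norm x - 1)\<^sup>2" by simp
  then have "2 * norm x \<le> 1 + (norm x)\<^sup>2" by (simp add: power2_eq_square algebra_simps)
  then have x: "norm x \<le> 1 + (norm x)\<^sup>2" using norm_ge_zero[of x] by linarith
  have "\<bar>f x\<bar> \<le> \<bar>f 0\<bar> + \<bar>g 0 \<bullet> x\<bar> + L / 2 * (norm x)\<^sup>2"
    using first_order[of 0 x, unfolded add_0] by linarith
  also have "\<dots> \<le> \<bar>f 0\<bar> * (1 + (norm x)\<^sup>2) + norm (g 0) * (1 + (norm x)\<^sup>2) + L * (1 + (norm x)\<^sup>2)"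
  proof (intro add_mono)
    show "\<bar>f 0\<bar> \<le> \<bar>f 0\<bar> * (1 + (norm x)\<^sup>2)" by (simp add: algebra_simps)
    have "\<bar>g 0 \<bullet> x\<bar> \<le> norm (g 0) * norm x" by (rule Cauchy_Schwarz_ineq2)
    also have "\<dots> \<le> norm (g 0) * (1 + (norm x)\<^sup>2)" by (intro mult_left_mono x) simp
    finally show "\<bar>g 0 \<bullet> x\<bar> \<le> norm (g 0) * (1 + (norm x)\<^sup>2)" .
    have "L / 2 * (norm x)\<^sup>2 \<le> L * (norm x)\<^sup>2" using L_nonneg by (intro mult_right_mono) auto
    then show "L / 2 * (norm x)\<^sup>2 \<le> L * (1 + (norm x)\<^sup>2)" using L_nonneg by (simp add: algebra_simps)
  qed
  also have "\<dots> = (\<bar>f 0\<bar> + norm (g 0) + L) * (1 + (norm x)\<^sup>2)" by (simp add: algebra_simps)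
  finally show ?thesis .
qed

lemma norm_affine_power2_le: "(norm (x + (R :: real^'d^'d) *v z))\<^sup>2 \<le> 2 * (norm x)\<^sup>2 + 2 * (norm R)\<^sup>2 * (norm z)\<^sup>2"
proof -
  have "(norm (R *v z))\<^sup>2 \<le> (norm R * norm z)\<^sup>2"
    by (intro power_mono norm_matrix_vector_mult_le) simp
  then show ?thesis
    using norm_add_power2_le[of x "R *v z"] by (simp add: power_mult_distrib)
qed

lemma integrable_gauss_f:
  fixes R :: "real^'d^'d"
  shows "integrable gauss (\<lambda>z. f (x + R *v z))"
proof (rule Bochner_Integration.integrable_bound)
  let ?C = "\<bar>f 0\<bar> + norm (g 0) + L"
  show "integrable gauss (\<lambda>z :: real^'d. ?C * (1 + (2 * (norm x)\<^sup>2 + 2 * (norm R)\<^sup>2 * (norm z)\<^sup>2)))"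
    by (intro integrable_mult_right Bochner_Integration.integrable_add integrable_gauss_norm_power2) auto
  have "\<bar>f (x + R *v z)\<bar> \<le> ?C * (1 + (2 * (norm x)\<^sup>2 + 2 * (norm R)\<^sup>2 * (norm z)\<^sup>2))" for z
    using L_nonneg by (intro order_trans[OF abs_f_le] mult_left_mono add_left_mono norm_affine_power2_le) auto
  then show "AE z in gauss. norm (f (x + R *v z)) \<le> norm (?C * (1 + (2 * (norm x)\<^sup>2 + 2 * (norm R)\<^sup>2 * (norm z)\<^sup>2)))"
    using L_nonneg by (intro AE_I2) (auto intro: order_trans[OF _ abs_ge_self])
qed measurable

lemma norm_g_affine_le:
  fixes R :: "real^'d^'d"
  shows "norm (g (x + R *v z)) \<le> norm (g 0) + L * norm x + L * norm R * norm z"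
proof -
  have "norm (x + R *v z) \<le> norm x + norm R * norm z"
    by (intro order_trans[OF norm_triangle_ineq] add_left_mono norm_matrix_vector_mult_le)
  then have "L * norm (x + R *v z) \<le> L * (norm x + norm R * norm z)"
    using L_nonneg by (intro mult_left_mono)
  then show ?thesis using norm_g_le[of "x + R *v z"] by (simp add: algebra_simps)
qed

lemma integrable_gauss_g:
  fixes R :: "real^'d^'d"
  shows "integrable gauss (\<lambda>z. g (x + R *v z))"
proof (rule Bochner_Integration.integrable_bound)
  show "integrable gauss (\<lambda>z :: real^'d. norm (g 0) + L * norm x + L * norm R * norm z)"
    by (intro integrable_mult_right Bochner_Integration.integrable_add integrable_gauss_norm) auto
  show "AE z in gauss. norm (g (x + R *v z)) \<le> norm (norm (g 0) + L * norm x + L * norm R * norm z)"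
    using norm_g_affine_le[of x R] by (intro AE_I2) (auto intro: order_trans[OF _ abs_ge_self])
qed measurable

lemma integrable_gauss_g_inner:
  fixes R :: "real^'d^'d"
  shows "integrable gauss (\<lambda>z. g (x + R *v z) \<bullet> u)"
  using integrable_gauss_g by (rule integrable_inner_left)

lemma integrable_gauss_g_inner_mult:
  fixes R :: "real^'d^'d"
  shows "integrable gauss (\<lambda>z. (g (x + R *v z) \<bullet> u) * (z \<bullet> v))"
proof (rule Bochner_Integration.integrable_bound)
  let ?b = "\<lambda>z :: real^'d. norm u * norm v * ((norm (g 0) + L * norm x) * norm z + L * norm R * (norm z)\<^sup>2)"
  show "integrable gauss ?b"
    by (intro integrable_mult_right Bochner_Integration.integrable_add integrable_gauss_norm integrable_gauss_norm_power2)
  have "\<bar>(g (x + R *v z) \<bullet> u) * (z \<bullet> v)\<bar> \<le> ?b z" for z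
  proof -
    have "\<bar>(g (x + R *v z) \<bullet> u) * (z \<bullet> v)\<bar> \<le> (norm (g (x + R *v z)) * norm u) * (norm z * norm v)"
      unfolding abs_mult by (intro mult_mono Cauchy_Schwarz_ineq2) auto
    also have "\<dots> \<le> ((norm (g 0) + L * norm x + L * norm R * norm z) * norm u) * (norm z * norm v)"
      by (intro mult_right_mono norm_g_affine_le) auto
    finally show ?thesis by (simp add: algebra_simps power2_eq_square)
  qed
  then show "AE z in gauss. norm ((g (x + R *v z) \<bullet> u) * (z \<bullet> v)) \<le> norm (?b z)"
    by (intro AE_I2) (auto intro: order_trans[OF _ abs_ge_self])
qed measurable

definition smooth :: "real^'d^'d \<Rightarrow> real^'d \<Rightarrow> real" where
  "smooth R x = (\<integral>z. f (x + R *v z) \<partial>gauss)"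

definition smooth_grad :: "real^'d^'d \<Rightarrow> real^'d \<Rightarrow> real^'d" where
  "smooth_grad R x = (\<integral>z. g (x + R *v z) \<partial>gauss)"

lemma smooth_grad_inner: "smooth_grad R x \<bullet> u = (\<integral>z. g (x + R *v z) \<bullet> u \<partial>gauss)"
  unfolding smooth_grad_def by (rule integral_inner_left[symmetric]) (simp add: integrable_gauss_g)

lemma smooth_first_order: "\<bar>smooth R (x + u) - smooth R x - smooth_grad R x \<bullet> u\<bar> \<le> L / 2 * (norm u)\<^sup>2"
proof -
  have "smooth R (x + u) - smooth R x - smooth_grad R x \<bullet> u =
      (\<integral>z. f (x + R *v z + u) - f (x + R *v z) - g (x + R *v z) \<bullet> u \<partial>gauss)"
    unfolding smooth_def smooth_grad_inner
    using integrable_gauss_f[of "x + u" R] integrable_gauss_f[of x R] integrable_gauss_g_inner[of x R u]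
    by (simp add: add_ac)
  also have "\<bar>\<dots>\<bar> \<le> (\<integral>z. L / 2 * (norm u)\<^sup>2 \<partial>(gauss :: (real^'d) measure))"
  proof (intro abs_integral_le_integral)
    show "integrable gauss (\<lambda>z. f (x + R *v z + u) - f (x + R *v z) - g (x + R *v z) \<bullet> u)"
      using integrable_gauss_f[of "x + u" R] integrable_gauss_f[of x R] integrable_gauss_g_inner[of x R u]
      by (simp add: add_ac)
  qed (use first_order in auto)
  finally show ?thesis by (simp add: gauss.prob_space[unfolded space_gauss])
qed

text \<open>The bilinear form \<open>(u, w) \<mapsto> E[(g (x + R Z) \<bullet> u) (Z \<bullet> w)]\<close> with \<open>w = R\<^sup>-\<^sup>1 u\<close> plays the role of
  the Hessian of the smoothed function: one derivative has been moved to the Gaussian density, so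
  that \<open>f\<close> need not be twice differentiable.\<close>

lemma smooth_grad_increment:
  fixes u v x :: "real^'d"
  assumes Rv: "R *v v = u" and t: "0 \<le> t"
  shows "\<bar>smooth_grad R (x + t *\<^sub>R u) \<bullet> u - smooth_grad R x \<bullet> u - t * (\<integral>z. (g (x + R *v z) \<bullet> u) * (z \<bullet> v) \<partial>gauss)\<bar>
    \<le> L * (norm u)\<^sup>2 * norm v * t\<^sup>2 / 2"
proof -
  define q where "q y = g (x + R *v y) \<bullet> u" for y
  have [measurable]: "q \<in> borel_measurable borel" unfolding q_def by measurable
  have q_shift: "q (z + s *\<^sub>R v) = g (x + s *\<^sub>R u + R *v z) \<bullet> u" for z s
    by (simp add: q_def matrix_vector_right_distrib matrix_vector_mult_scaleR Rv add_ac)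
  define \<phi> where "\<phi> = (std_gaussian_density :: real^'d \<Rightarrow> real)"
  have \<phi>_meas[measurable]: "\<phi> \<in> borel_measurable borel" unfolding \<phi>_def by measurable
  define b where "b s = (\<integral>z. (g (x + s *\<^sub>R u + R *v z) \<bullet> u) * (z \<bullet> v) \<partial>gauss)" for s
  \<comment> \<open>Since R v = u, moving x by s u amounts to moving z by s v; after the change of
    variable, s occurs in the density only.\<close>
  have k: "smooth_grad R (x + s *\<^sub>R u) \<bullet> u = (\<integral>y. \<phi> (y - s *\<^sub>R v) * q y \<partial>lborel)"
    and k_int: "integrable lborel (\<lambda>y. \<phi> (y - s *\<^sub>R v) * q y)" for s
    using integral_gauss_shift[of q "s *\<^sub>R v"] integrable_gauss_shift[of q "s *\<^sub>R v"]
      integrable_gauss_g_inner[of "x + s *\<^sub>R u" R u]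
    by (simp_all add: q_shift \<phi>_def smooth_grad_inner)
  define J where "J s y = \<phi> (y - s *\<^sub>R v) * (q y * ((y - s *\<^sub>R v) \<bullet> v))" for s y
  have b: "b s = (\<integral>y. J s y \<partial>lborel)" and J_int: "integrable lborel (J s)"
    and J_norm: "(\<integral>y. norm (J s y) \<partial>lborel) = (\<integral>z. \<bar>(g (x + s *\<^sub>R u + R *v z) \<bullet> u) * (z \<bullet> v)\<bar> \<partial>gauss)" for s
  proof -
    let ?h = "\<lambda>y. q y * ((y - s *\<^sub>R v) \<bullet> v)"
    show "b s = (\<integral>y. J s y \<partial>lborel)" "integrable lborel (J s)"
      using integral_gauss_shift[of ?h "s *\<^sub>R v"] integrable_gauss_shift[of ?h "s *\<^sub>R v"]
        integrable_gauss_g_inner_mult[of "x + s *\<^sub>R u" R u v]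
      by (simp_all add: q_shift b_def J_def[abs_def] \<phi>_def)
    show "(\<integral>y. norm (J s y) \<partial>lborel) = (\<integral>z. \<bar>(g (x + s *\<^sub>R u + R *v z) \<bullet> u) * (z \<bullet> v)\<bar> \<partial>gauss)"
      using integral_gauss_shift[of "\<lambda>y. \<bar>?h y\<bar>" "s *\<^sub>R v"]
      by (simp add: q_shift J_def \<phi>_def abs_mult)
  qed
  \<comment> \<open>The absolute value stays inside the integral because the bound serves twice: for
    the Lipschitz estimate \<open>b_le\<close> and for the uniform bound \<open>J_norm_le\<close>
    behind Fubini.\<close>
  have b_diff: "(\<integral>z. \<bar>(g (x + s *\<^sub>R u + R *v z) \<bullet> u) * (z \<bullet> v) - (g (x + R *v z) \<bullet> u) * (z \<bullet> v)\<bar> \<partial>gauss)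
      \<le> L * (norm u)\<^sup>2 * norm v * s" if s: "0 \<le> s" for s
  proof -
    have int: "integrable gauss (\<lambda>z. \<bar>(g (x + s *\<^sub>R u + R *v z) \<bullet> u) * (z \<bullet> v) - (g (x + R *v z) \<bullet> u) * (z \<bullet> v)\<bar>)"
      by (intro integrable_abs Bochner_Integration.integrable_diff integrable_gauss_g_inner_mult)
    have "(\<integral>z. \<bar>(g (x + s *\<^sub>R u + R *v z) \<bullet> u) * (z \<bullet> v) - (g (x + R *v z) \<bullet> u) * (z \<bullet> v)\<bar> \<partial>gauss)
        \<le> (\<integral>z. L * (norm u)\<^sup>2 * s * \<bar>z \<bullet> v\<bar> \<partial>gauss)"
    proof (intro integral_mono int)
      show "integrable gauss (\<lambda>z. L * (norm u)\<^sup>2 * s * \<bar>z \<bullet> v\<bar>)"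
        by (intro integrable_mult_right integrable_abs integrable_gauss_inner)
      fix z
      have "\<bar>(g (x + s *\<^sub>R u + R *v z) - g (x + R *v z)) \<bullet> u\<bar> \<le>
          norm (g (x + s *\<^sub>R u + R *v z) - g (x + R *v z)) * norm u"
        by (rule Cauchy_Schwarz_ineq2)
      also have "\<dots> \<le> (L * norm (x + s *\<^sub>R u + R *v z - (x + R *v z))) * norm u"
        by (intro mult_right_mono lipschitz) simp
      also have "\<dots> = L * (norm u)\<^sup>2 * s" using s by (simp add: power2_eq_square)
      finally have "\<bar>(g (x + s *\<^sub>R u + R *v z) - g (x + R *v z)) \<bullet> u\<bar> * \<bar>z \<bullet> v\<bar> \<le> L * (norm u)\<^sup>2 * s * \<bar>z \<bullet> v\<bar>"
        by (rule mult_right_mono) simp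
      then show "\<bar>(g (x + s *\<^sub>R u + R *v z) \<bullet> u) * (z \<bullet> v) - (g (x + R *v z) \<bullet> u) * (z \<bullet> v)\<bar> \<le> L * (norm u)\<^sup>2 * s * \<bar>z \<bullet> v\<bar>"
        by (simp add: abs_mult[symmetric] inner_diff_left left_diff_distrib)
    qed
    also have "\<dots> \<le> L * (norm u)\<^sup>2 * s * norm v"
      using L_nonneg s by (simp, intro mult_left_mono integral_gauss_abs_inner_le) auto
    finally show ?thesis by (simp add: mult_ac)
  qed
  have b_le: "\<bar>b s - b 0\<bar> \<le> L * (norm u)\<^sup>2 * norm v * s" if s: "0 \<le> s" for s
  proof -
    have "b s - b 0 = (\<integral>z. (g (x + s *\<^sub>R u + R *v z) \<bullet> u) * (z \<bullet> v) - (g (x + R *v z) \<bullet> u) * (z \<bullet> v) \<partial>gauss)"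
      unfolding b_def by (simp add: integrable_gauss_g_inner_mult)
    then show ?thesis
      using integral_abs_bound[of gauss "\<lambda>z. (g (x + s *\<^sub>R u + R *v z) \<bullet> u) * (z \<bullet> v) - (g (x + R *v z) \<bullet> u) * (z \<bullet> v)"]
        b_diff[OF s] by linarith
  qed
  let ?I = "\<lambda>s. indicator {0..t} s :: real"
  have J_meas[measurable]: "(\<lambda>(s, y). ?I s * J s y) \<in> borel_measurable (lborel \<Otimes>\<^sub>M lborel)"
    unfolding J_def by measurable
  define K where "K = (\<integral>z. \<bar>(g (x + R *v z) \<bullet> u) * (z \<bullet> v)\<bar> \<partial>gauss) + L * (norm u)\<^sup>2 * norm v * t"
  have J_norm_le: "(\<integral>y. norm (J s y) \<partial>lborel) \<le> K" if "0 \<le> s" "s \<le> t" for s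
  proof -
    have "(\<integral>y. norm (J s y) \<partial>lborel) \<le>
      (\<integral>z. \<bar>(g (x + R *v z) \<bullet> u) * (z \<bullet> v)\<bar> +
        \<bar>(g (x + s *\<^sub>R u + R *v z) \<bullet> u) * (z \<bullet> v) - (g (x + R *v z) \<bullet> u) * (z \<bullet> v)\<bar> \<partial>gauss)"
      unfolding J_norm
      by (intro integral_mono integrable_abs Bochner_Integration.integrable_add Bochner_Integration.integrable_diff
          integrable_gauss_g_inner_mult) auto
    also have "\<dots> \<le> (\<integral>z. \<bar>(g (x + R *v z) \<bullet> u) * (z \<bullet> v)\<bar> \<partial>gauss) + L * (norm u)\<^sup>2 * norm v * s"
      using b_diff[OF that(1)]
      by (subst Bochner_Integration.integral_add)
        (auto intro!: integrable_abs Bochner_Integration.integrable_diff integrable_gauss_g_inner_mult)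
    also have "\<dots> \<le> K" unfolding K_def using that L_nonneg by (intro add_left_mono mult_left_mono) auto
    finally show ?thesis .
  qed
  have ind_int: "integrable lborel (\<lambda>s. ?I s * c)" for c :: real
    using t by (intro integrable_mult_left integrable_real_indicator) auto
  have J_pair: "integrable (lborel \<Otimes>\<^sub>M lborel) (\<lambda>(s, y). ?I s * J s y)"
  proof (rule lborel_pair.Fubini_integrable[OF J_meas])
    show "AE s in lborel. integrable lborel (\<lambda>y. case (s, y) of (s, y) \<Rightarrow> ?I s * J s y)"
      using J_int by simp
    show "integrable lborel (\<lambda>s. \<integral>y. norm (case (s, y) of (s, y) \<Rightarrow> ?I s * J s y) \<partial>lborel)"
    proof (rule Bochner_Integration.integrable_bound[OF ind_int[of K]])
      show "(\<lambda>s. \<integral>y. norm (case (s, y) of (s, y) \<Rightarrow> ?I s * J s y) \<partial>lborel) \<in> borel_measurable lborel"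
        by measurable
      show "AE s in lborel. norm (\<integral>y. norm (case (s, y) of (s, y) \<Rightarrow> ?I s * J s y) \<partial>lborel) \<le> norm (?I s * K)"
        using J_norm_le by (intro AE_I2) (auto simp: indicator_def intro: order_trans[OF _ abs_ge_self])
    qed
  qed
  \<comment> \<open>For fixed y only the density is differentiated; q y is a constant
    factor.\<close>
  have FTC: "(\<integral>s. ?I s * J s y \<partial>lborel) = (\<phi> (y - t *\<^sub>R v) - \<phi> y) * q y" for y
  proof -
    have "(\<integral>s. (((y - s *\<^sub>R v) \<bullet> v) * \<phi> (y - s *\<^sub>R v)) * indicator {0..t} s \<partial>lborel) =
        \<phi> (y - t *\<^sub>R v) - \<phi> (y - 0 *\<^sub>R v)"
    proof (rule integral_FTC_Icc_real[OF t])
      show "((\<lambda>s. \<phi> (y - s *\<^sub>R v)) has_real_derivative ((y - s *\<^sub>R v) \<bullet> v) * \<phi> (y - s *\<^sub>R v)) (at s)" for s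
        unfolding \<phi>_def by (rule std_gaussian_density_line_deriv)
      show "isCont (\<lambda>s. ((y - s *\<^sub>R v) \<bullet> v) * \<phi> (y - s *\<^sub>R v)) s" for s
        unfolding \<phi>_def std_gaussian_density_eq_exp by (intro continuous_intros) auto
    qed
    moreover have "(\<integral>s. ?I s * J s y \<partial>lborel) =
        (\<integral>s. ((((y - s *\<^sub>R v) \<bullet> v) * \<phi> (y - s *\<^sub>R v)) * indicator {0..t} s) * q y \<partial>lborel)"
      by (simp add: J_def mult_ac)
    ultimately show ?thesis by simp
  qed
  \<comment> \<open>Exchanging the integrals shows the increment to be the integral of b over
    [0, t], so b is the second derivative in integrated form; it remains to compare b s with b
    0.\<close>
  have "smooth_grad R (x + t *\<^sub>R u) \<bullet> u - smooth_grad R x \<bullet> u = (\<integral>y. (\<phi> (y - t *\<^sub>R v) - \<phi> y) * q y \<partial>lborel)"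
    using k[of t] k[of 0] k_int[of t] k_int[of 0] by (simp add: left_diff_distrib)
  also have "\<dots> = (\<integral>y. \<integral>s. ?I s * J s y \<partial>lborel \<partial>lborel)" by (simp add: FTC)
  also have "\<dots> = (\<integral>s. \<integral>y. ?I s * J s y \<partial>lborel \<partial>lborel)"
    using lborel_pair.Fubini_integral[OF J_pair] by simp
  also have "\<dots> = (\<integral>s. ?I s * b s \<partial>lborel)" by (simp add: b)
  finally have k_diff: "smooth_grad R (x + t *\<^sub>R u) \<bullet> u - smooth_grad R x \<bullet> u = (\<integral>s. ?I s * b s \<partial>lborel)" .
  have b_int: "integrable lborel (\<lambda>s. ?I s * b s)"
    using lborel_pair.integrable_fst'[OF J_pair] by (simp add: b)
  have s_int: "(\<integral>s. (L * (norm u)\<^sup>2 * norm v * s) * ?I s \<partial>lborel) = L * (norm u)\<^sup>2 * norm v * t\<^sup>2 / 2"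
  proof -
    have "((\<lambda>s. L * (norm u)\<^sup>2 * norm v * s\<^sup>2 / 2) has_real_derivative L * (norm u)\<^sup>2 * norm v * s) (at s)" for s
      by (auto intro!: derivative_eq_intros)
    from integral_FTC_Icc_real[OF t this] show ?thesis by simp
  qed
  have "t * b 0 = (\<integral>s. ?I s * b 0 \<partial>lborel)" using t by simp
  then have "\<bar>smooth_grad R (x + t *\<^sub>R u) \<bullet> u - smooth_grad R x \<bullet> u - t * b 0\<bar> = \<bar>\<integral>s. ?I s * b s - ?I s * b 0 \<partial>lborel\<bar>"
    using t b_int ind_int[of "b 0"] by (simp add: k_diff)
  also have "\<dots> \<le> (\<integral>s. (L * (norm u)\<^sup>2 * norm v * s) * ?I s \<partial>lborel)"
  proof (rule abs_integral_le_integral)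
    show "integrable lborel (\<lambda>s. ?I s * b s - ?I s * b 0)"
      using b_int ind_int by (intro Bochner_Integration.integrable_diff)
    show "integrable lborel (\<lambda>s. (L * (norm u)\<^sup>2 * norm v * s) * ?I s)"
      using borel_integrable_atLeastAtMost[of 0 t "\<lambda>s. L * (norm u)\<^sup>2 * norm v * s"]
      by (simp add: indicator_def if_distrib cong: if_cong)
    show "\<bar>?I s * b s - ?I s * b 0\<bar> \<le> (L * (norm u)\<^sup>2 * norm v * s) * ?I s" for s
      using b_le[of s] by (auto simp: indicator_def)
  qed
  also have "\<dots> = L * (norm u)\<^sup>2 * norm v * t\<^sup>2 / 2" by (rule s_int)
  finally show ?thesis by (simp add: b_def)
qed

text \<open>Integrates \<open>smooth_grad_increment\<close> along the segment, which turns t^2 / 2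
  into 1/6. The factor |v| is the gain from smoothing: with v = R^-1 u it is at most |u| / sqrt l,
  so the error is cubic in u, whereas f itself only allows the quadratic error of
  \<open>first_order\<close>.\<close>

lemma smooth_second_order:
  fixes u v x :: "real^'d"
  assumes Rv: "R *v v = u"
  shows "\<bar>smooth R (x + u) - smooth R x - smooth_grad R x \<bullet> u - (\<integral>z. (g (x + R *v z) \<bullet> u) * (z \<bullet> v) \<partial>gauss) / 2\<bar>
    \<le> L * (norm u)\<^sup>2 * norm v / 6"
proof -
  define b where "b = (\<integral>z. (g (x + R *v z) \<bullet> u) * (z \<bullet> v) \<partial>gauss)"
  define F where "F t = smooth R (x + t *\<^sub>R u) - t * (smooth_grad R x \<bullet> u) - t\<^sup>2 / 2 * b" for t
  have deriv: "((\<lambda>t. smooth R (x + t *\<^sub>R u)) has_real_derivative smooth_grad R (x + t *\<^sub>R u) \<bullet> u) (at t)" for t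
  proof (rule DERIV_of_quadratic_bound)
    fix e
    show "\<bar>smooth R (x + (t + e) *\<^sub>R u) - smooth R (x + t *\<^sub>R u) - e * (smooth_grad R (x + t *\<^sub>R u) \<bullet> u)\<bar>
        \<le> (L / 2 * (norm u)\<^sup>2) * e\<^sup>2"
      using smooth_first_order[of R "x + t *\<^sub>R u" "e *\<^sub>R u"]
      by (simp add: algebra_simps power_mult_distrib)
  qed
  have "\<bar>F 1 - F 0\<bar> \<le> (L * (norm u)\<^sup>2 * norm v / 2) / real (Suc 2)"
  proof (rule abs_diff_le_of_DERIV_bound[where F'="\<lambda>t. smooth_grad R (x + t *\<^sub>R u) \<bullet> u - smooth_grad R x \<bullet> u - t * b"])
    fix t :: real assume t: "0 \<le> t"
    show "(F has_real_derivative smooth_grad R (x + t *\<^sub>R u) \<bullet> u - smooth_grad R x \<bullet> u - t * b) (at t)"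
      unfolding F_def by (auto intro!: derivative_eq_intros deriv)
    show "\<bar>smooth_grad R (x + t *\<^sub>R u) \<bullet> u - smooth_grad R x \<bullet> u - t * b\<bar> \<le> L * (norm u)\<^sup>2 * norm v / 2 * t\<^sup>2"
      using smooth_grad_increment[OF Rv t, of x] by (simp add: b_def)
  qed
  moreover have "F 1 - F 0 = smooth R (x + u) - smooth R x - smooth_grad R x \<bullet> u - b / 2"
    by (simp add: F_def)
  ultimately show ?thesis by (simp add: b_def)
qed

end

section \<open>Measurability of random roots, size of the root, and entrywise Gaussian
  moments\<close>

lemma borel_measurable_matrix_vector_mult_pair [measurable (raw)]:
  fixes A :: "'a \<Rightarrow> real^'n^'m"
  assumes "A \<in> borel_measurable M" "z \<in> borel_measurable M"
  shows "(\<lambda>\<omega>. A \<omega> *v z \<omega>) \<in> borel_measurable M"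
proof -
  have "continuous_on UNIV (\<lambda>p :: (real^'n^'m) \<times> (real^'n). fst p *v snd p)"
    unfolding matrix_vector_mult_def by (intro continuous_on_vec_lambda continuous_intros)
  then show ?thesis
    using borel_measurable_continuous_Pair[OF assms, of "\<lambda>A z. A *v z"] by (simp add: case_prod_beta')
qed

lemma borel_measurable_vec_nth [measurable (raw)]:
  assumes "v \<in> borel_measurable M"
  shows "(\<lambda>\<omega>. v \<omega> $ i :: 'b :: real_normed_vector) \<in> borel_measurable M"
  using assms by (rule borel_measurable_continuous_on[rotated]) (intro continuous_intros)

text \<open>On the closed set of matrices above l I the root and its inverse are continuous;
  extended by 0 they are Borel, and Q never leaves that set. The bound at every point is the reason
  for clipping in the main argument.\<close>

lemma borel_measurable_posdef_sqrt:
  fixes Q :: "'a \<Rightarrow> real^'d^'d"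
  assumes [measurable]: "Q \<in> borel_measurable M" and Q: "\<And>\<omega>. l *\<^sub>R mat 1 \<preceq> Q \<omega>" and l: "0 < l"
  shows "(\<lambda>\<omega>. posdef_sqrt (Q \<omega>)) \<in> borel_measurable M"
    and "(\<lambda>\<omega>. matrix_inv (posdef_sqrt (Q \<omega>)) $ i $ j) \<in> borel_measurable M"
proof -
  let ?C = "{A :: real^'d^'d. l *\<^sub>R mat 1 \<preceq> A}"
  have C: "?C \<in> sets borel" by (intro borel_closed closed_loewner_ge)
  have [measurable]: "(\<lambda>A. if A \<in> ?C then posdef_sqrt A else 0) \<in> borel_measurable borel"
    by (intro borel_measurable_continuous_on_if C continuous_on_posdef_sqrt l continuous_on_const)
  have "(\<lambda>\<omega>. (\<lambda>A. if A \<in> ?C then posdef_sqrt A else 0) (Q \<omega>)) \<in> borel_measurable M"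
    by measurable
  then show "(\<lambda>\<omega>. posdef_sqrt (Q \<omega>)) \<in> borel_measurable M" using Q by simp
  have [measurable]: "(\<lambda>A. if A \<in> ?C then matrix_inv (posdef_sqrt A) $ i $ j else 0) \<in> borel_measurable borel"
    by (intro borel_measurable_continuous_on_if C continuous_on_matrix_inv_posdef_sqrt l continuous_on_const)
  have "(\<lambda>\<omega>. (\<lambda>A. if A \<in> ?C then matrix_inv (posdef_sqrt A) $ i $ j else 0) (Q \<omega>)) \<in> borel_measurable M"
    by measurable
  then show "(\<lambda>\<omega>. matrix_inv (posdef_sqrt (Q \<omega>)) $ i $ j) \<in> borel_measurable M" using Q by simp
qed

lemma trace_le_loewner:
  fixes V :: "real^'d^'d"
  assumes "V \<preceq> c *\<^sub>R mat 1"
  shows "trace V \<le> c * real CARD('d)"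
proof -
  have "V $ i $ i \<le> c" for i
    using assms by (simp add: loewner_le_scaleR_mat_1_iff matrix_component_eq_inner)
      (metis mult.right_neutral norm_axis_1 power_one)
  then have "trace V \<le> (\<Sum>i\<in>(UNIV::'d set). c)" unfolding trace_def by (intro sum_mono)
  then show ?thesis by (simp add: mult.commute)
qed

lemma norm_posdef_sqrt_le:
  fixes Q :: "real^'d^'d"
  assumes Q: "l *\<^sub>R mat 1 \<preceq> Q" "0 < l" and c: "Q \<preceq> c *\<^sub>R mat 1"
  shows "norm (posdef_sqrt Q) \<le> sqrt (c * real CARD('d))"
proof (rule real_le_rsqrt)
  have "(norm (posdef_sqrt Q))\<^sup>2 = (\<Sum>i\<in>UNIV. (norm (posdef_sqrt Q $ i))\<^sup>2)"
    unfolding power2_norm_eq_inner by (simp add: inner_vec_def)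
  also have "\<dots> = trace Q"
    using trace_square_eq_sum_norm_rows[OF posdef_sqrt_props(3)[OF Q]] by (simp add: posdef_sqrt_props(2)[OF Q])
  also have "\<dots> \<le> c * real CARD('d)" by (rule trace_le_loewner[OF c])
  finally show "(norm (posdef_sqrt Q))\<^sup>2 \<le> c * real CARD('d)" .
qed

lemma integral_gauss_posdef_sqrt_components:
  fixes V :: "real^'d^'d"
  assumes V: "a *\<^sub>R mat 1 \<preceq> V" "0 < a"
  shows "integrable gauss (\<lambda>w. (posdef_sqrt V *v w) $ i * (posdef_sqrt V *v w) $ j)"
    and "(\<integral>w. (posdef_sqrt V *v w) $ i * (posdef_sqrt V *v w) $ j \<partial>gauss) = V $ i $ j"
    and "integrable gauss (\<lambda>w. u \<bullet> (posdef_sqrt V *v w))"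
    and "(\<integral>w. u \<bullet> (posdef_sqrt V *v w) \<partial>gauss) = 0"
proof -
  let ?T = "posdef_sqrt V"
  have row: "(?T *v w) $ i = w \<bullet> ?T $ i" for w i
    by (simp add: matrix_vector_mult_def inner_vec_def mult.commute)
  show "integrable gauss (\<lambda>w. (?T *v w) $ i * (?T *v w) $ j)"
    unfolding row by (rule integrable_gauss_inner_mult)
  have "(?T ** ?T) $ i $ j = ?T $ i \<bullet> transpose ?T $ j"
    by (simp add: matrix_matrix_mult_def inner_vec_def transpose_def)
  then have "V $ i $ j = ?T $ i \<bullet> ?T $ j"
    by (simp add: posdef_sqrt_props[OF V])
  then show "(\<integral>w. (?T *v w) $ i * (?T *v w) $ j \<partial>gauss) = V $ i $ j"
    unfolding row by (simp add: integral_gauss_inner_mult)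
  have u: "u \<bullet> (?T *v w) = w \<bullet> (?T *v u)" for w
    using symmetric_inner_matrix_vector[OF posdef_sqrt_props(3)[OF V], of u w] by (simp add: inner_commute)
  show "integrable gauss (\<lambda>w. u \<bullet> (?T *v w))" "(\<integral>w. u \<bullet> (?T *v w) \<partial>gauss) = 0"
    unfolding u by (rule integrable_gauss_inner integral_gauss_inner)+
qed

section \<open>The smoothed function: growth, Hessian entries and Gaussian increments\<close>

context lipschitz_gradient
begin

lemma measurable_smooth [measurable (raw)]:
  assumes [measurable]: "R \<in> borel_measurable M" "x \<in> borel_measurable M"
  shows "(\<lambda>\<omega>. smooth (R \<omega>) (x \<omega>)) \<in> borel_measurable M"
  unfolding smooth_def by measurable

lemma measurable_smooth_grad [measurable (raw)]:
  assumes [measurable]: "R \<in> borel_measurable M" "x \<in> borel_measurable M"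
  shows "(\<lambda>\<omega>. smooth_grad (R \<omega>) (x \<omega>)) \<in> borel_measurable M"
  unfolding smooth_grad_def by measurable

text \<open>For \<open>W = R\<^sup>-\<^sup>1\<close> these are the entries of the Hessian of \<open>smooth R\<close> at \<open>x\<close>.\<close>

definition smooth_hess :: "real^'d^'d \<Rightarrow> real^'d^'d \<Rightarrow> real^'d \<Rightarrow> 'd \<Rightarrow> 'd \<Rightarrow> real" where
  "smooth_hess R W x i j = (\<integral>z. (g (x + R *v z) \<bullet> axis i 1) * (z \<bullet> (W *v axis j 1)) \<partial>gauss)"

text \<open>Expanding into entries separates coefficients known before the step from the products
  u_i u_j, so that a covariance can be inserted entry by entry.\<close>

lemma smooth_hess_quadratic:
  "(\<integral>z. (g (x + R *v z) \<bullet> u) * (z \<bullet> (W *v u)) \<partial>gauss) = (\<Sum>i\<in>UNIV. \<Sum>j\<in>UNIV. smooth_hess R W x i j * (u $ i * u $ j))"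
proof -
  have W: "W *v u = (\<Sum>j\<in>UNIV. u $ j *\<^sub>R (W *v axis j 1))"
    by (simp only: matrix_mult_sum[of W u]) (simp add: matrix_vector_mult_basis scalar_mult_eq_scaleR)
  have u: "a \<bullet> u = (\<Sum>i\<in>UNIV. (a \<bullet> axis i 1) * u $ i)" for a :: "real^'d"
    by (subst inner_vec_def) (simp add: inner_axis)
  have "(g (x + R *v z) \<bullet> u) * (z \<bullet> (W *v u)) =
      (\<Sum>i\<in>UNIV. \<Sum>j\<in>UNIV. ((g (x + R *v z) \<bullet> axis i 1) * (z \<bullet> (W *v axis j 1))) * (u $ i * u $ j))" for z
    unfolding W u[of "g (x + R *v z)"] inner_sum_right inner_scaleR_right sum_product
    by (intro sum.cong refl) (simp only: mult_ac)
  then show ?thesis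
    unfolding smooth_hess_def by (simp add: integrable_gauss_g_inner_mult)
qed

lemma abs_smooth_hess_le:
  assumes W: "\<And>u. norm (W *v u) \<le> \<kappa> * norm u"
  shows "\<bar>smooth_hess R W x i j\<bar> \<le> L * norm R * \<kappa> * (\<integral>z. (norm z)\<^sup>2 \<partial>(gauss :: (real^'d) measure))"
proof -
  let ?w = "W *v axis j 1"
  have w: "norm ?w \<le> \<kappa>" using W[of "axis j 1"] by simp
  \<comment> \<open>Centring: z . w has mean 0, so g x may be subtracted at no cost. The Lipschitz
    bound then gives an estimate that does not depend on x.\<close>
  have "(\<integral>z. (g x \<bullet> axis i 1) * (z \<bullet> ?w) \<partial>gauss) = 0"
    by (simp add: integral_gauss_inner)
  then have "smooth_hess R W x i j = (\<integral>z. (g (x + R *v z) \<bullet> axis i 1) * (z \<bullet> ?w) - (g x \<bullet> axis i 1) * (z \<bullet> ?w) \<partial>gauss)"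
    unfolding smooth_hess_def
    by (subst Bochner_Integration.integral_diff) (auto simp: integrable_gauss_g_inner_mult integrable_gauss_inner)
  also have "\<bar>\<dots>\<bar> \<le> (\<integral>z. L * norm R * \<kappa> * (norm z)\<^sup>2 \<partial>(gauss :: (real^'d) measure))"
  proof (rule abs_integral_le_integral)
    show "integrable gauss (\<lambda>z. (g (x + R *v z) \<bullet> axis i 1) * (z \<bullet> ?w) - (g x \<bullet> axis i 1) * (z \<bullet> ?w))"
      by (intro Bochner_Integration.integrable_diff integrable_gauss_g_inner_mult integrable_mult_right integrable_gauss_inner)
    show "integrable gauss (\<lambda>z :: real^'d. L * norm R * \<kappa> * (norm z)\<^sup>2)"
      by (intro integrable_mult_right integrable_gauss_norm_power2)
    fix z
    have "\<bar>(g (x + R *v z) - g x) \<bullet> axis i 1\<bar> \<le> norm (g (x + R *v z) - g x)"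
      using Cauchy_Schwarz_ineq2[of "g (x + R *v z) - g x" "axis i 1"] by simp
    also have "\<dots> \<le> L * norm (x + R *v z - x)" by (rule lipschitz)
    also have "\<dots> \<le> L * (norm R * norm z)"
      using L_nonneg by (simp, intro mult_left_mono norm_matrix_vector_mult_le)
    finally have 1: "\<bar>(g (x + R *v z) - g x) \<bullet> axis i 1\<bar> \<le> L * (norm R * norm z)" .
    have 2: "\<bar>z \<bullet> ?w\<bar> \<le> norm z * \<kappa>"
      by (rule order_trans[OF Cauchy_Schwarz_ineq2 mult_left_mono[OF w]]) simp
    have "\<bar>(g (x + R *v z) - g x) \<bullet> axis i 1\<bar> * \<bar>z \<bullet> ?w\<bar> \<le> L * (norm R * norm z) * (norm z * \<kappa>)"
      by (rule mult_mono[OF 1 2]) (auto simp: L_nonneg)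
    moreover have "(g (x + R *v z) \<bullet> axis i 1) * (z \<bullet> ?w) - (g x \<bullet> axis i 1) * (z \<bullet> ?w) =
        ((g (x + R *v z) - g x) \<bullet> axis i 1) * (z \<bullet> ?w)"
      by (simp add: inner_diff_left left_diff_distrib)
    ultimately show "\<bar>(g (x + R *v z) \<bullet> axis i 1) * (z \<bullet> ?w) - (g x \<bullet> axis i 1) * (z \<bullet> ?w)\<bar> \<le> L * norm R * \<kappa> * (norm z)\<^sup>2"
      by (simp add: abs_mult power2_eq_square mult_ac)
  qed
  finally show ?thesis by simp
qed

lemma norm_smooth_grad_le:
  "norm (smooth_grad R x) \<le> norm (g 0) + L * norm x + L * norm R * (\<integral>z. norm z \<partial>(gauss :: (real^'d) measure))"
proof -
  have "norm (smooth_grad R x) \<le> (\<integral>z. norm (g (x + R *v z)) \<partial>gauss)"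
    unfolding smooth_grad_def by (rule integral_norm_bound)
  also have "\<dots> \<le> (\<integral>z. norm (g 0) + L * norm x + L * norm R * norm z \<partial>(gauss :: (real^'d) measure))"
    by (intro integral_mono integrable_norm integrable_gauss_g norm_g_affine_le
        Bochner_Integration.integrable_add integrable_mult_right integrable_gauss_norm) auto
  also have "\<dots> = norm (g 0) + L * norm x + L * norm R * (\<integral>z. norm z \<partial>(gauss :: (real^'d) measure))"
    by (simp add: integrable_gauss_norm gauss.prob_space[unfolded space_gauss])
  finally show ?thesis .
qed

lemma abs_smooth_le:
  "\<bar>smooth R x\<bar> \<le> (\<bar>f 0\<bar> + norm (g 0) + L) *
     (1 + (2 * (norm x)\<^sup>2 + 2 * (norm R)\<^sup>2 * (\<integral>z. (norm z)\<^sup>2 \<partial>(gauss :: (real^'d) measure))))"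
proof -
  let ?C = "\<bar>f 0\<bar> + norm (g 0) + L"
  have int: "integrable gauss (\<lambda>z :: real^'d. 1 + (2 * (norm x)\<^sup>2 + 2 * (norm R)\<^sup>2 * (norm z)\<^sup>2))"
    by (intro integrable_mult_right Bochner_Integration.integrable_add integrable_gauss_norm_power2) auto
  have "\<bar>smooth R x\<bar> \<le> (\<integral>z. ?C * (1 + (2 * (norm x)\<^sup>2 + 2 * (norm R)\<^sup>2 * (norm z)\<^sup>2)) \<partial>(gauss :: (real^'d) measure))"
    unfolding smooth_def
  proof (rule abs_integral_le_integral[OF integrable_gauss_f integrable_mult_right[OF int]])
    show "\<bar>f (x + R *v z)\<bar> \<le> ?C * (1 + (2 * (norm x)\<^sup>2 + 2 * (norm R)\<^sup>2 * (norm z)\<^sup>2))" for z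
      using L_nonneg by (intro order_trans[OF abs_f_le] mult_left_mono add_left_mono norm_affine_power2_le) auto
  qed
  also have "\<dots> = ?C * (\<integral>z. 1 + (2 * (norm x)\<^sup>2 + 2 * (norm R)\<^sup>2 * (norm z)\<^sup>2) \<partial>(gauss :: (real^'d) measure))"
    by simp
  also have "(\<integral>z. 1 + (2 * (norm x)\<^sup>2 + 2 * (norm R)\<^sup>2 * (norm z)\<^sup>2) \<partial>(gauss :: (real^'d) measure)) =
      1 + (2 * (norm x)\<^sup>2 + 2 * (norm R)\<^sup>2 * (\<integral>z. (norm z)\<^sup>2 \<partial>(gauss :: (real^'d) measure)))"
    by (simp add: integrable_gauss_norm_power2 gauss.prob_space[unfolded space_gauss])
  finally show ?thesis .
qed

lemma integrable_gauss_smooth: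
  fixes T :: "real^'d^'d"
  shows "integrable gauss (\<lambda>w. smooth R (x + T *v w))"
proof (rule Bochner_Integration.integrable_bound)
  let ?C = "\<bar>f 0\<bar> + norm (g 0) + L"
  let ?b = "\<lambda>w :: real^'d. ?C * (1 + (2 * (2 * (norm x)\<^sup>2 + 2 * (norm T)\<^sup>2 * (norm w)\<^sup>2) +
      2 * (norm R)\<^sup>2 * (\<integral>z. (norm z)\<^sup>2 \<partial>(gauss :: (real^'d) measure))))"
  show "integrable gauss ?b"
    by (intro integrable_mult_right Bochner_Integration.integrable_add integrable_gauss_norm_power2) auto
  have "\<bar>smooth R (x + T *v w)\<bar> \<le> ?b w" for w
    using L_nonneg
    by (intro order_trans[OF abs_smooth_le] mult_left_mono add_left_mono add_right_mono norm_affine_power2_le) auto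
  then show "AE w in gauss. norm (smooth R (x + T *v w)) \<le> norm (?b w)"
    by (intro AE_I2) (auto intro: order_trans[OF _ abs_ge_self])
qed measurable

text \<open>The convolution identity for Gaussian laws and Fubini. It presents the Gaussian half of
  a replacement step as a random increment of the same function
  \<open>smooth (posdef_sqrt Q)\<close> in which X is inserted.\<close>

lemma smooth_posdef_sqrt_add:
  fixes Q V :: "real^'d^'d"
  assumes Q: "l *\<^sub>R mat 1 \<preceq> Q" and V: "a *\<^sub>R mat 1 \<preceq> V" and pos: "0 < l" "0 < a"
  shows "smooth (posdef_sqrt (Q + V)) x = (\<integral>w. smooth (posdef_sqrt Q) (x + posdef_sqrt V *v w) \<partial>gauss)"
proof -
  let ?R = "posdef_sqrt Q" and ?T = "posdef_sqrt V"
  let ?G = "gauss \<Otimes>\<^sub>M gauss :: ((real^'d) \<times> (real^'d)) measure"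
  have meas: "(\<lambda>(z, w). ?R *v z + ?T *v w) \<in> measurable ?G borel" by measurable
  have "smooth (posdef_sqrt (Q + V)) x = (\<integral>y. f (x + y) \<partial>distr gauss borel ((*v) (posdef_sqrt (Q + V))))"
    unfolding smooth_def by (subst integral_distr) auto
  also have "\<dots> = (\<integral>y. f (x + y) \<partial>distr ?G borel (\<lambda>(z, w). ?R *v z + ?T *v w))"
    by (simp only: distr_gauss_pair_posdef_sqrt[OF Q V pos])
  also have "\<dots> = (\<integral>p. f (x + (?R *v fst p + ?T *v snd p)) \<partial>?G)"
    by (subst integral_distr[OF meas]) (auto simp: case_prod_beta')
  also have "\<dots> = (\<integral>w. \<integral>z. f (x + (?R *v z + ?T *v w)) \<partial>gauss \<partial>gauss)"
  proof -
    have "integrable (distr gauss borel ((*v) (posdef_sqrt (Q + V)))) (\<lambda>y. f (x + y))"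
      by (subst integrable_distr_eq) (auto intro: integrable_gauss_f)
    then have "integrable (distr ?G borel (\<lambda>(z, w). ?R *v z + ?T *v w)) (\<lambda>y. f (x + y))"
      by (simp only: distr_gauss_pair_posdef_sqrt[OF Q V pos])
    then have "integrable ?G (\<lambda>(z, w). f (x + (?R *v z + ?T *v w)))"
      by (subst (asm) integrable_distr_eq[OF meas]) (auto simp: case_prod_beta')
    from gauss_pair.integral_snd[OF this] show ?thesis by (simp add: case_prod_beta')
  qed
  finally show ?thesis by (simp add: smooth_def add_ac)
qed

text \<open>The second-order expansion at u = V^(1/2) w, averaged over w: the linear term vanishes
  and the quadratic one becomes H paired with V. The 1/3 is the Taylor constant 1/6 times the factor
  2 of the third Gaussian moment.\<close>

lemma smooth_gauss_increment:
  fixes Q V :: "real^'d^'d"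
  assumes Q: "l *\<^sub>R mat 1 \<preceq> Q" and V: "a *\<^sub>R mat 1 \<preceq> V" and pos: "0 < l" "0 < a"
  shows "\<bar>smooth (posdef_sqrt (Q + V)) x - smooth (posdef_sqrt Q) x -
      (\<Sum>i\<in>UNIV. \<Sum>j\<in>UNIV. smooth_hess (posdef_sqrt Q) (matrix_inv (posdef_sqrt Q)) x i j * V $ i $ j) / 2\<bar>
    \<le> L / (3 * sqrt l) * (trace V * sqrt (trace V))"
proof -
  let ?R = "posdef_sqrt Q" and ?T = "posdef_sqrt V" and ?W = "matrix_inv (posdef_sqrt Q)"
  define H where "H = smooth_hess ?R ?W x"
  define rem where "rem w = smooth ?R (x + ?T *v w) - smooth ?R x - smooth_grad ?R x \<bullet> (?T *v w) -
     (\<Sum>i\<in>UNIV. \<Sum>j\<in>UNIV. H i j * ((?T *v w) $ i * (?T *v w) $ j)) / 2" for w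
  note comp = integral_gauss_posdef_sqrt_components[OF V pos(2)]
  have rem_int: "integrable gauss rem"
    unfolding rem_def using comp integrable_gauss_smooth by simp
  have rem_eq: "(\<integral>w. rem w \<partial>gauss) = smooth (posdef_sqrt (Q + V)) x - smooth ?R x -
      (\<Sum>i\<in>UNIV. \<Sum>j\<in>UNIV. H i j * V $ i $ j) / 2"
    unfolding rem_def using comp integrable_gauss_smooth
    by (simp add: smooth_posdef_sqrt_add[OF Q V pos] gauss.prob_space[unfolded space_gauss])
  have rem_le: "\<bar>rem w\<bar> \<le> L / (6 * sqrt l) * norm (?T *v w) ^ 3" for w
  proof -
    let ?u = "?T *v w"
    have "?R *v (?W *v ?u) = (?R ** ?W) *v ?u" by (rule matrix_vector_mul_assoc)
    then have "?R *v (?W *v ?u) = ?u"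
      using matrix_inv_mult(1)[OF posdef_sqrt_props(4)[OF Q pos(1)]] by simp
    from smooth_second_order[OF this, of x]
    have "\<bar>rem w\<bar> \<le> L * (norm ?u)\<^sup>2 * norm (?W *v ?u) / 6"
      unfolding rem_def H_def smooth_hess_quadratic .
    also have "\<dots> \<le> L * (norm ?u)\<^sup>2 * (norm ?u / sqrt l) / 6"
      using L_nonneg norm_matrix_inv_posdef_sqrt_mult_vec_le[OF Q pos(1)]
      by (intro divide_right_mono mult_left_mono) auto
    finally show ?thesis by (simp add: power2_eq_square power3_eq_cube mult_ac)
  qed
  have "\<bar>\<integral>w. rem w \<partial>gauss\<bar> \<le> (\<integral>w. L / (6 * sqrt l) * norm (?T *v w) ^ 3 \<partial>gauss)"
    using integrable_gauss_posdef_sqrt_norm_power3[OF V pos(2)] rem_le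
    by (intro abs_integral_le_integral rem_int integrable_mult_right)
  also have "\<dots> \<le> L / (6 * sqrt l) * (2 * (trace V * sqrt (trace V)))"
    using L_nonneg pos integral_gauss_posdef_sqrt_norm_power3_le[OF V pos(2)]
    by (simp only: integral_mult_right_zero, intro mult_left_mono) auto
  finally show ?thesis unfolding rem_eq H_def by simp
qed

text \<open>For the last step, where no further smoothing is present: the linear term averages out
  and E |V^(1/2) w|^2 = tr V.\<close>

lemma smooth_gauss_increment_first_order:
  fixes V :: "real^'d^'d"
  assumes V: "a *\<^sub>R mat 1 \<preceq> V" and pos: "0 < a"
  shows "\<bar>smooth (posdef_sqrt V) x - f x\<bar> \<le> L / 2 * trace V"
proof -
  let ?T = "posdef_sqrt V"
  note comp = integral_gauss_posdef_sqrt_components[OF V pos]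
  have int: "integrable gauss (\<lambda>w. f (x + ?T *v w) - f x - g x \<bullet> (?T *v w))"
    using comp integrable_gauss_f by simp
  have "smooth ?T x - f x = (\<integral>w. f (x + ?T *v w) - f x - g x \<bullet> (?T *v w) \<partial>gauss)"
    unfolding smooth_def using comp integrable_gauss_f by (simp add: gauss.prob_space[unfolded space_gauss])
  also have "\<bar>\<dots>\<bar> \<le> (\<integral>w. L / 2 * (norm (?T *v w))\<^sup>2 \<partial>gauss)"
    using integrable_gauss_posdef_sqrt_norm_power2[OF V pos] first_order
    by (intro abs_integral_le_integral int integrable_mult_right)
  also have "\<dots> = L / 2 * trace V"
    using integral_gauss_posdef_sqrt_norm_power2[OF V pos] by simp
  finally show ?thesis .
qed

end

section \<open>One step of the Lindeberg replacement\<close>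

text \<open>x is the partial sum before the step, F its past, X the next difference and V the
  conditional covariance of X. The order bounds on V hold at every point, so that roots of V are
  measurable; only the conditional moments are almost sure statements.\<close>

locale conditional_step = lipschitz_gradient f g L + prob_space M
  for f :: "real^'d \<Rightarrow> real" and g L and M :: "'a measure" +
  fixes F :: "'a measure" and x X :: "'a \<Rightarrow> real^'d" and V :: "'a \<Rightarrow> real^'d^'d" and a c :: real
  assumes subalg: "subalgebra M F"
    and x_F: "x \<in> borel_measurable F"
    and x_square: "integrable M (\<lambda>\<omega>. (norm (x \<omega>))\<^sup>2)"
    and V_F: "V \<in> borel_measurable F"
    and V_ge: "a *\<^sub>R mat 1 \<preceq> V \<omega>" and V_le: "V \<omega> \<preceq> c *\<^sub>R mat 1" and a_pos: "0 < a"
    and X_M [measurable]: "X \<in> borel_measurable M"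
    and X_cube: "integrable M (\<lambda>\<omega>. norm (X \<omega>) ^ 3)"
    and cond_mean: "AE \<omega> in M. real_cond_exp M F (\<lambda>\<omega>. X \<omega> $ i) \<omega> = 0"
    and cond_cov: "AE \<omega> in M. real_cond_exp M F (\<lambda>\<omega>. X \<omega> $ i * X \<omega> $ j) \<omega> = V \<omega> $ i $ j"
begin

sublocale finite_measure_subalgebra M F
  by unfold_locales (rule subalg)

lemma F_imp_M: "h \<in> borel_measurable F \<Longrightarrow> h \<in> borel_measurable M"
  by (rule measurable_from_subalg[OF subalg])

lemma x_M [measurable]: "x \<in> borel_measurable M" and V_M [measurable]: "V \<in> borel_measurable M"
  using x_F V_F by (auto intro: F_imp_M)

lemma X_square: "integrable M (\<lambda>\<omega>. (norm (X \<omega>))\<^sup>2)"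
proof (rule Bochner_Integration.integrable_bound)
  show "integrable M (\<lambda>\<omega>. 1 + norm (X \<omega>) ^ 3)" using X_cube by simp
  have "r\<^sup>2 \<le> 1 + r ^ 3" if "0 \<le> r" for r :: real
  proof (cases "r \<le> 1")
    case True
    then have "r\<^sup>2 \<le> 1" using that by (simp add: power_le_one)
    then show ?thesis using that by (smt (verit) zero_le_power)
  next
    case False
    then have "r\<^sup>2 \<le> r ^ 3" by (intro power_increasing) auto
    then show ?thesis by simp
  qed
  then show "AE \<omega> in M. norm ((norm (X \<omega>))\<^sup>2) \<le> norm (1 + norm (X \<omega>) ^ 3)"
    by (intro AE_I2) (auto intro: order_trans[OF _ abs_ge_self])
qed measurable

text \<open>Linear growth in |x| is allowed because gradients of the smoothed function grow like
  that; |x| |X| is integrable as both factors are square integrable.\<close>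

lemma F_weighted_X:
  assumes h: "h \<in> borel_measurable F" and bound: "\<And>\<omega>. \<bar>h \<omega>\<bar> \<le> K + K' * norm (x \<omega>)" and K: "0 \<le> K'"
  shows "integrable M (\<lambda>\<omega>. h \<omega> * X \<omega> $ i)" and "(\<integral>\<omega>. h \<omega> * X \<omega> $ i \<partial>M) = 0"
proof -
  have [measurable]: "h \<in> borel_measurable M" using h by (rule F_imp_M)
  show int: "integrable M (\<lambda>\<omega>. h \<omega> * X \<omega> $ i)"
  proof (rule Bochner_Integration.integrable_bound)
    let ?b = "\<lambda>\<omega>. \<bar>K\<bar> * (1 + (norm (X \<omega>))\<^sup>2) + K' * ((norm (x \<omega>))\<^sup>2 + (norm (X \<omega>))\<^sup>2)"
    show "integrable M ?b"
      using x_square X_square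
      by (intro Bochner_Integration.integrable_add integrable_mult_right) auto
    have "\<bar>h \<omega> * X \<omega> $ i\<bar> \<le> ?b \<omega>" for \<omega>
    proof -
      have sq: "r * s \<le> r\<^sup>2 + s\<^sup>2" for r s :: real
        using sum_squares_bound[of r s] zero_le_power2[of r] zero_le_power2[of s] by linarith
      have "\<bar>h \<omega> * X \<omega> $ i\<bar> \<le> (\<bar>K\<bar> + K' * norm (x \<omega>)) * norm (X \<omega>)"
        unfolding abs_mult using bound[of \<omega>] K component_le_norm_cart[of "X \<omega>" i]
        by (intro mult_mono) auto
      also have "\<dots> = \<bar>K\<bar> * (1 * norm (X \<omega>)) + K' * (norm (x \<omega>) * norm (X \<omega>))"
        by (simp add: algebra_simps)
      also have "\<dots> \<le> \<bar>K\<bar> * (1\<^sup>2 + (norm (X \<omega>))\<^sup>2) + K' * ((norm (x \<omega>))\<^sup>2 + (norm (X \<omega>))\<^sup>2)"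
        using K by (intro add_mono mult_left_mono sq) auto
      finally show ?thesis by simp
    qed
    then show "AE \<omega> in M. norm (h \<omega> * X \<omega> $ i) \<le> norm (?b \<omega>)"
      by (intro AE_I2) (auto intro: order_trans[OF _ abs_ge_self])
  qed measurable
  have "(\<integral>\<omega>. h \<omega> * X \<omega> $ i \<partial>M) = (\<integral>\<omega>. h \<omega> * real_cond_exp M F (\<lambda>\<omega>. X \<omega> $ i) \<omega> \<partial>M)"
    by (rule real_cond_exp_intg(2)[OF int h, symmetric]) measurable
  also have "\<dots> = (\<integral>\<omega>. 0 \<partial>M)"
  proof (rule integral_cong_AE)
    show "AE \<omega> in M. h \<omega> * real_cond_exp M F (\<lambda>\<omega>. X \<omega> $ i) \<omega> = 0"
      using cond_mean[of i] by eventually_elim simp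
  qed measurable
  finally show "(\<integral>\<omega>. h \<omega> * X \<omega> $ i \<partial>M) = 0" by simp
qed

text \<open>Here the weights are bounded, as the Hessian entries are, and |X|^2 dominates. Pulling h
  out of the conditional expectation inserts V.\<close>

lemma F_weighted_XX:
  assumes h: "h \<in> borel_measurable F" and bound: "\<And>\<omega>. \<bar>h \<omega>\<bar> \<le> K"
  shows "integrable M (\<lambda>\<omega>. h \<omega> * (X \<omega> $ i * X \<omega> $ j))" and "integrable M (\<lambda>\<omega>. h \<omega> * V \<omega> $ i $ j)"
    and "(\<integral>\<omega>. h \<omega> * (X \<omega> $ i * X \<omega> $ j) \<partial>M) = (\<integral>\<omega>. h \<omega> * V \<omega> $ i $ j \<partial>M)"
proof -
  have [measurable]: "h \<in> borel_measurable M" using h by (rule F_imp_M)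
  show int: "integrable M (\<lambda>\<omega>. h \<omega> * (X \<omega> $ i * X \<omega> $ j))"
  proof (rule Bochner_Integration.integrable_bound)
    show "integrable M (\<lambda>\<omega>. K * (norm (X \<omega>))\<^sup>2)" using X_square by simp
    have "\<bar>h \<omega> * (X \<omega> $ i * X \<omega> $ j)\<bar> \<le> K * (norm (X \<omega>) * norm (X \<omega>))" for \<omega>
      unfolding abs_mult using bound[of \<omega>] component_le_norm_cart
      by (intro mult_mono) (auto intro: order_trans[OF abs_ge_zero])
    then show "AE \<omega> in M. norm (h \<omega> * (X \<omega> $ i * X \<omega> $ j)) \<le> norm (K * (norm (X \<omega>))\<^sup>2)"
      by (intro AE_I2) (auto simp: power2_eq_square intro: order_trans[OF _ abs_ge_self])
  qed measurable
  have V_comp: "(\<lambda>\<omega>. V \<omega> $ i $ j) \<in> borel_measurable M" by measurable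
  have ae: "AE \<omega> in M. h \<omega> * real_cond_exp M F (\<lambda>\<omega>. X \<omega> $ i * X \<omega> $ j) \<omega> = h \<omega> * V \<omega> $ i $ j"
    using cond_cov[of i j] by eventually_elim simp
  have meas: "(\<lambda>\<omega>. X \<omega> $ i * X \<omega> $ j) \<in> borel_measurable M" by measurable
  note cond = real_cond_exp_intg[OF int h meas]
  show "integrable M (\<lambda>\<omega>. h \<omega> * V \<omega> $ i $ j)"
    using cond(1) integrable_cong_AE[OF _ _ ae] V_comp by simp
  have "(\<integral>\<omega>. h \<omega> * real_cond_exp M F (\<lambda>\<omega>. X \<omega> $ i * X \<omega> $ j) \<omega> \<partial>M) = (\<integral>\<omega>. h \<omega> * V \<omega> $ i $ j \<partial>M)"
    using V_comp by (intro integral_cong_AE[OF _ _ ae]) measurable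
  then show "(\<integral>\<omega>. h \<omega> * (X \<omega> $ i * X \<omega> $ j) \<partial>M) = (\<integral>\<omega>. h \<omega> * V \<omega> $ i $ j \<partial>M)"
    using cond(2) by simp
qed

lemma norm_X_power2: "(norm (X \<omega>))\<^sup>2 = (\<Sum>i\<in>UNIV. X \<omega> $ i * X \<omega> $ i)"
  unfolding power2_norm_eq_inner by (simp add: inner_vec_def)

lemma F_weighted_norm_square:
  assumes h: "h \<in> borel_measurable F" and bound: "\<And>\<omega>. \<bar>h \<omega>\<bar> \<le> K"
  shows "integrable M (\<lambda>\<omega>. h \<omega> * (norm (X \<omega>))\<^sup>2)" and "integrable M (\<lambda>\<omega>. h \<omega> * trace (V \<omega>))"
    and "(\<integral>\<omega>. h \<omega> * (norm (X \<omega>))\<^sup>2 \<partial>M) = (\<integral>\<omega>. h \<omega> * trace (V \<omega>) \<partial>M)"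
  unfolding norm_X_power2 trace_def sum_distrib_left using F_weighted_XX[OF assms] by simp_all

lemma trace_V_pos: "0 < trace (V \<omega>)" and trace_V_ge: "a * real CARD('d) \<le> trace (V \<omega>)"
  and trace_V_le: "trace (V \<omega>) \<le> c * real CARD('d)"
proof -
  have "0 < a * real CARD('d)" using a_pos by simp
  then show "0 < trace (V \<omega>)" using trace_ge_loewner[OF V_ge, of \<omega>] by simp
qed (rule trace_ge_loewner[OF V_ge] trace_le_loewner[OF V_le])+

lemma trace_V_F: "(\<lambda>\<omega>. trace (V \<omega>)) \<in> borel_measurable F"
  unfolding trace_def using V_F by measurable

lemma sqrt_trace_V_F: "(\<lambda>\<omega>. sqrt (trace (V \<omega>))) \<in> borel_measurable F"
  using trace_V_F by measurable

lemma sqrt_trace_V_le: "\<bar>sqrt (trace (V \<omega>))\<bar> \<le> sqrt (c * real CARD('d))"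
  using trace_V_le[of \<omega>] trace_V_pos[of \<omega>] by simp

text \<open>Conditional Jensen for \<open>r \<mapsto> r\<^sup>3\<^sup>/\<^sup>2\<close>, via the tangent at the conditional mean.\<close>

lemma trace_V_power_le_cube:
  shows "integrable M (\<lambda>\<omega>. trace (V \<omega>) * sqrt (trace (V \<omega>)))"
    and "(\<integral>\<omega>. trace (V \<omega>) * sqrt (trace (V \<omega>)) \<partial>M) \<le> (\<integral>\<omega>. norm (X \<omega>) ^ 3 \<partial>M)"
proof -
  let ?s = "\<lambda>\<omega>. sqrt (trace (V \<omega>))"
  note w = F_weighted_norm_square[OF sqrt_trace_V_F sqrt_trace_V_le]
  show int: "integrable M (\<lambda>\<omega>. trace (V \<omega>) * ?s \<omega>)" using w(2) by (simp add: mult.commute)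
  have tangent: "trace (V \<omega>) * ?s \<omega> + 3 / 2 * (?s \<omega> * (norm (X \<omega>))\<^sup>2 - ?s \<omega> * trace (V \<omega>)) \<le> norm (X \<omega>) ^ 3" for \<omega>
  proof -
    have tr: "trace (V \<omega>) = (?s \<omega>)\<^sup>2" using trace_V_pos[of \<omega>] by simp
    define s b where "s = ?s \<omega>" and "b = norm (X \<omega>)"
    have s: "0 \<le> s" "0 \<le> b" using trace_V_pos[of \<omega>] by (auto simp: s_def b_def less_imp_le)
    \<comment> \<open>The product equals 2 b^3 - 3 s b^2 + s^3, twice the gap in the tangent
      inequality.\<close>
    have "0 \<le> (b - s)\<^sup>2 * (2 * b + s)" using s by simp
    then have "s\<^sup>2 * s + 3 / 2 * (s * b\<^sup>2 - s * s\<^sup>2) \<le> b ^ 3"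
      by (simp add: power2_eq_square power3_eq_cube algebra_simps)
    then show ?thesis unfolding s_def b_def tr[symmetric] .
  qed
  have "(\<integral>\<omega>. trace (V \<omega>) * ?s \<omega> \<partial>M) =
      (\<integral>\<omega>. trace (V \<omega>) * ?s \<omega> + 3 / 2 * (?s \<omega> * (norm (X \<omega>))\<^sup>2 - ?s \<omega> * trace (V \<omega>)) \<partial>M)"
    using w int by simp
  also have "\<dots> \<le> (\<integral>\<omega>. norm (X \<omega>) ^ 3 \<partial>M)"
    using w int X_cube tangent by (intro integral_mono) auto
  finally show "(\<integral>\<omega>. trace (V \<omega>) * ?s \<omega> \<partial>M) \<le> (\<integral>\<omega>. norm (X \<omega>) ^ 3 \<partial>M)" .
qed

lemma xX_square: "integrable M (\<lambda>\<omega>. (norm (x \<omega> + X \<omega>))\<^sup>2)"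
proof (rule Bochner_Integration.integrable_bound)
  show "integrable M (\<lambda>\<omega>. 2 * (norm (x \<omega>))\<^sup>2 + 2 * (norm (X \<omega>))\<^sup>2)"
    using x_square X_square by simp
  show "AE \<omega> in M. norm ((norm (x \<omega> + X \<omega>))\<^sup>2) \<le> norm (2 * (norm (x \<omega>))\<^sup>2 + 2 * (norm (X \<omega>))\<^sup>2)"
    using norm_add_power2_le by (intro AE_I2) auto
qed measurable

lemma integrable_smooth_comp:
  assumes [measurable]: "R \<in> borel_measurable M" "y \<in> borel_measurable M"
    and R: "\<And>\<omega>. norm (R \<omega>) \<le> \<rho>" and y: "integrable M (\<lambda>\<omega>. (norm (y \<omega>))\<^sup>2)"
  shows "integrable M (\<lambda>\<omega>. smooth (R \<omega>) (y \<omega>))"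
proof (rule Bochner_Integration.integrable_bound)
  let ?C = "\<bar>f 0\<bar> + norm (g 0) + L" and ?E = "\<integral>z. (norm z)\<^sup>2 \<partial>(gauss :: (real^'d) measure)"
  let ?b = "\<lambda>\<omega>. ?C * (1 + (2 * (norm (y \<omega>))\<^sup>2 + 2 * \<rho>\<^sup>2 * ?E))"
  show "integrable M ?b"
    using y by (intro integrable_mult_right Bochner_Integration.integrable_add) auto
  have "\<bar>smooth (R \<omega>) (y \<omega>)\<bar> \<le> ?b \<omega>" for \<omega>
    using L_nonneg power_mono[OF R norm_ge_zero, of \<omega> 2]
    by (intro order_trans[OF abs_smooth_le] mult_left_mono add_left_mono mult_right_mono) auto
  then show "AE \<omega> in M. norm (smooth (R \<omega>) (y \<omega>)) \<le> norm (?b \<omega>)"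
    by (intro AE_I2) (auto intro: order_trans[OF _ abs_ge_self])
qed measurable

lemma smooth_grad_X:
  assumes R: "R \<in> borel_measurable F" and bound: "\<And>\<omega>. norm (R \<omega>) \<le> \<rho>"
  shows "integrable M (\<lambda>\<omega>. smooth_grad (R \<omega>) (x \<omega>) \<bullet> X \<omega>)"
    and "(\<integral>\<omega>. smooth_grad (R \<omega>) (x \<omega>) \<bullet> X \<omega> \<partial>M) = 0"
proof -
  let ?E = "\<integral>z. norm z \<partial>(gauss :: (real^'d) measure)"
  have E: "0 \<le> ?E" by simp
  have meas: "(\<lambda>\<omega>. smooth_grad (R \<omega>) (x \<omega>) $ i) \<in> borel_measurable F" for i
    using R x_F by measurable
  have "\<bar>smooth_grad (R \<omega>) (x \<omega>) $ i\<bar> \<le> (norm (g 0) + L * \<rho> * ?E) + L * norm (x \<omega>)" for \<omega> i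
  proof -
    have "L * norm (R \<omega>) * ?E \<le> L * \<rho> * ?E"
      using L_nonneg E bound[of \<omega>] by (intro mult_right_mono mult_left_mono) auto
    then show ?thesis
      using component_le_norm_cart[of "smooth_grad (R \<omega>) (x \<omega>)" i] norm_smooth_grad_le[of "R \<omega>" "x \<omega>"]
      by linarith
  qed
  note w = F_weighted_X[OF meas this L_nonneg]
  show "integrable M (\<lambda>\<omega>. smooth_grad (R \<omega>) (x \<omega>) \<bullet> X \<omega>)"
    "(\<integral>\<omega>. smooth_grad (R \<omega>) (x \<omega>) \<bullet> X \<omega> \<partial>M) = 0"
    unfolding inner_vec_def using w by simp_all
qed

text \<open>Both expectations are expanded around \<open>smooth (R \<omega>) (x \<omega>)\<close>:
  \<open>D1\<close> is the remainder for X, \<open>D2\<close> the one for the Gaussian replacement.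
  The constants 1/6 and 1/3 add up to 1/2 once (tr V)^(3/2) is replaced by |X|^3 in the
  mean.\<close>

lemma expectation_smooth_increment:
  assumes Q_F: "Q \<in> borel_measurable F" and Q_ge: "\<And>\<omega>. l *\<^sub>R mat 1 \<preceq> Q \<omega>" and Q_le: "\<And>\<omega>. Q \<omega> \<preceq> b *\<^sub>R mat 1"
    and l: "0 < l"
  shows "\<bar>(\<integral>\<omega>. smooth (posdef_sqrt (Q \<omega>)) (x \<omega> + X \<omega>) \<partial>M) - (\<integral>\<omega>. smooth (posdef_sqrt (Q \<omega> + V \<omega>)) (x \<omega>) \<partial>M)\<bar>
    \<le> L / (2 * sqrt l) * (\<integral>\<omega>. norm (X \<omega>) ^ 3 \<partial>M)"
proof -
  define R where "R \<omega> = posdef_sqrt (Q \<omega>)" for \<omega>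
  define W where "W \<omega> = matrix_inv (R \<omega>)" for \<omega>
  have R_F: "R \<in> borel_measurable F"
    unfolding R_def by (rule borel_measurable_posdef_sqrt[OF Q_F Q_ge l])
  have W_F: "(\<lambda>\<omega>. W \<omega> $ i $ j) \<in> borel_measurable F" for i j
    unfolding W_def R_def by (rule borel_measurable_posdef_sqrt[OF Q_F Q_ge l])
  define \<rho> where "\<rho> = sqrt (b * real CARD('d))"
  have R_le: "norm (R \<omega>) \<le> \<rho>" for \<omega>
    unfolding R_def \<rho>_def by (rule norm_posdef_sqrt_le[OF Q_ge l Q_le])
  have W_le: "norm (W \<omega> *v u) \<le> (1 / sqrt l) * norm u" for \<omega> u
    unfolding W_def R_def using norm_matrix_inv_posdef_sqrt_mult_vec_le[OF Q_ge l] by simp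
  define U where "U \<omega> = posdef_sqrt (Q \<omega> + V \<omega>)" for \<omega>
  have QV_ge: "(l + a) *\<^sub>R mat 1 \<preceq> Q \<omega> + V \<omega>" for \<omega>
    by (rule loewner_ge_add[OF Q_ge V_ge])
  have QV_le: "Q \<omega> + V \<omega> \<preceq> (b + c) *\<^sub>R mat 1" for \<omega>
    by (rule loewner_le_add[OF Q_le V_le])
  have la: "0 < l + a" using l a_pos by simp
  have U_F: "U \<in> borel_measurable F"
    unfolding U_def using Q_F V_F by (intro borel_measurable_posdef_sqrt[OF _ QV_ge la]) measurable
  have U_le: "norm (U \<omega>) \<le> sqrt ((b + c) * real CARD('d))" for \<omega>
    unfolding U_def by (rule norm_posdef_sqrt_le[OF QV_ge la QV_le])
  have [measurable]: "R \<in> borel_measurable M" "U \<in> borel_measurable M"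
    using R_F U_F by (auto intro: F_imp_M)
  define H where "H \<omega> i j = smooth_hess (R \<omega>) (W \<omega>) (x \<omega>) i j" for \<omega> i j
  have H_F: "(\<lambda>\<omega>. H \<omega> i j) \<in> borel_measurable F" for i j
  proof -
    \<comment> \<open>Written out in entries of W, since measurability of the inverse root is
      available entrywise.\<close>
    have "W \<omega> *v axis j 1 = (\<chi> k. W \<omega> $ k $ j)" for \<omega>
      by (simp add: matrix_vector_mult_basis column_def)
    then have "H \<omega> i j = (\<integral>z. g (x \<omega> + R \<omega> *v z) $ i * (\<Sum>k\<in>UNIV. z $ k * W \<omega> $ k $ j) \<partial>gauss)" for \<omega>
      unfolding H_def smooth_hess_def
      by (simp add: inner_axis) (simp add: inner_vec_def[of _ "\<chi> k. W \<omega> $ k $ j"])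
    then show ?thesis using R_F x_F W_F by simp
  qed
  define KH where "KH = L * \<rho> * (1 / sqrt l) * (\<integral>z. (norm z)\<^sup>2 \<partial>(gauss :: (real^'d) measure))"
  have H_le: "\<bar>H \<omega> i j\<bar> \<le> KH" for \<omega> i j
  proof -
    have "\<bar>H \<omega> i j\<bar> \<le> L * norm (R \<omega>) * (1 / sqrt l) * (\<integral>z. (norm z)\<^sup>2 \<partial>(gauss :: (real^'d) measure))"
      unfolding H_def by (rule abs_smooth_hess_le[OF W_le])
    also have "\<dots> \<le> KH"
      unfolding KH_def using L_nonneg l R_le by (intro mult_right_mono mult_left_mono) auto
    finally show ?thesis .
  qed
  note H_w = F_weighted_XX[OF H_F H_le]
  note G_w = smooth_grad_X[OF R_F R_le]
  define D1 where "D1 \<omega> = smooth (R \<omega>) (x \<omega> + X \<omega>) - smooth (R \<omega>) (x \<omega>) - smooth_grad (R \<omega>) (x \<omega>) \<bullet> X \<omega> -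
      (\<Sum>i\<in>UNIV. \<Sum>j\<in>UNIV. H \<omega> i j * (X \<omega> $ i * X \<omega> $ j)) / 2" for \<omega>
  define D2 where "D2 \<omega> = smooth (U \<omega>) (x \<omega>) - smooth (R \<omega>) (x \<omega>) -
      (\<Sum>i\<in>UNIV. \<Sum>j\<in>UNIV. H \<omega> i j * V \<omega> $ i $ j) / 2" for \<omega>
  have int: "integrable M (\<lambda>\<omega>. smooth (R \<omega>) (x \<omega> + X \<omega>))" "integrable M (\<lambda>\<omega>. smooth (R \<omega>) (x \<omega>))"
      "integrable M (\<lambda>\<omega>. smooth (U \<omega>) (x \<omega>))"
    by (rule integrable_smooth_comp[OF _ _ R_le xX_square] integrable_smooth_comp[OF _ _ R_le x_square]
        integrable_smooth_comp[OF _ _ U_le x_square]; measurable)+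
  have D1_int: "integrable M D1" and D2_int: "integrable M D2"
    unfolding D1_def D2_def using int H_w G_w by simp_all
  have D1_le: "\<bar>D1 \<omega>\<bar> \<le> L / (6 * sqrt l) * norm (X \<omega>) ^ 3" for \<omega>
  proof -
    have "R \<omega> *v (W \<omega> *v X \<omega>) = (R \<omega> ** W \<omega>) *v X \<omega>" by (rule matrix_vector_mul_assoc)
    then have "R \<omega> *v (W \<omega> *v X \<omega>) = X \<omega>"
      using matrix_inv_mult(1)[OF posdef_sqrt_props(4)[OF Q_ge[of \<omega>] l]] by (simp add: W_def R_def)
    from smooth_second_order[OF this, of "x \<omega>"]
    have "\<bar>D1 \<omega>\<bar> \<le> L * (norm (X \<omega>))\<^sup>2 * norm (W \<omega> *v X \<omega>) / 6"
      unfolding D1_def H_def smooth_hess_quadratic .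
    also have "\<dots> \<le> L * (norm (X \<omega>))\<^sup>2 * ((1 / sqrt l) * norm (X \<omega>)) / 6"
      using L_nonneg W_le by (intro divide_right_mono mult_left_mono) auto
    finally show ?thesis by (simp add: power2_eq_square power3_eq_cube mult_ac)
  qed
  have D2_le: "\<bar>D2 \<omega>\<bar> \<le> L / (3 * sqrt l) * (trace (V \<omega>) * sqrt (trace (V \<omega>)))" for \<omega>
    unfolding D2_def H_def W_def R_def U_def by (rule smooth_gauss_increment[OF Q_ge V_ge l a_pos])
  \<comment> \<open>The terms of order zero cancel, the gradient term has mean 0, and the two
    Hessian terms have equal means because H is F-measurable and V is the conditional
    covariance.\<close>
  have "(\<integral>\<omega>. smooth (R \<omega>) (x \<omega> + X \<omega>) \<partial>M) - (\<integral>\<omega>. smooth (U \<omega>) (x \<omega>) \<partial>M) = (\<integral>\<omega>. D1 \<omega> \<partial>M) - (\<integral>\<omega>. D2 \<omega> \<partial>M)"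
    unfolding D1_def D2_def using int H_w G_w by simp
  also have "\<bar>\<dots>\<bar> \<le> \<bar>\<integral>\<omega>. D1 \<omega> \<partial>M\<bar> + \<bar>\<integral>\<omega>. D2 \<omega> \<partial>M\<bar>" by (rule abs_triangle_ineq4)
  also have "\<dots> \<le> (\<integral>\<omega>. L / (6 * sqrt l) * norm (X \<omega>) ^ 3 \<partial>M) +
      (\<integral>\<omega>. L / (3 * sqrt l) * (trace (V \<omega>) * sqrt (trace (V \<omega>))) \<partial>M)"
    by (intro add_mono abs_integral_le_integral D1_int D2_int D1_le D2_le integrable_mult_right
        X_cube trace_V_power_le_cube(1))
  also have "\<dots> \<le> L / (6 * sqrt l) * (\<integral>\<omega>. norm (X \<omega>) ^ 3 \<partial>M) + L / (3 * sqrt l) * (\<integral>\<omega>. norm (X \<omega>) ^ 3 \<partial>M)"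
    using L_nonneg l trace_V_power_le_cube(2)
    by (simp only: integral_mult_right_zero, intro add_left_mono mult_left_mono) auto
  also have "\<dots> = L / (2 * sqrt l) * (\<integral>\<omega>. norm (X \<omega>) ^ 3 \<partial>M)"
    using l by (simp add: field_simps)
  finally show ?thesis unfolding R_def U_def .
qed

text \<open>Without smoothing, the first-order expansion of f is all there is; X and its Gaussian
  replacement each cost L / 2 times E tr V.\<close>

lemma expectation_smooth_last_increment:
  "\<bar>(\<integral>\<omega>. f (x \<omega> + X \<omega>) \<partial>M) - (\<integral>\<omega>. smooth (posdef_sqrt (V \<omega>)) (x \<omega>) \<partial>M)\<bar>
    \<le> L / sqrt a * (\<integral>\<omega>. norm (X \<omega>) ^ 3 \<partial>M)"
proof -
  \<comment> \<open>With R = 0 the smoothed function is f itself, so the integrability and mean-zero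
    lemmas for \<open>smooth\<close> apply to f and g.\<close>
  have smooth_0: "smooth 0 y = f y" "smooth_grad 0 y = g y" for y
    by (simp_all add: smooth_def smooth_grad_def gauss.prob_space[unfolded space_gauss])
  define T where "T \<omega> = posdef_sqrt (V \<omega>)" for \<omega>
  have [measurable]: "T \<in> borel_measurable M"
    unfolding T_def by (rule F_imp_M[OF borel_measurable_posdef_sqrt(1)[OF V_F V_ge a_pos]])
  have T_le: "norm (T \<omega>) \<le> sqrt (c * real CARD('d))" for \<omega>
    unfolding T_def by (rule norm_posdef_sqrt_le[OF V_ge a_pos V_le])
  have G_w: "integrable M (\<lambda>\<omega>. g (x \<omega>) \<bullet> X \<omega>)" "(\<integral>\<omega>. g (x \<omega>) \<bullet> X \<omega> \<partial>M) = 0"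
    using smooth_grad_X[of "\<lambda>_. 0" 0] by (simp_all add: smooth_0)
  have int: "integrable M (\<lambda>\<omega>. f (x \<omega> + X \<omega>))" "integrable M (\<lambda>\<omega>. f (x \<omega>))"
      "integrable M (\<lambda>\<omega>. smooth (T \<omega>) (x \<omega>))"
    using integrable_smooth_comp[of "\<lambda>_. 0" _ 0, OF _ _ _ xX_square] integrable_smooth_comp[of "\<lambda>_. 0" _ 0, OF _ _ _ x_square]
      integrable_smooth_comp[OF _ _ T_le x_square] by (simp_all add: smooth_0)
  have w: "integrable M (\<lambda>\<omega>. trace (V \<omega>))" "(\<integral>\<omega>. (norm (X \<omega>))\<^sup>2 \<partial>M) = (\<integral>\<omega>. trace (V \<omega>) \<partial>M)"
    using F_weighted_norm_square[of "\<lambda>_. 1" 1] by simp_all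
  have "(\<integral>\<omega>. f (x \<omega> + X \<omega>) \<partial>M) - (\<integral>\<omega>. smooth (T \<omega>) (x \<omega>) \<partial>M) =
      (\<integral>\<omega>. f (x \<omega> + X \<omega>) - f (x \<omega>) - g (x \<omega>) \<bullet> X \<omega> \<partial>M) - (\<integral>\<omega>. smooth (T \<omega>) (x \<omega>) - f (x \<omega>) \<partial>M)"
    using int G_w by simp
  also have "\<bar>\<dots>\<bar> \<le> \<bar>\<integral>\<omega>. f (x \<omega> + X \<omega>) - f (x \<omega>) - g (x \<omega>) \<bullet> X \<omega> \<partial>M\<bar> + \<bar>\<integral>\<omega>. smooth (T \<omega>) (x \<omega>) - f (x \<omega>) \<partial>M\<bar>"
    by (rule abs_triangle_ineq4)
  also have "\<dots> \<le> (\<integral>\<omega>. L / 2 * (norm (X \<omega>))\<^sup>2 \<partial>M) + (\<integral>\<omega>. L / 2 * trace (V \<omega>) \<partial>M)"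
  proof (rule add_mono)
    show "\<bar>\<integral>\<omega>. f (x \<omega> + X \<omega>) - f (x \<omega>) - g (x \<omega>) \<bullet> X \<omega> \<partial>M\<bar> \<le> (\<integral>\<omega>. L / 2 * (norm (X \<omega>))\<^sup>2 \<partial>M)"
      by (intro abs_integral_le_integral integrable_mult_right Bochner_Integration.integrable_diff
          int G_w X_square first_order)
    show "\<bar>\<integral>\<omega>. smooth (T \<omega>) (x \<omega>) - f (x \<omega>) \<partial>M\<bar> \<le> (\<integral>\<omega>. L / 2 * trace (V \<omega>) \<partial>M)"
      unfolding T_def
      by (intro abs_integral_le_integral integrable_mult_right Bochner_Integration.integrable_diff
          int[unfolded T_def] w smooth_gauss_increment_first_order[OF V_ge a_pos])
  qed
  also have "\<dots> = L * (\<integral>\<omega>. trace (V \<omega>) \<partial>M)" using w by simp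
  \<comment> \<open>Since tr V >= a d >= a, a factor sqrt(tr V / a) may be inserted; the last step
    then has the same cubic form as the others.\<close>
  also have "\<dots> \<le> L * (\<integral>\<omega>. (1 / sqrt a) * (trace (V \<omega>) * sqrt (trace (V \<omega>))) \<partial>M)"
  proof (intro mult_left_mono integral_mono w L_nonneg integrable_mult_right trace_V_power_le_cube)
    fix \<omega>
    have "1 \<le> real CARD('d)" by (simp add: Suc_leI)
    then have "a * 1 \<le> a * real CARD('d)" using a_pos by (intro mult_left_mono) auto
    then have "a \<le> trace (V \<omega>)" using trace_V_ge[of \<omega>] by simp
    then have "trace (V \<omega>) * sqrt a \<le> trace (V \<omega>) * sqrt (trace (V \<omega>))"
      using trace_V_pos[of \<omega>] by (intro mult_left_mono) auto
    then show "trace (V \<omega>) \<le> (1 / sqrt a) * (trace (V \<omega>) * sqrt (trace (V \<omega>)))"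
      using a_pos by (simp add: field_simps)
  qed
  also have "\<dots> \<le> L * ((1 / sqrt a) * (\<integral>\<omega>. norm (X \<omega>) ^ 3 \<partial>M))"
    using L_nonneg a_pos trace_V_power_le_cube(2) by (simp only: integral_mult_right_zero, intro mult_left_mono) auto
  finally show ?thesis by (simp add: T_def)
qed

end

section \<open>The martingale central limit bound\<close>

text \<open>With s^2 = r^2 + 1, the inequality 2 r s <= r^2 + s^2 yields 1 / s <= 2 (s - r), which
  telescopes.\<close>

lemma sum_inverse_sqrt_le: "(\<Sum>j=1..m. 1 / sqrt (real j)) \<le> 2 * sqrt (real m)"
proof (induction m)
  case (Suc m)
  let ?r = "sqrt (real m)" and ?s = "sqrt (real (Suc m))"
  have s: "0 < ?s" by simp
  have "?s * ?s = ?r * ?r + 1" by (simp del: real_sqrt_mult_self add: real_sqrt_mult_self)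
  moreover have "0 \<le> (?s - ?r)\<^sup>2" by simp
  ultimately have "2 * ?r * ?s + 1 \<le> 2 * ?s * ?s"
    by (simp add: power2_eq_square algebra_simps)
  then have "2 * ?r + 1 / ?s \<le> 2 * ?s"
    using s by (simp add: field_simps)
  then show ?case using Suc.IH by simp
qed simp

text \<open>Matrices outside the order interval are sent to the constant l I, not to a nearest
  point. This turns almost sure bounds into bounds at every point, and as a Borel function it
  preserves measurability with respect to any F k.\<close>

definition loewner_clip :: "real \<Rightarrow> real \<Rightarrow> real^'d^'d \<Rightarrow> real^'d^'d" where
  "loewner_clip l u A = (if l *\<^sub>R mat 1 \<preceq> A \<and> A \<preceq> u *\<^sub>R mat 1 then A else l *\<^sub>R mat 1)"

lemma loewner_clip_bounds:
  assumes "l \<le> u"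
  shows "l *\<^sub>R mat 1 \<preceq> loewner_clip l u A" "loewner_clip l u A \<preceq> u *\<^sub>R mat 1"
  using assms unfolding loewner_clip_def
  by (auto simp: scaleR_mat_1_loewner_le_iff loewner_le_scaleR_mat_1_iff transpose_scaleR_matrix
      scaleR_mat_1_mult_vec power2_norm_eq_inner mult_right_mono)

lemma borel_measurable_loewner_clip [measurable]: "loewner_clip l u \<in> borel_measurable borel"
proof -
  have [measurable]: "{A :: real^'d^'d. l *\<^sub>R mat 1 \<preceq> A} \<inter> {A. A \<preceq> u *\<^sub>R mat 1} \<in> sets borel"
    by (intro borel_closed closed_Int closed_loewner_ge closed_loewner_le)
  have "(\<lambda>A. if A \<in> {A :: real^'d^'d. l *\<^sub>R mat 1 \<preceq> A} \<inter> {A. A \<preceq> u *\<^sub>R mat 1} then A else l *\<^sub>R mat 1)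
      \<in> borel_measurable borel"
    by measurable
  then show ?thesis by (simp add: loewner_clip_def[abs_def])
qed

lemma sum_loewner_bounds:
  fixes V :: "nat \<Rightarrow> real^'d^'d"
  assumes "finite I" "\<And>i. i \<in> I \<Longrightarrow> l *\<^sub>R mat 1 \<preceq> V i" "\<And>i. i \<in> I \<Longrightarrow> V i \<preceq> u *\<^sub>R mat 1"
  shows "(real (card I) * l) *\<^sub>R mat 1 \<preceq> (\<Sum>i\<in>I. V i)" "(\<Sum>i\<in>I. V i) \<preceq> (real (card I) * u) *\<^sub>R mat 1"
proof -
  have 1: "(\<Sum>i\<in>I. V i - l *\<^sub>R mat 1) = (\<Sum>i\<in>I. V i) - (real (card I) * l) *\<^sub>R mat 1"
    by (simp add: sum_subtractf sum_constant_scaleR del: sum_constant)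
  have 2: "(\<Sum>i\<in>I. u *\<^sub>R mat 1 - V i) = (real (card I) * u) *\<^sub>R mat 1 - (\<Sum>i\<in>I. V i)"
    by (simp add: sum_subtractf sum_constant_scaleR del: sum_constant)
  have "possemidef (\<Sum>i\<in>I. W i)" if "\<And>i. i \<in> I \<Longrightarrow> possemidef (W i)" for W :: "nat \<Rightarrow> real^'d^'d"
    using assms(1) that
  proof (induction I rule: finite_induct)
    case empty
    show ?case by (simp add: possemidef_def transpose_def vec_eq_iff)
  next
    case (insert i I)
    then show ?case
      by (auto simp: possemidef_def transpose_add_matrix matrix_vector_mult_add_rdistrib inner_add_right)
  qed
  from this[of "\<lambda>i. V i - l *\<^sub>R mat 1"] this[of "\<lambda>i. u *\<^sub>R mat 1 - V i"]
  show "(real (card I) * l) *\<^sub>R mat 1 \<preceq> (\<Sum>i\<in>I. V i)" "(\<Sum>i\<in>I. V i) \<preceq> (real (card I) * u) *\<^sub>R mat 1"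
    using assms(2,3) unfolding loewner_le_def 1 2 by auto
qed

lemma borel_measurable_mat_cond_exp:
  fixes Y :: "'a \<Rightarrow> real^'d^'d"
  shows "mat_cond_exp M F Y \<in> borel_measurable F"
proof (subst borel_measurable_euclidean_space, rule ballI)
  fix b :: "real^'d^'d" assume "b \<in> Basis"
  then obtain i j where "b = axis i (axis j 1)" by (auto simp: Basis_vec_def)
  then show "(\<lambda>\<omega>. mat_cond_exp M F Y \<omega> \<bullet> b) \<in> borel_measurable F"
    by (simp add: inner_axis mat_cond_exp_def)
qed

lemma (in lipschitz_gradient) martingale_smooth_bound:
  fixes M :: "'a measure" and V :: "nat \<Rightarrow> 'a \<Rightarrow> real^'d^'d" and \<Sigma> :: "real^'d^'d"
  assumes M: "prob_space M" and n: "n \<ge> 1"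
    and filt: "finite_filtration M n F" and mart: "martingale_difference M n F X"
    and V: "\<And>k. k \<in> {1..n} \<Longrightarrow>
           AE \<omega> in M. V k \<omega> = mat_cond_exp M (F (k - 1)) (\<lambda>\<omega>. outer (X k \<omega>) (X k \<omega>)) \<omega>"
    and \<Sigma>: "AE \<omega> in M. (\<Sum>i=1..n. V i \<omega>) = \<Sigma>"
    and pos: "0 < \<alpha>" "\<alpha> \<le> \<beta>"
    and bounds: "\<And>k. k \<in> {1..n} \<Longrightarrow> AE \<omega> in M. \<alpha> *\<^sub>R mat 1 \<preceq> V k \<omega> \<and> V k \<omega> \<preceq> \<beta> *\<^sub>R mat 1"
    and cube: "\<And>k. k \<in> {1..n} \<Longrightarrow> integrable M (\<lambda>\<omega>. norm (X k \<omega>) ^ 3)"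
      "\<And>k. k \<in> {1..n} \<Longrightarrow> (\<integral>\<omega>. norm (X k \<omega>) ^ 3 \<partial>M) \<le> G"
  shows "\<bar>(\<integral>\<omega>. f (\<Sum>i=1..n. X i \<omega>) \<partial>M) - smooth (posdef_sqrt \<Sigma>) 0\<bar> \<le> 2 * L * G * sqrt (real n) / sqrt \<alpha>"
proof -
  interpret prob_space M by (rule M)
  \<comment> \<open>V k is only almost surely equal to the conditional covariance; this version is
    measurable with respect to F (k - 1).\<close>
  define V' where "V' k = mat_cond_exp M (F (k - 1)) (\<lambda>\<omega>. outer (X k \<omega>) (X k \<omega>))" for k
  define S where "S k \<omega> = (\<Sum>i=1..k. X i \<omega>)" for k \<omega>
  \<comment> \<open>Almost surely the sum of V i over i > k, but expressed through the past.\<close>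
  define P where "P k \<omega> = \<Sigma> - (\<Sum>i=1..k. V' i \<omega>)" for k \<omega>
  define Vc where "Vc k \<omega> = loewner_clip \<alpha> \<beta> (V' k \<omega>)" for k \<omega>
  \<comment> \<open>There are n - k summands left, each between \<alpha> I and \<beta> I. At k = n
    the lower bound degenerates to 0, which forces the separate last step.\<close>
  define l where "l k = real (n - k) * \<alpha>" for k
  define u where "u k = real (n - k) * \<beta>" for k
  define Q where "Q k \<omega> = loewner_clip (l k) (u k) (P k \<omega>)" for k \<omega>
  have lu: "l k \<le> u k" for k unfolding l_def u_def using pos by (intro mult_left_mono) auto
  have G: "0 \<le> G"
    using cube(2)[of 1] n by (intro order_trans[OF integral_nonneg_AE cube(2)[of 1]]) auto
  have sub: "subalgebra M (F k)" if "k \<le> n" for k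
    using filt that by (simp add: finite_filtration_def)
  have mono: "h \<in> borel_measurable (F k)" if "h \<in> borel_measurable (F j)" "j \<le> k" "k \<le> n"
    for h :: "'a \<Rightarrow> 'b :: topological_space" and j k
    using filt that by (intro measurable_from_subalg[OF _ that(1)]) (simp add: finite_filtration_def)
  have X_F: "X k \<in> borel_measurable (F k)" and X_square: "integrable M (\<lambda>\<omega>. (norm (X k \<omega>))\<^sup>2)"
    and X_mean: "AE \<omega> in M. vec_cond_exp M (F (k - 1)) (X k) \<omega> = 0" if "k \<in> {1..n}" for k
    using mart that by (auto simp: martingale_difference_def)
  \<comment> \<open>The index shift matters: V' i is known at time i - 1, so i = Suc k is still
    allowed at time k, and P (Suc k) is measurable with respect to F k, the past of the step that
    adds X (Suc k).\<close>
  have V'_F: "V' i \<in> borel_measurable (F k)" if "i \<in> {1..n}" "i \<le> Suc k" "k \<le> n" for i k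
    unfolding V'_def by (rule mono[OF borel_measurable_mat_cond_exp]) (use that in auto)
  have S_F: "S k \<in> borel_measurable (F k)" if "k \<le> n" for k
    unfolding S_def[abs_def] using that by (intro borel_measurable_sum mono[OF X_F]) auto
  have S_M: "S k \<in> borel_measurable M" if "k \<le> n" for k
    by (rule measurable_from_subalg[OF sub[OF that] S_F[OF that]])
  have X_M: "X k \<in> borel_measurable M" if "k \<in> {1..n}" for k
    by (rule measurable_from_subalg[OF sub X_F[OF that]]) (use that in simp)
  have V'_M: "V' k \<in> borel_measurable M" if "k \<in> {1..n}" for k
    by (rule measurable_from_subalg[OF sub V'_F[of k "k - 1"]]) (use that in auto)
  have P_F: "P (Suc k) \<in> borel_measurable (F k)" if "Suc k \<le> n" for k
    unfolding P_def[abs_def] using that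
    by (intro borel_measurable_diff borel_measurable_const borel_measurable_sum V'_F) auto
  have S_square: "integrable M (\<lambda>\<omega>. (norm (S k \<omega>))\<^sup>2)" if "k \<le> n" for k
    using that
  proof (induction k)
    case (Suc k)
    have [measurable]: "X (Suc k) \<in> borel_measurable M" "S k \<in> borel_measurable M"
      using Suc.prems by (auto intro: X_M S_M)
    have eq: "S (Suc k) \<omega> = S k \<omega> + X (Suc k) \<omega>" for \<omega> by (simp add: S_def)
    show ?case
    proof (rule Bochner_Integration.integrable_bound)
      show "integrable M (\<lambda>\<omega>. 2 * (norm (S k \<omega>))\<^sup>2 + 2 * (norm (X (Suc k) \<omega>))\<^sup>2)"
        using Suc X_square[of "Suc k"] by simp
      show "AE \<omega> in M. norm ((norm (S (Suc k) \<omega>))\<^sup>2) \<le> norm (2 * (norm (S k \<omega>))\<^sup>2 + 2 * (norm (X (Suc k) \<omega>))\<^sup>2)"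
        using norm_add_power2_le by (intro AE_I2) (auto simp: eq)
    qed (unfold eq, measurable)
  qed (simp add: S_def)
  have V_all: "AE \<omega> in M. \<forall>k\<in>{1..n}. V k \<omega> = V' k \<omega> \<and> \<alpha> *\<^sub>R mat 1 \<preceq> V k \<omega> \<and> V k \<omega> \<preceq> \<beta> *\<^sub>R mat 1"
    using V bounds by (intro AE_finite_allI) (auto simp: V'_def intro: AE_conjI)
  \<comment> \<open>Almost surely the clipping changes nothing.\<close>
  have tail: "AE \<omega> in M. (\<forall>k\<in>{1..n}. Vc k \<omega> = V' k \<omega>) \<and> (\<forall>k\<le>n. Q k \<omega> = P k \<omega>) \<and> P n \<omega> = 0"
    using V_all \<Sigma>
  proof eventually_elim
    case (elim \<omega>)
    have P: "P k \<omega> = (\<Sum>i\<in>{Suc k..n}. V i \<omega>)" if "k \<le> n" for k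
    proof -
      have "(\<Sum>i=1..n. V i \<omega>) = (\<Sum>i=1..k. V i \<omega>) + (\<Sum>i\<in>{Suc k..n}. V i \<omega>)"
        using that sum.ub_add_nat[of 1 k "\<lambda>i. V i \<omega>" "n - k"] by simp
      moreover have "(\<Sum>i=1..k. V i \<omega>) = (\<Sum>i=1..k. V' i \<omega>)"
        using elim(1) that by (intro sum.cong) auto
      ultimately show ?thesis using elim(2) by (simp add: P_def algebra_simps)
    qed
    have "Q k \<omega> = P k \<omega>" if k: "k \<le> n" for k
    proof -
      have "\<alpha> *\<^sub>R mat 1 \<preceq> V i \<omega>" "V i \<omega> \<preceq> \<beta> *\<^sub>R mat 1" if "i \<in> {Suc k..n}" for i
        using bspec[OF elim(1), of i] that by auto
      from sum_loewner_bounds[of "{Suc k..n}" \<alpha> "\<lambda>i. V i \<omega>" \<beta>, OF _ this]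
      have "l k *\<^sub>R mat 1 \<preceq> P k \<omega>" "P k \<omega> \<preceq> u k *\<^sub>R mat 1"
        unfolding P[OF k] l_def u_def by auto
      then show ?thesis by (simp add: Q_def loewner_clip_def)
    qed
    moreover have "Vc k \<omega> = V' k \<omega>" if "k \<in> {1..n}" for k
      using bspec[OF elim(1) that] by (auto simp: Vc_def loewner_clip_def)
    ultimately show ?case using P[of n] by simp
  qed
  have step: "conditional_step f g L M (F k) (S k) (X (Suc k)) (Vc (Suc k)) \<alpha> \<beta>" if k: "Suc k \<le> n" for k
  proof
    have Suc_k: "Suc k \<in> {1..n}" using k by simp
    show "subalgebra M (F k)" "S k \<in> borel_measurable (F k)" "integrable M (\<lambda>\<omega>. (norm (S k \<omega>))\<^sup>2)"
      using k by (auto intro: sub S_F S_square)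
    show "Vc (Suc k) \<in> borel_measurable (F k)"
      unfolding Vc_def[abs_def] by (rule measurable_compose[OF V'_F]) (use k in auto)
    show "\<alpha> *\<^sub>R mat 1 \<preceq> Vc (Suc k) \<omega>" "Vc (Suc k) \<omega> \<preceq> \<beta> *\<^sub>R mat 1" for \<omega>
      unfolding Vc_def by (rule loewner_clip_bounds[OF pos(2)])+
    show "0 < \<alpha>" by (rule pos)
    show "X (Suc k) \<in> borel_measurable M" by (rule X_M[OF Suc_k])
    show "integrable M (\<lambda>\<omega>. norm (X (Suc k) \<omega>) ^ 3)" by (rule cube(1)[OF Suc_k])
    show "AE \<omega> in M. real_cond_exp M (F k) (\<lambda>\<omega>. X (Suc k) \<omega> $ i) \<omega> = 0" for i
      using X_mean[OF Suc_k] by eventually_elim (simp add: vec_cond_exp_def vec_eq_iff)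
    show "AE \<omega> in M. real_cond_exp M (F k) (\<lambda>\<omega>. X (Suc k) \<omega> $ i * X (Suc k) \<omega> $ j) \<omega> = Vc (Suc k) \<omega> $ i $ j" for i j
      using tail by eventually_elim (use Suc_k in \<open>auto simp: V'_def mat_cond_exp_def outer_def\<close>)
  qed
  \<comment> \<open>The case k = n is written with f directly: P n is almost surely 0, which has no
    positive definite root.\<close>
  define E where "E k = (if k < n then \<integral>\<omega>. smooth (posdef_sqrt (Q k \<omega>)) (S k \<omega>) \<partial>M else \<integral>\<omega>. f (S n \<omega>) \<partial>M)" for k
  define B where "B k = (if Suc k < n then L / (2 * sqrt (l (Suc k))) * G else L / sqrt \<alpha> * G)" for k
  have E_step: "\<bar>E (Suc k) - E k\<bar> \<le> B k" if k: "k < n" for k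
  proof -
    interpret step: conditional_step f g L M "F k" "S k" "X (Suc k)" "Vc (Suc k)" \<alpha> \<beta>
      by (rule step) (use k in simp)
    have Suc_k: "Suc k \<in> {1..n}" using k by simp
    have S_Suc: "S (Suc k) \<omega> = S k \<omega> + X (Suc k) \<omega>" for \<omega> by (simp add: S_def)
    have P_eq: "P k \<omega> = P (Suc k) \<omega> + V' (Suc k) \<omega>" for \<omega> by (simp add: P_def)
    have [measurable]: "S k \<in> borel_measurable M" "X (Suc k) \<in> borel_measurable M"
      using step.x_M step.X_M by auto
    have smooth_M: "(\<lambda>\<omega>. smooth (posdef_sqrt (W \<omega>)) (S k \<omega>)) \<in> borel_measurable M"
      if "W \<in> borel_measurable M" "\<And>\<omega>. r *\<^sub>R mat 1 \<preceq> W \<omega>" "0 < r" for W r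
      by (rule measurable_smooth[OF borel_measurable_posdef_sqrt(1)[OF that]]) measurable
    \<comment> \<open>Q k may be exchanged for any matrix almost surely equal to it and bounded
      below at every point: Q (Suc k) + Vc (Suc k) in an ordinary step, Vc (Suc k) in the last
      one.\<close>
    have E_eq: "E k = (\<integral>\<omega>. smooth (posdef_sqrt (W \<omega>)) (S k \<omega>) \<partial>M)"
      if W: "W \<in> borel_measurable M" "\<And>\<omega>. r *\<^sub>R mat 1 \<preceq> W \<omega>" "0 < r" and ae: "AE \<omega> in M. Q k \<omega> = W \<omega>" for W r
    proof -
      have Q_M: "Q k \<in> borel_measurable M"
        unfolding Q_def[abs_def] P_def using k V'_M
        by (intro measurable_compose[OF _ borel_measurable_loewner_clip] borel_measurable_diff borel_measurable_sum) auto
      have "0 < l k" unfolding l_def using k pos by simp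
      moreover have "l k *\<^sub>R mat 1 \<preceq> Q k \<omega>" for \<omega>
        unfolding Q_def by (rule loewner_clip_bounds[OF lu])
      ultimately show ?thesis
        unfolding E_def using k ae
        by (simp, intro integral_cong_AE smooth_M[OF W] smooth_M[OF Q_M]) auto
    qed
    show ?thesis
    proof (cases "Suc k < n")
      case True
      have l_pos: "0 < l (Suc k)" unfolding l_def using True pos by simp
      have Q_F: "Q (Suc k) \<in> borel_measurable (F k)"
        unfolding Q_def[abs_def] by (rule measurable_compose[OF P_F]) (use k in auto)
      note Q_bounds = loewner_clip_bounds[OF lu, of "Suc k" "P (Suc k) _", folded Q_def]
      have "E (Suc k) = (\<integral>\<omega>. smooth (posdef_sqrt (Q (Suc k) \<omega>)) (S k \<omega> + X (Suc k) \<omega>) \<partial>M)"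
        using True by (simp add: E_def S_Suc)
      moreover have "E k = (\<integral>\<omega>. smooth (posdef_sqrt (Q (Suc k) \<omega> + Vc (Suc k) \<omega>)) (S k \<omega>) \<partial>M)"
      proof (rule E_eq)
        show "(\<lambda>\<omega>. Q (Suc k) \<omega> + Vc (Suc k) \<omega>) \<in> borel_measurable M"
          using step.F_imp_M[OF Q_F] step.V_M by measurable
        show "(l (Suc k) + \<alpha>) *\<^sub>R mat 1 \<preceq> Q (Suc k) \<omega> + Vc (Suc k) \<omega>" for \<omega>
          by (rule loewner_ge_add[OF Q_bounds(1) step.V_ge])
        show "0 < l (Suc k) + \<alpha>" using l_pos pos by simp
        show "AE \<omega> in M. Q k \<omega> = Q (Suc k) \<omega> + Vc (Suc k) \<omega>"
          using tail by eventually_elim (use k Suc_k P_eq in auto)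
      qed
      moreover have "L / (2 * sqrt (l (Suc k))) * (\<integral>\<omega>. norm (X (Suc k) \<omega>) ^ 3 \<partial>M) \<le> B k"
        using True L_nonneg l_pos cube(2)[OF Suc_k] unfolding B_def by (simp, intro mult_left_mono divide_right_mono) auto
      ultimately show ?thesis
        using step.expectation_smooth_increment[OF Q_F Q_bounds l_pos] by simp
    next
      case False
      then have n_eq: "n = Suc k" using k by simp
      have "E (Suc k) = (\<integral>\<omega>. f (S k \<omega> + X (Suc k) \<omega>) \<partial>M)"
        by (simp add: E_def n_eq S_Suc)
      moreover have "E k = (\<integral>\<omega>. smooth (posdef_sqrt (Vc (Suc k) \<omega>)) (S k \<omega>) \<partial>M)"
      proof (rule E_eq)
        show "AE \<omega> in M. Q k \<omega> = Vc (Suc k) \<omega>"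
          using tail by eventually_elim (use k Suc_k P_eq n_eq in auto)
      qed (fact step.V_M step.V_ge step.a_pos)+
      moreover have "L / sqrt \<alpha> * (\<integral>\<omega>. norm (X (Suc k) \<omega>) ^ 3 \<partial>M) \<le> B k"
        using False L_nonneg pos cube(2)[OF Suc_k] unfolding B_def by (simp, intro mult_left_mono divide_right_mono) auto
      ultimately show ?thesis
        using step.expectation_smooth_last_increment by simp
    qed
  qed
  have "\<bar>E n - E 0\<bar> = \<bar>\<Sum>k<n. E (Suc k) - E k\<bar>" by (simp add: sum_lessThan_telescope)
  also have "\<dots> \<le> (\<Sum>k<n. B k)"
    by (rule order_trans[OF sum_abs sum_mono]) (use E_step in auto)
  also have "\<dots> \<le> L * G / sqrt \<alpha> * (2 * sqrt (real n))"
  proof -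
    obtain m where m: "n = Suc m" using n by (cases n) auto
    have "(\<Sum>k<n. B k) = (\<Sum>k<m. B k) + L / sqrt \<alpha> * G" by (simp add: m B_def)
    also have "(\<Sum>k<m. B k) = (\<Sum>k<m. L * G / (2 * sqrt \<alpha>) * (1 / sqrt (real (m - k))))"
      by (intro sum.cong) (auto simp: B_def m l_def real_sqrt_mult)
    also have "\<dots> = L * G / (2 * sqrt \<alpha>) * (\<Sum>k<m. 1 / sqrt (real (m - k)))"
      by (simp add: sum_distrib_left)
    also have "(\<Sum>k<m. 1 / sqrt (real (m - k))) = (\<Sum>j=1..m. 1 / sqrt (real j))"
      by (rule sum.reindex_bij_witness[of _ "\<lambda>j. m - j" "\<lambda>k. m - k"]) auto
    also have "L * G / (2 * sqrt \<alpha>) * (\<Sum>j=1..m. 1 / sqrt (real j)) \<le> L * G / (2 * sqrt \<alpha>) * (2 * sqrt (real m))"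
      using L_nonneg G pos by (intro mult_left_mono sum_inverse_sqrt_le) auto
    also have "L * G / (2 * sqrt \<alpha>) * (2 * sqrt (real m)) + L / sqrt \<alpha> * G = L * G / sqrt \<alpha> * (sqrt (real m) + 1)"
      by (simp add: distrib_left mult_ac add_divide_distrib)
    \<comment> \<open>The smoothed steps contribute sqrt m and the last step 1; the crude bound by 2
      sqrt n is the source of the factor 2 in the conclusion.\<close>
    also have "\<dots> \<le> L * G / sqrt \<alpha> * (2 * sqrt (real n))"
    proof (intro mult_left_mono)
      have "sqrt (real m) \<le> sqrt (real n)" "1 \<le> sqrt (real n)" by (auto simp: m)
      then show "sqrt (real m) + 1 \<le> 2 * sqrt (real n)" by linarith
    qed (use L_nonneg G pos in auto)
    finally show ?thesis by simp
  qed
  finally have "\<bar>E n - E 0\<bar> \<le> 2 * L * G * sqrt (real n) / sqrt \<alpha>" by (simp add: mult_ac)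
  moreover have "E n = (\<integral>\<omega>. f (\<Sum>i=1..n. X i \<omega>) \<partial>M)" by (simp add: E_def S_def)
  moreover have "E 0 = smooth (posdef_sqrt \<Sigma>) 0"
  proof -
    \<comment> \<open>An almost sure statement about constants holds outright in a probability
      space.\<close>
    have "AE \<omega> in M. loewner_clip (l 0) (u 0) \<Sigma> = \<Sigma>"
      using tail by eventually_elim (auto simp: Q_def P_def)
    then show ?thesis using n by (simp add: E_def Q_def P_def S_def prob_space)
  qed
  ultimately show ?thesis by simp
qed

section \<open>From M2 to a Lipschitz gradient, and the normalised bound\<close>

lemma GDERIV_gradient:
  fixes h :: "real^'d \<Rightarrow> real"
  assumes "h differentiable (at x)"
  shows "GDERIV h x :> gradient h x"
proof -
  obtain D where D: "(h has_derivative D) (at x)"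
    using assms by (auto simp: differentiable_def)
  have lin: "linear D" using D by (rule has_derivative_linear)
  define v where "v = (\<chi> i. D (axis i 1))"
  have "D = (\<lambda>y. y \<bullet> v)"
  proof
    fix y :: "real^'d"
    have "D y = D (\<Sum>i\<in>UNIV. y $ i *\<^sub>R axis i 1)"
      by (simp add: basis_expansion[of y, unfolded scalar_mult_eq_scaleR])
    also have "\<dots> = y \<bullet> v"
      by (simp add: linear_sum[OF lin] linear_scale[OF lin] inner_vec_def v_def)
    finally show "D y = y \<bullet> v" .
  qed
  then have v: "GDERIV h x :> v" using D by (simp add: gderiv_def)
  moreover have "w = v" if "GDERIV h x :> w" for w
  proof -
    have "(\<lambda>y. y \<bullet> w) = (\<lambda>y. y \<bullet> v)"
      using that v unfolding gderiv_def by (rule has_derivative_unique)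
    then have "(w - v) \<bullet> w = (w - v) \<bullet> v" by meson
    then have "(w - v) \<bullet> (w - v) = 0" by (simp add: inner_diff_right)
    then show "w = v" by simp
  qed
  ultimately show ?thesis unfolding gradient_def by (rule theI)
qed

lemma norm_gradient_diff_le_M2:
  assumes "M2 h < \<infinity>"
  shows "norm (gradient h x - gradient h y) \<le> enn2real (M2 h) * norm (x - y)"
proof (cases "x = y")
  case False
  have "ennreal (norm (gradient h x - gradient h y) / norm (x - y)) \<le> M2 h"
    unfolding M2_def using False by (intro SUP_upper2[of "(x, y)"]) auto
  then have "norm (gradient h x - gradient h y) / norm (x - y) \<le> enn2real (M2 h)"
    using assms by (metis enn2real_mono enn2real_ennreal divide_nonneg_nonneg norm_ge_zero infinity_ennreal_def)
  then show ?thesis using False by (simp add: divide_le_eq)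
qed simp

theorem corollary2:
  fixes M :: "'a measure" and N :: "'b measure"
    and F :: "nat \<Rightarrow> 'a measure"
    and X :: "nat \<Rightarrow> 'a \<Rightarrow> real^'d"
    and V :: "nat \<Rightarrow> 'a \<Rightarrow> real^'d^'d"
    and S :: "'a \<Rightarrow> real^'d"
    and \<Sigma> :: "real^'d^'d"
    and Z :: "'b \<Rightarrow> real^'d"
    and h :: "real^'d \<Rightarrow> real"
    and n :: nat
    and \<alpha> \<beta> \<gamma> :: real
  assumes "prob_space M"
    and "n \<ge> 1"
    and "finite_filtration M n F"
    and "martingale_difference M n F X"
    and "\<And>k. k \<in> {1..n} \<Longrightarrow>
           AE \<omega> in M. V k \<omega> = mat_cond_exp M (F (k - 1)) (\<lambda>\<omega>. outer (X k \<omega>) (X k \<omega>)) \<omega>"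
    and "S = (\<lambda>\<omega>. \<Sum>i=1..n. X i \<omega>)"
    and "\<Sigma> = covariance_matrix M S"
    and "AE \<omega> in M. (\<Sum>i=1..n. V i \<omega>) = \<Sigma>"
    and "\<alpha> > 0" and "\<beta> > 0" and "\<gamma> > 0"
    and "\<And>k. k \<in> {1..n} \<Longrightarrow>
           AE \<omega> in M. \<alpha> *\<^sub>R mat 1 \<preceq> V k \<omega> \<and> V k \<omega> \<preceq> \<beta> *\<^sub>R mat 1"
    and "\<And>k. k \<in> {1..n} \<Longrightarrow> integrable M (\<lambda>\<omega>. norm (X k \<omega>) ^ 3)"
    and "\<And>k. k \<in> {1..n} \<Longrightarrow>
           (\<integral>\<omega>. norm (X k \<omega>) ^ 3 \<partial>M) \<le> \<gamma> * real CARD('d) powr (3 / 2)"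
    and "prob_space N"
    and "distributed N lborel Z (\<lambda>x. ennreal (std_gaussian_density x))"
    and "twice_differentiable h"
    and "M2 h < \<infinity>"
  shows "\<bar>(\<integral>\<omega>. h (matrix_inv (posdef_sqrt \<Sigma>) *v S \<omega>) \<partial>M) - (\<integral>\<omega>. h (Z \<omega>) \<partial>N)\<bar>
           \<le> 3 * pi * \<gamma> * sqrt \<beta> / (4 * \<alpha>\<^sup>2) * enn2real (M2 h) * (real CARD('d))\<^sup>2 / sqrt (real n)"
proof -
  interpret prob_space M by (rule assms(1))
  interpret N: prob_space N by (rule assms(15))
  define l where "l = real n * \<alpha>"
  have n: "0 < real n" using assms(2) by simp
  have l: "0 < l" unfolding l_def using n assms(9) by simp
  have bounds_all: "AE \<omega> in M. (\<forall>k\<in>{1..n}. \<alpha> *\<^sub>R mat 1 \<preceq> V k \<omega> \<and> V k \<omega> \<preceq> \<beta> *\<^sub>R mat 1) \<and> (\<Sum>i=1..n. V i \<omega>) = \<Sigma>"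
    using assms(8,12) by (intro AE_conjI AE_finite_allI) auto
  \<comment> \<open>\<Sigma> is deterministic, so its lower bound n \<alpha> can be read off at a
    single sample point where all almost sure relations hold.\<close>
  obtain \<omega>0 where \<omega>0: "\<And>k. k \<in> {1..n} \<Longrightarrow> \<alpha> *\<^sub>R mat 1 \<preceq> V k \<omega>0" "\<And>k. k \<in> {1..n} \<Longrightarrow> V k \<omega>0 \<preceq> \<beta> *\<^sub>R mat 1"
    "(\<Sum>i=1..n. V i \<omega>0) = \<Sigma>"
  proof -
    have "\<exists>\<omega>. (\<forall>k\<in>{1..n}. \<alpha> *\<^sub>R mat 1 \<preceq> V k \<omega> \<and> V k \<omega> \<preceq> \<beta> *\<^sub>R mat 1) \<and> (\<Sum>i=1..n. V i \<omega>) = \<Sigma>"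
    proof (rule ccontr)
      assume no: "\<not> ?thesis"
      have "AE \<omega> in M. False" using bounds_all by eventually_elim (use no in blast)
      then show False by simp
    qed
    then show thesis using that by blast
  qed
  have \<Sigma>_ge: "l *\<^sub>R mat 1 \<preceq> \<Sigma>"
    using sum_loewner_bounds(1)[of "{1..n}" \<alpha> "\<lambda>k. V k \<omega>0" \<beta>] \<omega>0 by (simp add: l_def)
  have "\<alpha> *\<^sub>R mat 1 \<preceq> V 1 \<omega>0" "V 1 \<omega>0 \<preceq> \<beta> *\<^sub>R mat 1" using \<omega>0 assms(2) by auto
  \<comment> \<open>Testing the two matrix bounds on one unit vector yields \<alpha> <=
    \<beta>.\<close>
  then have "\<alpha> * (norm (axis undefined 1 :: real^'d))\<^sup>2 \<le> \<beta> * (norm (axis undefined 1 :: real^'d))\<^sup>2"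
    unfolding scaleR_mat_1_loewner_le_iff loewner_le_scaleR_mat_1_iff by (meson order_trans)
  then have \<alpha>\<beta>: "\<alpha> \<le> \<beta>" by simp
  let ?R = "posdef_sqrt \<Sigma>"
  let ?A = "matrix_inv ?R"
  note R = posdef_sqrt_props[OF \<Sigma>_ge l]
  note A_inv = matrix_inv_mult[OF R(4)]
  have A_sym: "transpose ?A = ?A" by (rule matrix_inv_symmetric[OF R(4,3)])
  have A_le: "norm (?A *v x) \<le> norm x / sqrt l" for x
    by (rule norm_matrix_inv_posdef_sqrt_mult_vec_le[OF \<Sigma>_ge l])
  define m where "m = enn2real (M2 h)"
  have m: "0 \<le> m" by (simp add: m_def)
  have h_grad: "GDERIV h x :> gradient h x" for x
    using assms(17) by (intro GDERIV_gradient) (simp add: twice_differentiable_def)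
  have "continuous_on UNIV h"
    using h_grad by (auto simp: gderiv_def intro!: continuous_at_imp_continuous_on has_derivative_continuous)
  then have h_meas[measurable]: "h \<in> borel_measurable borel" by (rule borel_measurable_continuous_onI)
  define f where "f x = h (?A *v x)" for x
  define g where "g x = ?A *v gradient h (?A *v x)" for x
  interpret lipschitz_gradient f g "m / l"
  proof
    show "GDERIV f x :> g x" for x
    proof -
      have A: "((*v) ?A has_derivative (*v) ?A) (at x)"
        by (intro bounded_linear_imp_has_derivative matrix_vector_mul_bounded_linear)
      have "(h has_derivative (\<lambda>y. y \<bullet> gradient h (?A *v x))) (at (?A *v x))"
        using h_grad[of "?A *v x"] by (simp only: gderiv_def)
      from has_derivative_compose[OF A this]
      have "((\<lambda>x. h (?A *v x)) has_derivative (\<lambda>y. (?A *v y) \<bullet> gradient h (?A *v x))) (at x)" .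
      then show ?thesis
        unfolding gderiv_def f_def g_def by (simp add: symmetric_inner_matrix_vector[OF A_sym])
    qed
    \<comment> \<open>\<Sigma>^(-1/2) acts twice, inside the gradient and in front of it; each
      action costs 1 / sqrt l, hence m / l with l = n \<alpha>.\<close>
    show "norm (g x - g y) \<le> m / l * norm (x - y)" for x y
    proof -
      have "norm (g x - g y) = norm (?A *v (gradient h (?A *v x) - gradient h (?A *v y)))"
        by (simp add: g_def matrix_vector_mult_diff_distrib)
      also have "\<dots> \<le> norm (gradient h (?A *v x) - gradient h (?A *v y)) / sqrt l" by (rule A_le)
      also have "\<dots> \<le> (m * norm (?A *v x - ?A *v y)) / sqrt l"
        unfolding m_def using l by (intro divide_right_mono norm_gradient_diff_le_M2 assms(18)) auto
      also have "\<dots> \<le> (m * (norm (x - y) / sqrt l)) / sqrt l"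
        using l m A_le[of "x - y"]
        by (intro divide_right_mono mult_left_mono) (auto simp: matrix_vector_mult_diff_distrib)
      also have "\<dots> = m / l * norm (x - y)" using l by (simp add: field_simps)
      finally show ?thesis .
    qed
    show "0 \<le> m / l" using l m by simp
  qed
  define G where "G = \<gamma> * real CARD('d) powr (3 / 2)"
  have main: "\<bar>(\<integral>\<omega>. f (\<Sum>i=1..n. X i \<omega>) \<partial>M) - smooth (posdef_sqrt \<Sigma>) 0\<bar> \<le> 2 * (m / l) * G * sqrt (real n) / sqrt \<alpha>"
    unfolding G_def
    by (rule martingale_smooth_bound[OF assms(1,2,3,4,5,8,9) \<alpha>\<beta> assms(12,13,14)])
  \<comment> \<open>At the origin the smoothing by \<Sigma>^(1/2) z and the normalisation by
    \<Sigma>^(-1/2) cancel.\<close>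
  have "smooth ?R 0 = (\<integral>z. h z \<partial>gauss)"
    using A_inv(2) by (simp add: smooth_def f_def matrix_vector_mul_assoc)
  also have "\<dots> = (\<integral>z. h z \<partial>distr N lborel Z)"
    unfolding gauss_def using distributed_distr_eq_density[OF assms(16)] by simp
  also have "\<dots> = (\<integral>\<omega>. h (Z \<omega>) \<partial>N)"
    using distributed_measurable[OF assms(16)] by (subst integral_distr) auto
  finally have smooth_eq: "smooth ?R 0 = (\<integral>\<omega>. h (Z \<omega>) \<partial>N)" .
  let ?d = "real CARD('d)"
  have "2 * (m / l) * G * sqrt (real n) / sqrt \<alpha> \<le>
      3 * pi * \<gamma> * sqrt \<beta> / (4 * \<alpha>\<^sup>2) * m * ?d\<^sup>2 / sqrt (real n)"
  proof -
    have d: "1 \<le> ?d" by (simp add: Suc_leI)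
    have "?d powr (3 / 2) \<le> ?d powr 2" using d by (intro powr_mono) auto
    then have d_le: "?d powr (3 / 2) \<le> ?d\<^sup>2" using d by simp
    \<comment> \<open>All slack in the final constant: 2 <= 3 pi / 4, \<alpha> <= \<beta> and
      d^(3/2) <= d^2. The root of \<alpha> appears on the left because \<alpha>^(-3/2) is written as
      sqrt \<alpha> / \<alpha>^2.\<close>
    have "2 * (sqrt \<alpha> * ?d powr (3 / 2)) \<le> (3 * pi / 4) * (sqrt \<beta> * ?d\<^sup>2)"
      using pi_gt3 assms(9) \<alpha>\<beta> d_le by (intro mult_mono) auto
    then have "2 * (sqrt \<alpha> * ?d powr (3 / 2)) * (m * \<gamma> / (\<alpha>\<^sup>2 * sqrt (real n))) \<le>
        (3 * pi / 4) * (sqrt \<beta> * ?d\<^sup>2) * (m * \<gamma> / (\<alpha>\<^sup>2 * sqrt (real n)))"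
      using m assms(9,11) by (intro mult_right_mono) auto
    moreover have "2 * (m / l) * G * sqrt (real n) / sqrt \<alpha> =
        2 * (sqrt \<alpha> * ?d powr (3 / 2)) * (m * \<gamma> / (\<alpha>\<^sup>2 * sqrt (real n)))"
    proof -
      have "sqrt (real n) / real n = 1 / sqrt (real n)" "1 / (\<alpha> * sqrt \<alpha>) = sqrt \<alpha> / \<alpha>\<^sup>2"
        using n assms(9) by (simp_all add: field_simps power2_eq_square)
      moreover have "2 * (m / l) * G * sqrt (real n) / sqrt \<alpha> =
          2 * m * \<gamma> * ?d powr (3 / 2) * (sqrt (real n) / real n) * (1 / (\<alpha> * sqrt \<alpha>))"
        by (simp add: l_def G_def)
      ultimately show ?thesis by (simp add: mult_ac)
    qed
    ultimately show ?thesis by (simp add: mult_ac)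
  qed
  with main show ?thesis
    unfolding smooth_eq m_def[symmetric] assms(6) f_def by simp
qed

end
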